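(* Let $g\in L^2(0,2\pi)\setminus H^1(0,2\pi)$. Then the least squares, the dual least squares and the Bubnov-Galerkin methods with trigonometric polynomials for the equation $K\Psi=g$ all diverge to infinity with first order rate; that is, for each $\tau\in\{LS,DLS,BG\}$, $$\lim_{n\to\infty}\big\|(K_n^{\tau})^{\dagger}Q_n^{\tau}g\big\|_{L^2}=\infty\qquad\text{and}\qquad \big\|(K_n^{\tau})^{\dagger}Q_n^{\tau}g\big\|_{L^2}=O(n)\quad(n\to\infty).$$ Moreover the first order rate is optimal, in the following sense: when $\Omega$ is the disc centred at the origin with radius $e^{-1/2}$, parametrized by $\gamma(s)=e^{-1/2}(\cos s,\sin s)$, for every $\alpha\in(0,\tfrac12)$ there exist $g\in L^2(0,2\pi)\setminus H^1(0,2\pi)$ and $c>0$ such that $\|(K_n^{\tau})^{\dagger}Q_n^{\tau}g\|_{L^2}\ge c\,n^{1-\alpha}$ for all $n\ge1$ and all $\tau\in\{LS,DLS,BG\}$.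
   Context: Setting: $\Omega\subset\mathbb{R}^2$ is a bounded simply connected domain whose boundary $\partial\Omega$ is a closed curve of class $C^3$, i.e. it has a $2\pi$-periodic, three times continuously differentiable (simple closed) parametrization $\gamma(s)=(a(s),b(s))$, $s\in[0,2\pi]$, with $|\dot\gamma(s)|>0$ for all $s$. It is assumed that there exists $z_0\in\Omega$ with $|x-z_0|\neq1$ for all $x\in\partial\Omega$. Symm's integral operator is $K:L^2(0,2\pi)\to L^2(0,2\pi)$, $$(K\Psi)(t)=-\frac1\pi\int_0^{2\pi}\Psi(s)\ln|\gamma(t)-\gamma(s)|\,ds .$$ For $r\ge0$, $H^r(0,2\pi)$ is the periodic Sobolev space of all $\sum_{k\in\mathbb{Z}}a_ke^{ikt}$ with $\sum_k(1+k^2)^r|a_k|^2<\infty$; $H^0(0,2\pi)=L^2(0,2\pi)$. Projection methods: given finite-dimensional subspaces $X_n,Y_n\subseteq L^2(0,2\pi)$, let $P_n,Q_n$ be the orthogonal projections of $L^2(0,2\pi)$ onto $X_n,Y_n$ and let $K_n:=Q_nKP_n:X_n\to Y_n$. $(K_n)^\dagger$ denotes the Moore-Penrose inverse of $K_n:X_n\to Y_n$ (which is the usual inverse when $K_n$ is invertible). With $T_n:=\mathrm{span}\{e^{ikt}:-n\le k\le n\}$ the three methods (superscript $\tau$) are: least squares ($LS$): $X_n^{LS}=T_n$, $Y_n^{LS}=K(T_n)$; dual least squares ($DLS$): $Y_n^{DLS}=T_n$, $X_n^{DLS}=K^*(T_n)$, $K^*$ being the adjoint of $K$ in $L^2(0,2\pi)$;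 Bubnov-Galerkin ($BG$): $X_n^{BG}=Y_n^{BG}=T_n$. *)

theory Defs
  imports "HOL-Analysis.Analysis" "HOL-Library.Landau_Symbols"
begin

section \<open>The complex Hilbert space of square-integrable functions on \<open>(0, 2\<pi>)\<close>\<close>

abbreviation per_measure :: "real measure" where
  "per_measure \<equiv> restrict_space lborel {0<..<2 * pi}"

definition sq_integrable :: "(real \<Rightarrow> complex) \<Rightarrow> bool" where
  "sq_integrable f \<longleftrightarrow>
     f \<in> borel_measurable per_measure \<and> integrable per_measure (\<lambda>t. (cmod (f t))\<^sup>2)"

definition l2_rel :: "(real \<Rightarrow> complex) \<Rightarrow> (real \<Rightarrow> complex) \<Rightarrow> bool" where
  "l2_rel f g \<longleftrightarrow> sq_integrable f \<and> sq_integrable g \<and> (AE t in per_measure. f t = g t)"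

lemma sq_integrable_measurable [measurable_dest]:
  "sq_integrable f \<Longrightarrow> f \<in> borel_measurable per_measure"
  by (simp add: sq_integrable_def)

lemma sq_integrable_const: "sq_integrable (\<lambda>t. c)"
proof -
  have "finite_measure per_measure"
    by (rule finite_measureI) (simp add: emeasure_restrict_space space_restrict_space)
  then show ?thesis
    by (simp add: sq_integrable_def finite_measure.integrable_const)
qed

lemma sq_integrable_add:
  assumes "sq_integrable f" "sq_integrable g"
  shows "sq_integrable (\<lambda>t. f t + g t)"
proof -
  note [measurable] = assms[THEN sq_integrable_measurable]
  have "integrable per_measure (\<lambda>t. 2 * (cmod (f t))\<^sup>2 + 2 * (cmod (g t))\<^sup>2)"
    using assms by (simp add: sq_integrable_def)
  then have "integrable per_measure (\<lambda>t. (cmod (f t + g t))\<^sup>2)"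
  proof (rule Bochner_Integration.integrable_bound)
    have "(cmod (f t + g t))\<^sup>2 \<le> 2 * (cmod (f t))\<^sup>2 + 2 * (cmod (g t))\<^sup>2" for t
    proof -
      have "(cmod (f t + g t))\<^sup>2 \<le> (cmod (f t) + cmod (g t))\<^sup>2"
        by (intro power_mono norm_triangle_ineq) auto
      also have "\<dots> \<le> 2 * (cmod (f t))\<^sup>2 + 2 * (cmod (g t))\<^sup>2"
        using zero_le_power2[of "cmod (f t) - cmod (g t)"]
        by (simp add: power2_sum power2_diff)
      finally show ?thesis .
    qed
    then show "AE t in per_measure. norm ((cmod (f t + g t))\<^sup>2)
        \<le> norm (2 * (cmod (f t))\<^sup>2 + 2 * (cmod (g t))\<^sup>2)"
      by simp
  qed measurable
  then show ?thesis by (simp add: sq_integrable_def)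
qed

lemma sq_integrable_cmult:
  assumes "sq_integrable f"
  shows "sq_integrable (\<lambda>t. c * f t)"
  using assms by (auto simp: sq_integrable_def norm_mult power_mult_distrib)

lemma integrable_mult_cnj:
  assumes "sq_integrable f" "sq_integrable g"
  shows "integrable per_measure (\<lambda>t. f t * cnj (g t))"
proof -
  have "integrable per_measure (\<lambda>t. (cmod (f t))\<^sup>2 + (cmod (g t))\<^sup>2)"
    using assms by (simp add: sq_integrable_def)
  then show ?thesis
  proof (rule Bochner_Integration.integrable_bound)
    have "cmod (f t) * cmod (g t) \<le> (cmod (f t))\<^sup>2 + (cmod (g t))\<^sup>2" for t
    proof -
      have "2 * (cmod (f t) * cmod (g t)) \<le> (cmod (f t))\<^sup>2 + (cmod (g t))\<^sup>2"
        using zero_le_power2[of "cmod (f t) - cmod (g t)"] by (simp add: power2_diff)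
      moreover have "0 \<le> cmod (f t) * cmod (g t)" by simp
      ultimately show ?thesis by linarith
    qed
    then show "AE t in per_measure. norm (f t * cnj (g t))
        \<le> norm ((cmod (f t))\<^sup>2 + (cmod (g t))\<^sup>2)"
      by (simp add: norm_mult)
    have cnj: "cnj \<in> borel_measurable borel"
      by (intro borel_measurable_continuous_onI continuous_intros)
    show "(\<lambda>t. f t * cnj (g t)) \<in> borel_measurable per_measure"
      by (intro borel_measurable_times measurable_compose[OF _ cnj]
          sq_integrable_measurable assms)
  qed
qed

quotient_type l2 = "real \<Rightarrow> complex" / partial: l2_rel
proof (rule part_equivpI)
  show "\<exists>f. l2_rel f f"
    using sq_integrable_const[of 0] by (auto simp: l2_rel_def)
  show "symp l2_rel"
    by (auto simp: symp_def l2_rel_def elim: AE_mp)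
  show "transp l2_rel"
  proof (rule transpI)
    fix f g h assume "l2_rel f g" "l2_rel g h"
    then show "l2_rel f h" unfolding l2_rel_def by (auto elim: AE_mp)
  qed
qed

lift_definition cscale :: "complex \<Rightarrow> l2 \<Rightarrow> l2" is "\<lambda>c f t. c * f t"
  by (auto simp: l2_rel_def sq_integrable_cmult)

lift_definition cinner :: "l2 \<Rightarrow> l2 \<Rightarrow> complex" is
  "\<lambda>f g. \<integral>t. f t * cnj (g t) \<partial>per_measure"
proof -
  fix f f' g g' assume *: "l2_rel f f'" "l2_rel g g'"
  have meas: "(\<lambda>t. u t * cnj (v t)) \<in> borel_measurable per_measure"
    if "sq_integrable u" "sq_integrable v" for u v
    using integrable_mult_cnj[OF that] by auto
  show "(\<integral>t. f t * cnj (g t) \<partial>per_measure) = (\<integral>t. f' t * cnj (g' t) \<partial>per_measure)"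
  proof (rule integral_cong_AE)
    show "AE t in per_measure. f t * cnj (g t) = f' t * cnj (g' t)"
      using * by (auto simp: l2_rel_def elim: AE_mp)
  qed (use * in \<open>auto simp: l2_rel_def intro: meas\<close>)
qed

instantiation l2 :: real_vector
begin

lift_definition zero_l2 :: l2 is "\<lambda>t. 0"
  by (simp add: l2_rel_def sq_integrable_const)

lift_definition plus_l2 :: "l2 \<Rightarrow> l2 \<Rightarrow> l2" is "\<lambda>f g t. f t + g t"
  by (auto simp: l2_rel_def sq_integrable_add elim: AE_mp)

lift_definition uminus_l2 :: "l2 \<Rightarrow> l2" is "\<lambda>f t. - f t"
  using sq_integrable_cmult[where c = "-1"] by (auto simp: l2_rel_def)

definition minus_l2 :: "l2 \<Rightarrow> l2 \<Rightarrow> l2" where "minus_l2 f g = f + - g"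

definition scaleR_l2 :: "real \<Rightarrow> l2 \<Rightarrow> l2" where "scaleR_l2 r = cscale (of_real r)"

instance
proof
  fix f g h :: l2 and r s :: real
  show "f + g + h = f + (g + h)"
    by transfer (auto simp: l2_rel_def sq_integrable_add add.assoc)
  show "f + g = g + f"
    by transfer (auto simp: l2_rel_def sq_integrable_add add.commute)
  show "0 + f = f"
    by transfer (auto simp: l2_rel_def)
  show "- f + f = 0"
    by transfer (auto simp: l2_rel_def sq_integrable_const)
  show "f - g = f + - g" by (simp add: minus_l2_def)
  show "r *\<^sub>R (f + g) = r *\<^sub>R f + r *\<^sub>R g"
    unfolding scaleR_l2_def
    by transfer (auto simp: l2_rel_def sq_integrable_add sq_integrable_cmult distrib_left
        intro!: sq_integrable_add sq_integrable_cmult)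
  show "(r + s) *\<^sub>R f = r *\<^sub>R f + s *\<^sub>R f"
    unfolding scaleR_l2_def of_real_add
    by transfer (auto simp: l2_rel_def distrib_right
        intro!: sq_integrable_add sq_integrable_cmult)
  show "r *\<^sub>R s *\<^sub>R f = (r * s) *\<^sub>R f"
    unfolding scaleR_l2_def of_real_mult
    by transfer (auto simp: l2_rel_def mult.assoc intro!: sq_integrable_cmult)
  show "1 *\<^sub>R f = f"
    unfolding scaleR_l2_def of_real_1 by transfer (auto simp: l2_rel_def)
qed

end

instantiation l2 :: real_inner
begin

definition inner_l2 :: "l2 \<Rightarrow> l2 \<Rightarrow> real" where "inner_l2 f g = Re (cinner f g)"

lift_definition norm_l2 :: "l2 \<Rightarrow> real" is
  "\<lambda>f. sqrt (\<integral>t. (cmod (f t))\<^sup>2 \<partial>per_measure)"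
proof -
  fix f g assume *: "l2_rel f g"
  then have "sq_integrable f" "sq_integrable g" by (auto simp: l2_rel_def)
  note this[THEN sq_integrable_measurable, measurable]
  have "(\<integral>t. (cmod (f t))\<^sup>2 \<partial>per_measure) = (\<integral>t. (cmod (g t))\<^sup>2 \<partial>per_measure)"
    by (rule integral_cong_AE) (use * in \<open>auto simp: l2_rel_def elim: AE_mp\<close>)
  then show "sqrt (\<integral>t. (cmod (f t))\<^sup>2 \<partial>per_measure) = sqrt (\<integral>t. (cmod (g t))\<^sup>2 \<partial>per_measure)"
    by simp
qed

definition dist_l2 :: "l2 \<Rightarrow> l2 \<Rightarrow> real" where "dist_l2 f g = norm (f - g)"

definition sgn_l2 :: "l2 \<Rightarrow> l2" where "sgn_l2 f = f /\<^sub>R norm f"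

definition uniformity_l2 :: "(l2 \<times> l2) filter" where
  "uniformity_l2 = (INF e\<in>{0<..}. principal {(x, y). dist x y < e})"

definition open_l2 :: "l2 set \<Rightarrow> bool" where
  "open_l2 U \<longleftrightarrow> (\<forall>x\<in>U. eventually (\<lambda>(x', y). x' = x \<longrightarrow> y \<in> U) uniformity)"

instance
proof
  fix f g h :: l2 and r :: real
  show "dist f g = norm (f - g)" by (simp add: dist_l2_def)
  show "sgn f = f /\<^sub>R norm f" by (simp add: sgn_l2_def)
  show "(uniformity :: (l2 \<times> l2) filter) = (INF e\<in>{0<..}. principal {(x, y). dist x y < e})"
    by (simp add: uniformity_l2_def)
  show "open U \<longleftrightarrow> (\<forall>x\<in>U. eventually (\<lambda>(x', y). x' = x \<longrightarrow> y \<in> U) uniformity)" for U :: "l2 set"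
    by (simp add: open_l2_def)
  have "cinner f g = cnj (cinner g f)"
  proof transfer
    fix f g :: "real \<Rightarrow> complex"
    have "(\<integral>t. f t * cnj (g t) \<partial>per_measure) = (\<integral>t. cnj (g t * cnj (f t)) \<partial>per_measure)"
      by (simp add: mult.commute)
    then show "(\<integral>t. f t * cnj (g t) \<partial>per_measure) = cnj (\<integral>t. g t * cnj (f t) \<partial>per_measure)"
      by (simp only: Bochner_Integration.integral_cnj)
  qed
  then show "inner f g = inner g f" by (simp add: inner_l2_def)
  have "cinner (f + g) h = cinner f h + cinner g h"
    by transfer
      (auto simp: l2_rel_def distrib_right integrable_mult_cnj
        intro!: Bochner_Integration.integral_add)
  then show "inner (f + g) h = inner f h + inner g h" by (simp add: inner_l2_def)
  have "cinner (cscale (of_real r) f) g = of_real r * cinner f g"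
    by transfer (auto simp: l2_rel_def mult.assoc integrable_mult_cnj)
  then show "inner (r *\<^sub>R f) g = r * inner f g" by (simp add: inner_l2_def scaleR_l2_def)
  have self: "cinner f f = of_real ((norm f)\<^sup>2)"
  proof (transfer)
    fix f assume "l2_rel f f"
    have "f t * cnj (f t) = of_real ((cmod (f t))\<^sup>2)" for t
      by (metis complex_norm_square)
    then show "(\<integral>t. f t * cnj (f t) \<partial>per_measure)
        = of_real ((sqrt (\<integral>t. (cmod (f t))\<^sup>2 \<partial>per_measure))\<^sup>2)"
      by (simp add: integral_nonneg_AE del: of_real_power)
  qed
  then show "0 \<le> inner f f" by (simp add: inner_l2_def)
  have nn: "0 \<le> norm f" by transfer (simp add: integral_nonneg_AE)
  with self show "norm f = sqrt (inner f f)" by (simp add: inner_l2_def)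
  have "norm f = 0 \<longleftrightarrow> f = 0"
  proof transfer
    fix f assume "l2_rel f f"
    then have f: "sq_integrable f" by (simp add: l2_rel_def)
    then have "(\<integral>t. (cmod (f t))\<^sup>2 \<partial>per_measure) = 0 \<longleftrightarrow> (AE t in per_measure. (cmod (f t))\<^sup>2 = 0)"
      by (intro integral_nonneg_eq_0_iff_AE) (auto simp: sq_integrable_def)
    then show "(sqrt (\<integral>t. (cmod (f t))\<^sup>2 \<partial>per_measure) = 0) = l2_rel f (\<lambda>t. 0)"
      using f by (simp add: l2_rel_def sq_integrable_const)
  qed
  then show "inner f f = 0 \<longleftrightarrow> f = 0" using self by (simp add: inner_l2_def)
qed

end

interpretation l2: vector_space cscale
proof
  fix a b :: complex and f g :: l2
  show "cscale a (f + g) = cscale a f + cscale a g"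
    by transfer (auto simp: l2_rel_def distrib_left intro!: sq_integrable_add sq_integrable_cmult)
  show "cscale (a + b) f = cscale a f + cscale b f"
    by transfer (auto simp: l2_rel_def distrib_right intro!: sq_integrable_add sq_integrable_cmult)
  show "cscale a (cscale b f) = cscale (a * b) f"
    by transfer (auto simp: l2_rel_def mult.assoc intro!: sq_integrable_cmult)
  show "cscale 1 f = f"
    by transfer (auto simp: l2_rel_def)
qed

section \<open>Trigonometric polynomials and periodic Sobolev spaces\<close>

lift_definition trig :: "int \<Rightarrow> l2" is "\<lambda>k t. exp (\<i> * of_int k * of_real t)"
proof -
  fix k :: int
  have "(\<lambda>t. exp (\<i> * of_int k * of_real t)) \<in> borel_measurable per_measure"
    by (intro measurable_restrict_space1 borel_measurable_continuous_onI continuous_intros)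
       (simp add: borel_measurable_continuous_onI continuous_intros)
  moreover have "integrable per_measure (\<lambda>t. (cmod (exp (\<i> * of_int k * of_real t)))\<^sup>2)"
    using sq_integrable_const[of 1] by (simp add: sq_integrable_def)
  ultimately show "l2_rel (\<lambda>t. exp (\<i> * of_int k * of_real t)) (\<lambda>t. exp (\<i> * of_int k * of_real t))"
    by (simp add: l2_rel_def sq_integrable_def)
qed

definition trig_polys :: "nat \<Rightarrow> l2 set" where
  "trig_polys n = l2.span (trig ` {- int n..int n})"

definition sobolev :: "real \<Rightarrow> l2 set" where
  "sobolev r = {f. \<exists>a :: int \<Rightarrow> complex.
     (\<lambda>k. (1 + (real_of_int k)\<^sup>2) powr r * (cmod (a k))\<^sup>2) summable_on UNIV \<and>
     ((\<lambda>k. cscale (a k) (trig k)) has_sum f) UNIV}"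

section \<open>Projection methods\<close>

text \<open>
  The definite descriptions below are meaningful for the linear maps and finite-dimensional
  subspaces to which they are applied, and for operators possessing an adjoint.
\<close>

definition orth_proj :: "l2 set \<Rightarrow> l2 \<Rightarrow> l2" where
  "orth_proj V f = (THE p. p \<in> V \<and> (\<forall>v\<in>V. cinner (f - p) v = 0))"

definition adjoint_op :: "(l2 \<Rightarrow> l2) \<Rightarrow> l2 \<Rightarrow> l2" where
  "adjoint_op A = (THE B. \<forall>f g. cinner (A f) g = cinner f (B g))"

text \<open>
  The Moore--Penrose inverse of \<open>A\<close> restricted to \<open>X\<close>: \<open>y\<close> is sent to the element of \<open>X\<close>
  orthogonal to the kernel of the restriction whose image is the projection of \<open>y\<close> onto
  the range \<open>A ` X\<close>. The codomain \<open>Y \<supseteq> A ` X\<close> only restricts the admissible arguments \<open>y\<close>.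
\<close>

definition moore_penrose :: "l2 set \<Rightarrow> (l2 \<Rightarrow> l2) \<Rightarrow> l2 \<Rightarrow> l2" where
  "moore_penrose X A y =
     (THE x. x \<in> X \<and> (\<forall>z\<in>X. A z = 0 \<longrightarrow> cinner x z = 0) \<and> A x = orth_proj (A ` X) y)"

datatype proj_method = LS | DLS | BG

fun trial_space :: "proj_method \<Rightarrow> (l2 \<Rightarrow> l2) \<Rightarrow> nat \<Rightarrow> l2 set" where
  "trial_space LS K n = trig_polys n"
| "trial_space DLS K n = adjoint_op K ` trig_polys n"
| "trial_space BG K n = trig_polys n"

fun test_space :: "proj_method \<Rightarrow> (l2 \<Rightarrow> l2) \<Rightarrow> nat \<Rightarrow> l2 set" where
  "test_space LS K n = K ` trig_polys n"
| "test_space DLS K n = trig_polys n"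
| "test_space BG K n = trig_polys n"

definition discrete_op :: "proj_method \<Rightarrow> (l2 \<Rightarrow> l2) \<Rightarrow> nat \<Rightarrow> l2 \<Rightarrow> l2" where
  "discrete_op \<tau> K n f =
     orth_proj (test_space \<tau> K n) (K (orth_proj (trial_space \<tau> K n) f))"

definition proj_solution :: "proj_method \<Rightarrow> (l2 \<Rightarrow> l2) \<Rightarrow> nat \<Rightarrow> l2 \<Rightarrow> l2" where
  "proj_solution \<tau> K n g =
     moore_penrose (trial_space \<tau> K n) (discrete_op \<tau> K n) (orth_proj (test_space \<tau> K n) g)"

section \<open>Symm's integral operator\<close>

text \<open>
  The plane is identified with the complex numbers. The integrand is integrable and the
  resulting function square-integrable whenever \<open>\<gamma>\<close> parametrizes a regular closed curve; the
  convention \<open>ln 0 = 0\<close> then affects only a null set.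
\<close>

definition symm_op :: "(real \<Rightarrow> complex) \<Rightarrow> l2 \<Rightarrow> l2" where
  "symm_op \<gamma> \<Psi> = abs_l2 (\<lambda>t. - (1 / of_real pi) *
     (\<integral>s. rep_l2 \<Psi> s * of_real (ln (cmod (\<gamma> t - \<gamma> s))) \<partial>per_measure))"

primrec C_class :: "nat \<Rightarrow> (real \<Rightarrow> complex) \<Rightarrow> bool" where
  "C_class 0 f \<longleftrightarrow> continuous_on UNIV f"
| "C_class (Suc k) f \<longleftrightarrow>
     (\<exists>f'. (\<forall>s. (f has_vector_derivative f' s) (at s)) \<and> C_class k f')"

definition parametrized_boundary :: "complex set \<Rightarrow> (real \<Rightarrow> complex) \<Rightarrow> bool" where
  "parametrized_boundary \<Omega> \<gamma> \<longleftrightarrow>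
     (\<forall>s. \<gamma> (s + 2 * pi) = \<gamma> s) \<and> C_class 3 \<gamma> \<and> inj_on \<gamma> {0..<2 * pi} \<and>
     (\<forall>s. vector_derivative \<gamma> (at s) \<noteq> 0) \<and> \<gamma> ` {0..2 * pi} = frontier \<Omega>"

definition circle_param :: "real \<Rightarrow> complex" where
  "circle_param s = of_real (exp (- 1 / 2)) * Complex (cos s) (sin s)"

lemma C_class_cis: "C_class k (\<lambda>s. c * cis s)"
proof (induction k arbitrary: c)
  case 0
  then show ?case by (simp add: continuous_intros)
next
  case (Suc k)
  have "((\<lambda>s. c * cis s) has_vector_derivative (c * \<i>) * cis s) (at s)" for s
    unfolding cis_conv_exp
    by (auto intro!: derivative_eq_intros has_vector_derivative_real_field simp: algebra_simps)
  with Suc.IH[of "c * \<i>"] show ?case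
    by (auto intro!: exI[of _ "\<lambda>s. (c * \<i>) * cis s"])
qed

lemma parametrized_boundary_circle:
  "parametrized_boundary (ball 0 (exp (- 1 / 2))) circle_param"
proof -
  define r :: real where "r = exp (- 1 / 2)"
  have r: "r > 0" by (simp add: r_def)
  have \<gamma>: "circle_param = (\<lambda>s. of_real r * cis s)"
    by (auto simp: circle_param_def r_def cis.ctr)
  have deriv: "(circle_param has_vector_derivative (of_real r * \<i>) * cis s) (at s)" for s
    unfolding \<gamma> cis_conv_exp
    by (auto intro!: derivative_eq_intros has_vector_derivative_real_field simp: algebra_simps)
  have "vector_derivative circle_param (at s) \<noteq> 0" for s
    using vector_derivative_at[OF deriv[of s]] r by simp
  moreover have "inj_on circle_param {0..<2 * pi}"
  proof (rule inj_onI)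
    fix s t assume st: "s \<in> {0..<2 * pi}" "t \<in> {0..<2 * pi}" and "circle_param s = circle_param t"
    then have "cis s = cis t" using r by (simp add: \<gamma>)
    then have "Arg2pi (cis s) = Arg2pi (cis t)" by simp
    moreover have "Arg2pi (cis u) = u" if "u \<in> {0..<2 * pi}" for u
      using that by (intro Arg2pi_unique[of 1]) (auto simp: cis_conv_exp)
    ultimately show "s = t" using st by simp
  qed
  moreover have "circle_param ` {0..2 * pi} = frontier (ball 0 r)"
  proof
    show "circle_param ` {0..2 * pi} \<subseteq> frontier (ball 0 r)"
      using r by (auto simp: \<gamma> norm_mult)
    show "frontier (ball 0 r) \<subseteq> circle_param ` {0..2 * pi}"
    proof
      fix z assume "z \<in> frontier (ball (0 :: complex) r)"
      then have "cmod z = r" using r by simp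
      then have "z = circle_param (Arg2pi z)"
        using Arg2pi_eq[of z] by (simp add: \<gamma> cis_conv_exp)
      then show "z \<in> circle_param ` {0..2 * pi}"
        using Arg2pi_ge_0[of z] Arg2pi_lt_2pi[of z] by (intro image_eqI) auto
    qed
  qed
  moreover have "circle_param (s + 2 * pi) = circle_param s" for s
    by (simp add: circle_param_def)
  moreover have "C_class 3 circle_param"
    unfolding \<gamma> by (rule C_class_cis)
  ultimately show ?thesis
    unfolding parametrized_boundary_def r_def by blast
qed

end

(*
Put m_j = max 1 |j| and e_j(t) = exp(ijt). On a regular closed curve Symm's kernel differs from that
of the circle of radius exp(-1/2), which maps e_j to e_j / m_j, by a kernel with bounded derivative.
Hence m_j times the j-th Fourier coefficient of K f is f_j + D_j f with D Hilbert-Schmidt, so K maps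
L^2 boundedly into H^1. If K is injective, a compactness argument gives
|w| <= C |P_n K w|_{H^1} <= C' n |P_n K w| for w in T_n and large n, from which the O(n) bounds for the
three methods follow. Conversely K applied to the n-th approximation converges to g coefficientwise,
so approximations that stay bounded along a subsequence would force g into H^1.

For injectivity let K f = 0. The charge consisting of f on the curve and of minus the total mass of f
spread uniformly over the unit circle around z_0 is neutral and has logarithmic energy zero, by
the mean value formula for ln|x - y| and, if the curve encloses that circle, the maximum principle.
By Frullani's formula -ln a is the integral of (exp(-sa) - exp(-s))/s over s > 0, so the energy is
an integral of the nonnegative Gaussian energies; the power series of exp(2s Re(x cnj y)) turns one
vanishing Gaussian energy into vanishing moments, and Stone-Weierstrass gives f = 0.
*)
theory Submission
  imports Defs "HOL-Library.Diagonal_Subsequence"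
begin

section \<open>Moments and closed sets\<close>

text \<open>The obstacle is injectivity. The logarithmic kernel is positive only on neutral charges:
  the term exp(-s) of Frullani's formula drops out of the energy just when the total charge is zero,
  and on the unit circle the constants are annihilated. The compensating mass sits on a unit circle
  because the potential of that circle, 2 pi ln max(|z - z0|, 1) for density one, vanishes on it and
  inside it: its self-energy is zero, and a curve inside it feels nothing. The radius exp(-1/2)
  shifts the logarithm by -1/2 and so turns the eigenvalue 0 of the constants on the unit circle
  into 1, without touching the other modes. One square-summable bound on the smoothing part does
  double duty: it gives boundedness into H^1, and compactness in the form of a Hilbert cube. The
  three methods differ in one point of the lower bound. Dual least squares and Bubnov-Galerkin
  reproduce the low Fourier coefficients of g exactly. Least squares does not; there the residual is
  tested against the error of approximating exp(ijt) from K(T_n), which is of order 1/n.\<close>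

lemma norm_integral_le_integral:
  fixes f :: "'a \<Rightarrow> 'b :: {banach, second_countable_topology}" and g :: "'a \<Rightarrow> real"
  assumes "integrable M f" "integrable M g" "\<And>x. x \<in> space M \<Longrightarrow> norm (f x) \<le> g x"
  shows "norm (\<integral>x. f x \<partial>M) \<le> (\<integral>x. g x \<partial>M)"
  by (rule order_trans[OF integral_norm_bound integral_mono]) (use assms in auto)

lemma integrable_mult_continuous_image:
  fixes h p :: "'a \<Rightarrow> complex" and F :: "complex \<Rightarrow> complex"
  assumes h: "integrable M h" and p[measurable]: "p \<in> borel_measurable M"
    and R: "\<And>x. x \<in> space M \<Longrightarrow> norm (p x) \<le> R" and F: "continuous_on UNIV F"
  shows "integrable M (\<lambda>x. h x * F (p x))"
proof -
  have "compact (F ` cball 0 R)"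
    by (intro compact_continuous_image continuous_on_subset[OF F]) auto
  then obtain B where B: "\<And>z. z \<in> cball 0 R \<Longrightarrow> norm (F z) \<le> B"
    by (meson bounded_iff compact_imp_bounded imageI)
  have [measurable]: "F \<in> borel_measurable borel"
    by (rule borel_measurable_continuous_onI[OF F])
  have [measurable]: "h \<in> borel_measurable M" using h by auto
  show ?thesis
  proof (rule Bochner_Integration.integrable_bound[where f = "\<lambda>x. B * norm (h x)"])
    show "integrable M (\<lambda>x. B * norm (h x))" using h by simp
    show "AE x in M. norm (h x * F (p x)) \<le> norm (B * norm (h x))"
    proof (rule AE_I2)
      fix x assume x: "x \<in> space M"
      have "norm (F (p x)) \<le> B" using B R[OF x] by simp
      then have "norm (h x * F (p x)) \<le> B * norm (h x)"
        by (metis mult.commute mult_right_mono norm_ge_zero norm_mult)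
      then show "norm (h x * F (p x)) \<le> norm (B * norm (h x))" by simp
    qed
  qed measurable
qed

text \<open>Polynomials in Re z and Im z are polynomials in z and \<open>cnj z\<close>, so by
  Stone-Weierstrass on the disc of radius R the mixed moments decide the integral against every
  continuous function of \<open>p\<close>.\<close>

lemma moments_zero_imp_orthogonal_continuous:
  fixes h p :: "'a \<Rightarrow> complex" and G :: "complex \<Rightarrow> real"
  assumes h: "integrable M h" and p[measurable]: "p \<in> borel_measurable M"
    and R: "\<And>x. x \<in> space M \<Longrightarrow> norm (p x) \<le> R"
    and mom: "\<And>k l. (\<integral>x. h x * (p x ^ k * cnj (p x) ^ l) \<partial>M) = 0"
    and G: "continuous_on UNIV G"
  shows "(\<integral>x. h x * of_real (G (p x)) \<partial>M) = 0"
proof -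
  note int = integrable_mult_continuous_image[OF h p R]
  \<comment> \<open>Testing against all monomial multiples at once makes the property stable under
    multiplication by z and by \<open>cnj z\<close>; the product case of the induction over
    polynomials then merely iterates it.\<close>
  define good where "good F \<longleftrightarrow> continuous_on UNIV F \<and>
      (\<forall>k l. (\<integral>x. h x * (p x ^ k * cnj (p x) ^ l * F (p x)) \<partial>M) = 0)" for F :: "complex \<Rightarrow> complex"
  have good_add: "good (\<lambda>z. F1 z + F2 z)" if "good F1" "good F2" for F1 F2
  proof -
    have c: "continuous_on UNIV F1" "continuous_on UNIV F2" using that by (auto simp: good_def)
    have "(\<integral>x. h x * (p x ^ k * cnj (p x) ^ l * (F1 (p x) + F2 (p x))) \<partial>M) = 0" for k l
    proof -
      have "(\<integral>x. h x * (p x ^ k * cnj (p x) ^ l * (F1 (p x) + F2 (p x))) \<partial>M)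
         = (\<integral>x. h x * (p x ^ k * cnj (p x) ^ l * F1 (p x)) + h x * (p x ^ k * cnj (p x) ^ l * F2 (p x)) \<partial>M)"
        by (simp add: algebra_simps)
      also have "\<dots> = 0"
        using that int[of "\<lambda>z. z ^ k * cnj z ^ l * F1 z"] int[of "\<lambda>z. z ^ k * cnj z ^ l * F2 z"] c
        by (subst Bochner_Integration.integral_add) (auto simp: good_def continuous_intros)
      finally show ?thesis .
    qed
    then show ?thesis using c by (auto simp: good_def intro!: continuous_intros)
  qed
  have good_scale: "good (\<lambda>z. c * F z)" if "good F" for F c
    using that unfolding good_def
    by (auto simp: mult.left_commute[of _ c] intro!: continuous_intros)
  have good_id: "good (\<lambda>z. z * F z)" if "good F" for F
  proof -
    have "(\<integral>x. h x * (p x ^ k * cnj (p x) ^ l * (p x * F (p x))) \<partial>M) = 0" for k l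
    proof -
      have "(\<integral>x. h x * (p x ^ Suc k * cnj (p x) ^ l * F (p x)) \<partial>M) = 0"
        using that unfolding good_def by blast
      then show ?thesis by (simp add: algebra_simps)
    qed
    then show ?thesis using that by (auto simp: good_def intro!: continuous_intros)
  qed
  have good_cnj: "good (\<lambda>z. cnj z * F z)" if "good F" for F
  proof -
    have "(\<integral>x. h x * (p x ^ k * cnj (p x) ^ l * (cnj (p x) * F (p x))) \<partial>M) = 0" for k l
    proof -
      have "(\<integral>x. h x * (p x ^ k * cnj (p x) ^ Suc l * F (p x)) \<partial>M) = 0"
        using that unfolding good_def by blast
      then show ?thesis by (simp add: algebra_simps)
    qed
    then show ?thesis using that by (auto simp: good_def intro!: continuous_intros)
  qed
  have poly: "good (\<lambda>z. of_real (q z) * F z)" if "real_polynomial_function q" "good F" for q F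
    using that
  proof (induction arbitrary: F rule: real_polynomial_function.induct)
    case (linear q)
    interpret bounded_linear q by fact
    \<comment> \<open>A real-linear functional on the plane, written in the coordinates z and
      \<open>cnj z\<close>.\<close>
    have eq: "of_real (q z) = of_real (q 1) * ((z + cnj z) / 2) + of_real (q \<i>) * ((z - cnj z) / (2 * \<i>))" for z
    proof -
      have "q z = q (Re z *\<^sub>R 1 + Im z *\<^sub>R \<i>)"
        by (rule arg_cong[of _ _ q]) (simp add: complex_eq_iff)
      then have "q z = Re z * q 1 + Im z * q \<i>" by (simp add: add scaleR)
      moreover have "(z - cnj z) / (2 * \<i>) = of_real (Im z)"
        by (simp add: complex_eq_iff complex_diff_cnj)
      ultimately show ?thesis by (simp add: complex_add_cnj)
    qed
    have *: "of_real (q z) * F z = ((of_real (q 1) / 2 + of_real (q \<i>) / (2 * \<i>)) * (z * F z))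
        + ((of_real (q 1) / 2 - of_real (q \<i>) / (2 * \<i>)) * (cnj z * F z))" for z
      unfolding eq[of z] by (simp add: algebra_simps add_divide_distrib diff_divide_distrib)
    show ?case unfolding * by (intro good_add good_scale good_id good_cnj) (fact linear.prems)+
  next
    case (const c)
    then show ?case by (intro good_scale)
  next
    case (add f g)
    then show ?case by (simp add: distrib_right good_add)
  next
    case (mult f g)
    then show ?case by (simp add: mult.assoc)
  qed
  have good1: "good (\<lambda>z. 1)" using mom by (simp add: good_def)
  have small: "norm (\<integral>x. h x * of_real (G (p x)) \<partial>M) \<le> e * (\<integral>x. norm (h x) \<partial>M)" if e: "e > 0" for e
  proof -
    obtain q where q: "real_polynomial_function q" "\<And>z. z \<in> cball 0 R \<Longrightarrow> \<bar>G z - q z\<bar> < e"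
      by (rule Stone_Weierstrass_real_polynomial_function[OF _ continuous_on_subset[OF G], of "cball 0 R"])
         (use e in auto)
    have z: "(\<integral>x. h x * of_real (q (p x)) \<partial>M) = 0"
      using poly[OF q(1) good1] unfolding good_def by (auto dest!: spec[of _ 0])
    have cq: "continuous_on UNIV (\<lambda>z. complex_of_real (q z))"
      using poly[OF q(1) good1] by (simp add: good_def)
    have cG: "continuous_on UNIV (\<lambda>z. complex_of_real (G z))"
      by (intro continuous_intros G)
    have "(\<integral>x. h x * of_real (G (p x)) \<partial>M) = (\<integral>x. h x * of_real (G (p x)) - h x * of_real (q (p x)) \<partial>M)"
      using z int[OF _ cq] int[OF _ cG] by (subst Bochner_Integration.integral_diff) auto
    also have "norm \<dots> \<le> (\<integral>x. e * norm (h x) \<partial>M)"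
    proof (rule norm_integral_le_integral)
      show "integrable M (\<lambda>x. h x * of_real (G (p x)) - h x * of_real (q (p x)))"
        using int[OF _ cq] int[OF _ cG] by auto
      fix x assume that: "x \<in> space M"
      show "norm (h x * of_real (G (p x)) - h x * of_real (q (p x))) \<le> e * norm (h x)"
      proof -
        have "norm (h x * of_real (G (p x)) - h x * of_real (q (p x))) = norm (h x) * \<bar>G (p x) - q (p x)\<bar>"
          by (metis norm_mult norm_of_real of_real_diff right_diff_distrib)
        also have "\<dots> \<le> norm (h x) * e"
          using q(2)[of "p x"] R[OF that] by (intro mult_left_mono) auto
        finally show ?thesis by (simp add: mult.commute)
      qed
    qed (use h in auto)
    finally show ?thesis by simp
  qed
  show ?thesis
  proof (rule ccontr)
    define I J where "I = (\<integral>x. norm (h x) \<partial>M)" and "J = norm (\<integral>x. h x * of_real (G (p x)) \<partial>M)"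
    assume "\<not> ?thesis"
    then have J: "J > 0" by (simp add: J_def)
    have I: "I \<ge> 0" by (simp add: I_def)
    \<comment> \<open>The tolerance e = J / (2 (I + 1)) leaves at most J / 2 on the right; the added
      1 covers I = 0.\<close>
    have "J \<le> J / (2 * (I + 1)) * I" using small[of "J / (2 * (I + 1))", folded I_def J_def] I J by simp
    also have "\<dots> \<le> J / 2" using J I by (simp add: field_simps)
    finally show False using J by simp
  qed
qed

text \<open>The continuous functions max 0 (1 - n dist(z, A)) tend pointwise to the indicator
  because A is closed, and \<open>norm (h x)\<close> dominates the integrands.\<close>

lemma orthogonal_continuous_imp_closed:
  fixes h p :: "'a \<Rightarrow> complex"
  assumes h: "integrable M h" and p[measurable]: "p \<in> borel_measurable M"
    and orth: "\<And>G :: complex \<Rightarrow> real. continuous_on UNIV G \<Longrightarrow> (\<integral>x. h x * of_real (G (p x)) \<partial>M) = 0"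
    and A: "closed A" "A \<noteq> {}"
  shows "(\<integral>x. h x * indicator A (p x) \<partial>M) = 0"
proof -
  define G where "G n z = max 0 (1 - real n * infdist z A)" for n z
  have G: "continuous_on UNIV (G n)" for n unfolding G_def by (intro continuous_intros)
  have [measurable]: "h \<in> borel_measurable M" using h by auto
  have [measurable]: "G n \<in> borel_measurable borel" for n by (rule borel_measurable_continuous_onI[OF G])
  have [measurable]: "A \<in> sets borel" using A by simp
  have "(\<lambda>n. \<integral>x. h x * of_real (G n (p x)) \<partial>M) \<longlonglongrightarrow> (\<integral>x. h x * indicator A (p x) \<partial>M)"
  proof (rule integral_dominated_convergence[where w = "\<lambda>x. norm (h x)"])
    show "AE x in M. (\<lambda>n. h x * of_real (G n (p x))) \<longlonglongrightarrow> h x * indicator A (p x)"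
    proof (rule AE_I2)
      fix x
      have "(\<lambda>n. G n z) \<longlonglongrightarrow> indicator A z" for z
      proof (cases "z \<in> A")
        case True
        then show ?thesis by (simp add: G_def)
      next
        case False
        then have pos: "infdist z A > 0" using A by (simp add: infdist_pos_not_in_closed)
        obtain N where N: "real N * infdist z A > 1" using reals_Archimedean3[OF pos] by blast
        have "G n z = 0" if "n \<ge> N" for n
        proof -
          have "real N * infdist z A \<le> real n * infdist z A"
            using that pos by (intro mult_right_mono) auto
          then show ?thesis using N by (simp add: G_def)
        qed
        then have "eventually (\<lambda>n. G n z = 0) sequentially" by (auto simp: eventually_sequentially)
        then show ?thesis using False by (simp add: tendsto_eventually)
      qed
      then have "(\<lambda>n. complex_of_real (G n (p x))) \<longlonglongrightarrow> of_real (indicator A (p x))"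
        by (intro tendsto_of_real)
      then show "(\<lambda>n. h x * of_real (G n (p x))) \<longlonglongrightarrow> h x * indicator A (p x)"
        by (intro tendsto_mult tendsto_const) (cases "p x \<in> A"; simp)
    qed
    show "AE x in M. norm (h x * of_real (G n (p x))) \<le> norm (h x)" for n
      by (auto simp: norm_mult G_def infdist_nonneg intro!: mult_left_le)
  qed (use h in \<open>auto\<close>)
  then show ?thesis using orth[OF G] by (simp add: LIMSEQ_const_iff)
qed

text \<open>Closed sets form an intersection-stable generator of the Borel sets, and the sets on
  which f integrates to 0 form a Dynkin system; complements use that \<open>UNIV\<close> is itself
  closed.\<close>

lemma AE_zero_of_closed_integrals_zero:
  fixes f :: "real \<Rightarrow> complex"
  assumes f: "integrable lborel f"
    and int: "\<And>A. closed A \<Longrightarrow> (\<integral>x. indicator A x *\<^sub>R f x \<partial>lborel) = 0"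
  shows "AE x in lborel. f x = 0"
proof (rule sigma_finite_measure.density_zero[OF sigma_finite_lborel f])
  fix A :: "real set" assume "A \<in> sets lborel"
  then have A: "A \<in> sigma_sets UNIV (Collect closed)"
    by (simp add: borel_eq_closed)
  have G: "Int_stable (Collect closed :: real set set)" "Collect closed \<subseteq> Pow (UNIV :: real set)"
    by (auto simp: Int_stable_def)
  from G A have "A \<in> sets borel \<and> set_lebesgue_integral lborel A f = 0"
  proof (induction rule: sigma_sets_induct_disjoint)
    case (basic A)
    then show ?case using int by (auto simp: set_lebesgue_integral_def)
  next
    case empty
    then show ?case by (simp add: set_lebesgue_integral_def)
  next
    case (compl A)
    have iA: "integrable lborel (\<lambda>x. indicator A x *\<^sub>R f x)"
      using compl f by (intro integrable_mult_indicator) auto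
    have "set_lebesgue_integral lborel (UNIV - A) f
        = (\<integral>x. f x \<partial>lborel) - set_lebesgue_integral lborel A f"
      unfolding set_lebesgue_integral_def
      by (subst Bochner_Integration.integral_diff[OF f iA, symmetric])
         (auto intro!: Bochner_Integration.integral_cong simp: indicator_def)
    also have "(\<integral>x. f x \<partial>lborel) = 0" using int[of UNIV] by simp
    finally show ?case using compl by (simp add: Compl_eq_Diff_UNIV[symmetric] borel_comp)
  next
    case (union A)
    have "set_lebesgue_integral lborel (\<Union>i. A i) f = (\<Sum>i. set_lebesgue_integral lborel (A i) f)"
    proof (rule lebesgue_integral_countable_add)
      show "set_integrable lborel (\<Union>i. A i) f"
        unfolding set_integrable_def using union f by (intro integrable_mult_indicator) auto
    qed (use union in \<open>auto simp: disjoint_family_on_def\<close>)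
    then show ?case using union by auto
  qed
  then show "set_lebesgue_integral lborel A f = 0" by simp
qed

section \<open>The Hilbert space of square-integrable functions\<close>

lemma per_space [simp]: "space per_measure = {0<..<2 * pi}"
  by (simp add: space_restrict_space)

lemma per_finite: "finite_measure per_measure"
  by (rule finite_measureI) (simp add: emeasure_restrict_space space_restrict_space)

interpretation per: finite_measure per_measure
  by (rule per_finite)

lemma per_measurable_borel:
  "f \<in> borel_measurable borel \<Longrightarrow> f \<in> borel_measurable per_measure"
  by (simp add: measurable_restrict_space1)

lemma per_measurable_continuous:
  "continuous_on UNIV f \<Longrightarrow> f \<in> borel_measurable per_measure"
  by (intro per_measurable_borel borel_measurable_continuous_onI)

lemma per_integrable_bounded:
  fixes f :: "real \<Rightarrow> 'b :: {banach, second_countable_topology}"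
  assumes "f \<in> borel_measurable per_measure" "\<And>t. 0 < t \<Longrightarrow> t < 2 * pi \<Longrightarrow> norm (f t) \<le> B"
  shows "integrable per_measure f"
  by (rule per.integrable_const_bound[of _ B]) (use assms in auto)

lemma sq_integrable_bounded:
  assumes "f \<in> borel_measurable per_measure" "\<And>t. 0 < t \<Longrightarrow> t < 2 * pi \<Longrightarrow> norm (f t) \<le> B"
  shows "sq_integrable f"
  unfolding sq_integrable_def
proof
  note [measurable] = assms(1)
  show "integrable per_measure (\<lambda>t. (cmod (f t))\<^sup>2)"
    by (rule per_integrable_bounded[of _ "B\<^sup>2"]) (use assms(2) in \<open>auto intro!: power_mono\<close>)
qed (rule assms)

lemma sq_integrable_imp_integrable:
  assumes "sq_integrable f" shows "integrable per_measure f"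
  using integrable_mult_cnj[OF assms sq_integrable_const[of 1]] by simp

lemma per_integrable_iff:
  fixes f :: "real \<Rightarrow> complex"
  shows "integrable per_measure f \<longleftrightarrow> set_integrable lborel {0<..<2*pi} f"
  unfolding set_integrable_def by (subst integrable_restrict_space) auto

lemma per_integral_eq_integral:
  fixes f :: "real \<Rightarrow> complex"
  assumes "integrable per_measure f"
  shows "(\<integral>t. f t \<partial>per_measure) = integral {0..2 * pi} f"
proof -
  have "(\<integral>t. f t \<partial>per_measure) = set_lebesgue_integral lborel {0<..<2*pi} f"
    unfolding set_lebesgue_integral_def by (subst integral_restrict_space) auto
  also have "\<dots> = integral {0<..<2*pi} f"
    using assms by (intro set_borel_integral_eq_integral) (simp add: per_integrable_iff)
  finally show ?thesis by (simp add: integral_open_interval_real)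
qed

lemma per_AE_zero:
  fixes f :: "real \<Rightarrow> complex"
  assumes f: "integrable per_measure f"
    and int: "\<And>A. closed A \<Longrightarrow> (\<integral>t. f t * indicator A t \<partial>per_measure) = 0"
  shows "AE t in per_measure. f t = 0"
proof -
  have "AE t in lborel. indicator {0<..<2*pi} t *\<^sub>R f t = 0"
  proof (rule AE_zero_of_closed_integrals_zero)
    show "integrable lborel (\<lambda>t. indicator {0<..<2*pi} t *\<^sub>R f t)"
      using f by (simp add: per_integrable_iff set_integrable_def)
    fix A :: "real set" assume "closed A"
    then have "0 = (\<integral>t. f t * indicator A t \<partial>per_measure)" using int[of A] by simp
    also have "\<dots> = (\<integral>t. indicator {0<..<2*pi} t *\<^sub>R (f t * indicator A t) \<partial>lborel)"
      by (subst integral_restrict_space) auto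
    also have "\<dots> = (\<integral>t. indicator A t *\<^sub>R indicator {0<..<2*pi} t *\<^sub>R f t \<partial>lborel)"
      by (rule Bochner_Integration.integral_cong) (auto simp: indicator_def)
    finally show "(\<integral>t. indicator A t *\<^sub>R indicator {0<..<2*pi} t *\<^sub>R f t \<partial>lborel) = 0" by simp
  qed
  then show ?thesis
    by (subst AE_restrict_space_iff) (auto elim!: eventually_mono)
qed

text \<open>Closed parameter sets C are carried to the curve: p maps the compact set C \<inter>
  [0, 2 pi] onto a closed set A, and by injectivity p t lies in A exactly when t lies in C. Both
  uniqueness results, for Fourier coefficients and for the integral operator, end here.\<close>

lemma per_AE_zero_of_injective:
  fixes f p :: "real \<Rightarrow> complex"
  assumes f: "integrable per_measure f" and p: "continuous_on UNIV p" and inj: "inj_on p {0..<2 * pi}"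
    and per: "p (2 * pi) = p 0"
    and z: "\<And>A. closed A \<Longrightarrow> A \<subseteq> p ` {0..2*pi} \<Longrightarrow> A \<noteq> {} \<Longrightarrow> (\<integral>t. f t * indicator A (p t) \<partial>per_measure) = 0"
  shows "AE t in per_measure. f t = 0"
proof (rule per_AE_zero[OF f])
  fix C :: "real set" assume C: "closed C"
  define A where "A = p ` (C \<inter> {0..2*pi})"
  have cl: "closed A"
    unfolding A_def
    by (intro compact_imp_closed compact_continuous_image continuous_on_subset[OF p]
        closed_Int_compact[OF C]) auto
  have iff: "p t \<in> A \<longleftrightarrow> t \<in> C" if t: "0 < t" "t < 2 * pi" for t
  proof
    assume "p t \<in> A"
    then obtain s where s: "s \<in> C" "0 \<le> s" "s \<le> 2 * pi" "p t = p s" by (auto simp: A_def)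
    \<comment> \<open>The endpoint lies outside the half-open interval of injectivity; it is traded
      for 0, which t > 0 excludes.\<close>
    have "s \<noteq> 2 * pi"
    proof
      assume "s = 2 * pi"
      then have "p t = p 0" using s per by simp
      then have "t = 0" using t by (intro inj_onD[OF inj]) auto
      then show False using t by simp
    qed
    then have "t = s" using t s by (intro inj_onD[OF inj]) auto
    then show "t \<in> C" using s by simp
  qed (use t in \<open>auto simp: A_def\<close>)
  have "(\<integral>t. f t * indicator C t \<partial>per_measure) = (\<integral>t. f t * indicator A (p t) \<partial>per_measure)"
    by (rule Bochner_Integration.integral_cong) (auto simp: indicator_def iff)
  also have "\<dots> = 0"
  proof (cases "A = {}")
    case False
    then show ?thesis by (intro z cl) (auto simp: A_def)
  qed simp
  finally show "(\<integral>t. f t * indicator C t \<partial>per_measure) = 0" .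
qed

lemma l2_rel_rep: "l2_rel (rep_l2 F) (rep_l2 F)"
  by (rule Quotient_rep_reflp[OF Quotient_l2])

lemma sq_integrable_rep: "sq_integrable (rep_l2 F)"
  using l2_rel_rep[of F] by (simp add: l2_rel_def)

lemma abs_rep_l2: "abs_l2 (rep_l2 F) = F"
  by (rule Quotient_abs_rep[OF Quotient_l2])

lemma l2_rel_refl: "sq_integrable f \<Longrightarrow> l2_rel f f"
  by (simp add: l2_rel_def)

lemma l2_eqI:
  assumes "AE t in per_measure. rep_l2 F t = rep_l2 G t"
  shows "F = G"
proof -
  have "l2_rel (rep_l2 F) (rep_l2 G)" using assms sq_integrable_rep by (simp add: l2_rel_def)
  then have "abs_l2 (rep_l2 F) = abs_l2 (rep_l2 G)"
    using Quotient_rel[OF Quotient_l2] by blast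
  then show ?thesis by (simp add: abs_rep_l2)
qed

lemma rep_abs_l2:
  assumes "sq_integrable f" shows "AE t in per_measure. rep_l2 (abs_l2 f) t = f t"
proof -
  have "l2_rel (rep_l2 (abs_l2 f)) f"
    using Quotient_rep_abs[OF Quotient_l2, OF l2_rel_refl[OF assms]] .
  then show ?thesis by (simp add: l2_rel_def)
qed

lemma cinner_rep: "cinner F G = (\<integral>t. rep_l2 F t * cnj (rep_l2 G t) \<partial>per_measure)"
  by (simp add: cinner_def)

lemma cinner_add_left: "cinner (f + g) h = cinner f h + cinner g h"
  by transfer
    (auto simp: l2_rel_def distrib_right integrable_mult_cnj intro!: Bochner_Integration.integral_add)

lemma cinner_cscale_left: "cinner (cscale c f) g = c * cinner f g"
  by transfer (auto simp: l2_rel_def mult.assoc integrable_mult_cnj)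

lemma cinner_commute: "cinner f g = cnj (cinner g f)"
proof transfer
  fix f g :: "real \<Rightarrow> complex"
  have "(\<integral>t. f t * cnj (g t) \<partial>per_measure) = (\<integral>t. cnj (g t * cnj (f t)) \<partial>per_measure)"
    by (simp add: mult.commute)
  then show "(\<integral>t. f t * cnj (g t) \<partial>per_measure) = cnj (\<integral>t. g t * cnj (f t) \<partial>per_measure)"
    by (simp only: Bochner_Integration.integral_cnj)
qed

lemma cinner_add_right: "cinner f (g + h) = cinner f g + cinner f h"
  by (metis cinner_add_left cinner_commute complex_cnj_add)

lemma cinner_cscale_right: "cinner f (cscale c g) = cnj c * cinner f g"
  by (metis cinner_cscale_left cinner_commute complex_cnj_mult)

lemma cscale_minus_one: "cscale (- 1) f = - f"
  by (simp add: l2.scale_minus_left)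

lemma cinner_minus_left: "cinner (- f) g = - cinner f g"
  using cinner_cscale_left[of "-1" f g] by (simp add: cscale_minus_one)

lemma cinner_minus_right: "cinner f (- g) = - cinner f g"
  using cinner_cscale_right[of f "-1" g] by (simp add: cscale_minus_one)

lemma cinner_diff_left: "cinner (f - g) h = cinner f h - cinner g h"
  using cinner_add_left[of f "- g" h] by (simp add: cinner_minus_left)

lemma cinner_diff_right: "cinner f (g - h) = cinner f g - cinner f h"
  using cinner_add_right[of f g "- h"] by (simp add: cinner_minus_right)

lemma cinner_zero_left [simp]: "cinner 0 f = 0"
  using cinner_diff_left[of 0 0 f] by simp

lemma cinner_zero_right [simp]: "cinner f 0 = 0"
  using cinner_diff_right[of f 0 0] by simp

lemma cinner_sum_left: "cinner (sum f S) g = (\<Sum>k\<in>S. cinner (f k) g)"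
  by (induction S rule: infinite_finite_induct) (auto simp: cinner_add_left)

lemma cinner_sum_right: "cinner g (sum f S) = (\<Sum>k\<in>S. cinner g (f k))"
  by (induction S rule: infinite_finite_induct) (auto simp: cinner_add_right)

lemma cinner_self: "cinner f f = of_real ((norm f)\<^sup>2)"
proof -
  have "Re (cinner f f) = (norm f)\<^sup>2"
    using power2_norm_eq_inner[of f] by (simp add: inner_l2_def)
  moreover have "Im (cinner f f) = 0"
    using arg_cong[OF cinner_commute[of f f], of Im] by simp
  ultimately show ?thesis by (simp add: complex_eq_iff)
qed

lemma norm_cscale: "norm (cscale c f) = cmod c * norm f"
proof -
  have c: "cnj c * c = (complex_of_real (cmod c))\<^sup>2"
    by (metis complex_norm_square mult.commute of_real_power)
  have "of_real ((norm (cscale c f))\<^sup>2) = complex_of_real ((cmod c * norm f)\<^sup>2)"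
    unfolding cinner_self[symmetric] cinner_cscale_left cinner_cscale_right
    by (simp add: cinner_self power_mult_distrib c mult.assoc[symmetric])
  then have "(norm (cscale c f))\<^sup>2 = (cmod c * norm f)\<^sup>2" by (simp only: of_real_eq_iff)
  then show ?thesis by (simp add: power2_eq_iff_nonneg)
qed

lemma norm_cinner_le: "cmod (cinner f g) \<le> norm f * norm g"
proof (cases "cinner f g = 0")
  case False
  \<comment> \<open>A unimodular factor makes the complex inner product real, so that the
    Cauchy-Schwarz inequality of the real inner product applies.\<close>
  define c where "c = cnj (cinner f g) / of_real (cmod (cinner f g))"
  have c: "cmod c = 1" using False by (simp add: c_def norm_divide)
  have "c * cinner f g = of_real (cmod (cinner f g))"
    using False by (simp add: c_def complex_norm_square[symmetric] mult.commute[of "cnj _"] power2_eq_square)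
  then have "cmod (cinner f g) = inner (cscale c f) g"
    by (simp add: inner_l2_def cinner_cscale_left)
  also have "\<dots> \<le> norm (cscale c f) * norm g" by (rule norm_cauchy_schwarz)
  finally show ?thesis by (simp add: norm_cscale c)
qed simp

lemma scaleR_eq_cscale: "r *\<^sub>R f = cscale (of_real r) f"
  by (simp add: scaleR_l2_def)

lemma bounded_linear_cinner_left: "bounded_linear (\<lambda>f. cinner f g)"
  by (rule bounded_linear_intro[where K = "norm g"])
     (auto simp: cinner_add_left scaleR_eq_cscale cinner_cscale_left scaleR_conv_of_real norm_cinner_le)

lemma tendsto_cinner_left:
  "(f \<longlongrightarrow> l) F \<Longrightarrow> ((\<lambda>x. cinner (f x) g) \<longlongrightarrow> cinner l g) F"
  by (rule bounded_linear.tendsto[OF bounded_linear_cinner_left])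

text \<open>Along a subsequence with geometric gaps the increments are summable in L^1, hence
  absolutely summable almost everywhere. Fatou's lemma turns the pointwise limit into an L^2 limit,
  and a Cauchy sequence follows its subsequence.\<close>

lemma l2_complete:
  fixes X :: "nat \<Rightarrow> l2" assumes X: "Cauchy X" shows "convergent X"
proof -
  have "\<exists>N. \<forall>m\<ge>N. \<forall>n\<ge>N. norm (X m - X n) < (1/4) ^ k" for k :: nat
    using CauchyD[OF X, of "(1/4) ^ k"] by auto
  then obtain N where N: "\<And>k m n. m \<ge> N k \<Longrightarrow> n \<ge> N k \<Longrightarrow> norm (X m - X n) < (1/4) ^ k"
    by metis
  define r where "r k = (\<Sum>i\<le>k. N i) + k" for k
  have r_ge: "r k \<ge> N k" for k unfolding r_def using member_le_sum[of k "{..k}" N] by simp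
  have r_mono: "strict_mono r" by (rule strict_mono_Suc_iff[THEN iffD2]) (simp add: r_def)
  have r_bd: "norm (X (r m) - X (r k)) < (1/4) ^ k" if "k \<le> m" for k m
  proof (rule N)
    have "r k \<le> r m" using r_mono that by (simp add: strict_mono_less_eq)
    then show "N k \<le> r m" using r_ge[of k] by linarith
  qed (rule r_ge)
  define F where "F k = rep_l2 (X (r k))" for k
  have F: "sq_integrable (F k)" for k unfolding F_def by (rule sq_integrable_rep)
  have Fd: "sq_integrable (\<lambda>t. F m t - F k t)" for m k
    using sq_integrable_add[OF F[of m] sq_integrable_cmult[OF F[of k], of "-1"]] by simp
  note [measurable] = F[THEN sq_integrable_measurable]
  have absd: "abs_l2 (\<lambda>t. f t - F k t) = abs_l2 f - X (r k)" if "sq_integrable f" for f k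
  proof -
    have "abs_l2 f - abs_l2 (F k) = abs_l2 (\<lambda>t. f t - F k t)"
      unfolding minus_l2_def using that F sq_integrable_cmult[OF F[of k], of "-1"]
      by (simp add: plus_l2.abs_eq uminus_l2.abs_eq l2_rel_refl)
    then show ?thesis by (simp add: F_def abs_rep_l2)
  qed
  have L2: "(\<integral>\<^sup>+t. (cmod (F m t - F k t))\<^sup>2 \<partial>per_measure) \<le> ennreal (((1/4) ^ k)\<^sup>2)" if "k \<le> m" for k m
  proof -
    have "abs_l2 (\<lambda>t. F m t - F k t) = X (r m) - X (r k)"
      using absd[OF F[of m], of k] by (simp add: F_def abs_rep_l2)
    then have "norm (X (r m) - X (r k)) = sqrt (\<integral>t. (cmod (F m t - F k t))\<^sup>2 \<partial>per_measure)"
      using norm_l2.abs_eq[OF l2_rel_refl[OF Fd[of m k]]] by simp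
    with r_bd[OF that] have "(\<integral>t. (cmod (F m t - F k t))\<^sup>2 \<partial>per_measure) \<le> ((1/4) ^ k)\<^sup>2"
      by (metis less_imp_le real_sqrt_le_iff real_sqrt_abs abs_of_nonneg zero_le_power zero_le_divide_1_iff zero_le_numeral)
    moreover have "(\<integral>\<^sup>+t. (cmod (F m t - F k t))\<^sup>2 \<partial>per_measure)
        = ennreal (\<integral>t. (cmod (F m t - F k t))\<^sup>2 \<partial>per_measure)"
      using Fd[of m k] by (intro nn_integral_eq_integral) (auto simp: sq_integrable_def)
    ultimately show ?thesis by (simp add: ennreal_leI)
  qed
  have L1: "(\<integral>\<^sup>+t. cmod (F (Suc k) t - F k t) \<partial>per_measure) \<le> ennreal ((2 * pi + 1) * (1/2) ^ k)" for k
  proof -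
    \<comment> \<open>Substitute for Cauchy-Schwarz: either x is at most (1/2)^k, or 2^k x is at
      least 1. Integrated over the increments, the squared L^2 bound 16^(-k) absorbs the factor 2^k;
      this is why the gaps are (1/4)^k.\<close>
    have le: "x \<le> (1/2) ^ k + 2 ^ k * x\<^sup>2" if "x \<ge> 0" for x :: real
    proof (cases "x \<le> (1/2) ^ k")
      case False
      then have "2 ^ k * x \<ge> 2 ^ k * (1/2) ^ k" by (intro mult_left_mono) auto
      then have "2 ^ k * x \<ge> 1" by (simp add: power_mult_distrib[symmetric])
      then have "1 * x \<le> (2 ^ k * x) * x" using that by (intro mult_right_mono)
      moreover have "(0 :: real) \<le> (1/2) ^ k" by simp
      ultimately show ?thesis by (simp only: power2_eq_square mult.assoc)
    qed (simp add: add_increasing2)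
    have "(\<integral>\<^sup>+t. cmod (F (Suc k) t - F k t) \<partial>per_measure)
       \<le> (\<integral>\<^sup>+t. ennreal ((1/2) ^ k) + ennreal (2 ^ k) * ennreal ((cmod (F (Suc k) t - F k t))\<^sup>2) \<partial>per_measure)"
      using le by (intro nn_integral_mono) (simp add: ennreal_mult[symmetric] ennreal_plus[symmetric] del: ennreal_plus)
    also have "\<dots> = ennreal ((1/2) ^ k) * emeasure per_measure {0<..<2*pi}
        + ennreal (2 ^ k) * (\<integral>\<^sup>+t. (cmod (F (Suc k) t - F k t))\<^sup>2 \<partial>per_measure)"
      by (subst nn_integral_add) (auto simp: nn_integral_cmult)
    also have "\<dots> \<le> ennreal ((1/2) ^ k) * ennreal (2 * pi) + ennreal (2 ^ k) * ennreal (((1/4) ^ k)\<^sup>2)"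
      by (intro add_mono mult_mono L2) (auto simp: emeasure_restrict_space)
    also have "\<dots> = ennreal ((1/2) ^ k * (2 * pi) + 2 ^ k * ((1/4) ^ k)\<^sup>2)"
      by (simp add: ennreal_mult ennreal_plus)
    also have "\<dots> \<le> ennreal ((2 * pi + 1) * (1/2) ^ k)"
    proof (rule ennreal_leI)
      have "2 ^ k * ((1/4) ^ k)\<^sup>2 = ((1/8) :: real) ^ k"
        by (simp add: power2_eq_square power_mult_distrib[symmetric])
      also have "\<dots> \<le> (1/2) ^ k" by (intro power_mono) auto
      finally show "(1/2) ^ k * (2 * pi) + 2 ^ k * ((1/4) ^ k)\<^sup>2 \<le> (2 * pi + 1) * (1/2) ^ k"
        by (simp add: algebra_simps)
    qed
    finally show ?thesis .
  qed
  have "(\<integral>\<^sup>+t. (\<Sum>k. ennreal (cmod (F (Suc k) t - F k t))) \<partial>per_measure)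
      = (\<Sum>k. \<integral>\<^sup>+t. cmod (F (Suc k) t - F k t) \<partial>per_measure)"
    by (intro nn_integral_suminf) auto
  also have "\<dots> \<le> (\<Sum>k. ennreal ((2 * pi + 1) * (1/2) ^ k))"
    by (intro suminf_le L1) auto
  also have "\<dots> = ennreal (\<Sum>k. (2 * pi + 1) * (1/2) ^ k)"
    by (intro suminf_ennreal2) (auto intro!: summable_mult summable_geometric)
  also have "\<dots> < \<infinity>" by simp
  finally have "(\<integral>\<^sup>+t. (\<Sum>k. ennreal (cmod (F (Suc k) t - F k t))) \<partial>per_measure) \<noteq> \<infinity>" by simp
  then have "AE t in per_measure. (\<Sum>k. ennreal (cmod (F (Suc k) t - F k t))) \<noteq> \<infinity>"
    by (intro nn_integral_noteq_infinite) auto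
  then have AE_conv: "AE t in per_measure. (\<lambda>k. F k t) \<longlonglongrightarrow> lim (\<lambda>k. F k t)"
  proof eventually_elim
    case (elim t)
    then have "summable (\<lambda>k. cmod (F (Suc k) t - F k t))"
      by (intro summable_suminf_not_top) auto
    then have "summable (\<lambda>k. F (Suc k) t - F k t)" by (rule summable_norm_cancel)
    then have "convergent (\<lambda>k. F 0 t + (\<Sum>i<k. F (Suc i) t - F i t))"
      by (intro convergent_add convergent_const) (simp add: summable_iff_convergent)
    moreover have "F 0 t + (\<Sum>i<k. F (Suc i) t - F i t) = F k t" for k
      by (subst sum_lessThan_telescope) simp
    ultimately show ?case by (simp add: convergent_LIMSEQ_iff)
  qed
  define L where "L t = lim (\<lambda>k. F k t)" for t
  have Lm [measurable]: "L \<in> borel_measurable per_measure"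
    unfolding L_def by (intro borel_measurable_lim_metric) auto
  have Lk: "(\<integral>\<^sup>+t. (cmod (L t - F k t))\<^sup>2 \<partial>per_measure) \<le> ennreal (((1/4) ^ k)\<^sup>2)" for k
  proof -
    have "(\<integral>\<^sup>+t. (cmod (L t - F k t))\<^sup>2 \<partial>per_measure)
        = (\<integral>\<^sup>+t. liminf (\<lambda>m. ennreal ((cmod (F m t - F k t))\<^sup>2)) \<partial>per_measure)"
    proof (rule nn_integral_cong_AE)
      show "AE t in per_measure. ennreal ((cmod (L t - F k t))\<^sup>2)
          = liminf (\<lambda>m. ennreal ((cmod (F m t - F k t))\<^sup>2))"
        using AE_conv
      proof eventually_elim
        case (elim t)
        have "(\<lambda>m. ennreal ((cmod (F m t - F k t))\<^sup>2)) \<longlonglongrightarrow> ennreal ((cmod (L t - F k t))\<^sup>2)"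
          using elim unfolding L_def[symmetric] by (intro tendsto_ennrealI tendsto_intros)
        then show ?case by (rule lim_imp_Liminf[OF sequentially_bot, symmetric])
      qed
    qed
    also have "\<dots> \<le> liminf (\<lambda>m. \<integral>\<^sup>+t. (cmod (F m t - F k t))\<^sup>2 \<partial>per_measure)"
      by (intro nn_integral_liminf) auto
    also have "\<dots> \<le> liminf (\<lambda>m. ennreal (((1/4) ^ k)\<^sup>2))"
      by (intro Liminf_mono) (use L2 in \<open>auto simp: eventually_sequentially\<close>)
    also have "\<dots> = ennreal (((1/4) ^ k)\<^sup>2)" by (simp add: Liminf_const)
    finally show ?thesis .
  qed
  have Lint: "integrable per_measure (\<lambda>t. (cmod (L t - F k t))\<^sup>2)" for k
    by (rule integrableI_bounded) (use Lk[of k] in \<open>auto simp: le_less_trans\<close>)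
  have Lsq: "sq_integrable (\<lambda>t. L t - F k t)" for k
    using Lint by (simp add: sq_integrable_def)
  have Lsq0: "sq_integrable L"
    using sq_integrable_add[OF Lsq[of 0] F[of 0]] by simp
  have bd: "norm (abs_l2 L - X (r k)) \<le> (1/4) ^ k" for k
  proof -
    have "ennreal (\<integral>t. (cmod (L t - F k t))\<^sup>2 \<partial>per_measure) \<le> ennreal (((1/4) ^ k)\<^sup>2)"
      using Lk[of k] Lint[of k] by (subst nn_integral_eq_integral[symmetric]) auto
    then have "(\<integral>t. (cmod (L t - F k t))\<^sup>2 \<partial>per_measure) \<le> ((1/4) ^ k)\<^sup>2"
      by (simp add: ennreal_le_iff)
    then have "sqrt (\<integral>t. (cmod (L t - F k t))\<^sup>2 \<partial>per_measure) \<le> (1/4) ^ k"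
      by (intro real_le_lsqrt) auto
    then show ?thesis
      using norm_l2.abs_eq[OF l2_rel_refl[OF Lsq[of k]]] absd[OF Lsq0, of k] by simp
  qed
  have "(\<lambda>k. X (r k)) \<longlonglongrightarrow> abs_l2 L"
  proof (rule Lim_null_comparison[THEN LIM_zero_cancel])
    show "\<forall>\<^sub>F k in sequentially. norm (X (r k) - abs_l2 L) \<le> (1/4) ^ k"
      using bd by (simp add: norm_minus_commute)
  qed (simp add: LIMSEQ_realpow_zero)
  then have "X \<longlonglongrightarrow> abs_l2 L"
    using Cauchy_converges_subseq[OF X r_mono] by (simp add: o_def)
  then show ?thesis by (auto simp: convergent_def)
qed

instance l2 :: banach
  by standard (rule l2_complete)

section \<open>Fourier series\<close>

lemma has_vector_derivative_exp_linear:
  fixes c :: complex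
  shows "((\<lambda>t. exp (c * of_real t)) has_vector_derivative c * exp (c * of_real t)) (at t within S)"
  by (rule has_vector_derivative_real_field) (auto intro!: derivative_eq_intros)

lemma integrable_exp_int: "integrable per_measure (\<lambda>t. exp (\<i> * of_int k * of_real t))"
  by (rule per_integrable_bounded[of _ 1])
     (auto intro!: per_measurable_continuous continuous_intros)

lemma integral_exp_int:
  "(\<integral>t. exp (\<i> * of_int k * of_real t) \<partial>per_measure) = (if k = 0 then 2 * pi else 0)"
proof -
  have eq: "(\<integral>t. exp (\<i> * of_int k * of_real t) \<partial>per_measure)
      = integral {0..2*pi} (\<lambda>t. exp (\<i> * of_int k * of_real t))"
    by (rule per_integral_eq_integral[OF integrable_exp_int])
  show ?thesis
  proof (cases "k = 0")
    case True
    then show ?thesis using eq by (simp add: scaleR_conv_of_real)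
  next
    case False
    define c where "c = \<i> * of_int k"
    have c: "c \<noteq> 0" using False by (simp add: c_def)
    have "((\<lambda>t. exp (c * of_real t)) has_integral exp (c * of_real (2*pi)) / c - exp (c * of_real 0) / c) {0..2*pi}"
    proof (rule fundamental_theorem_of_calculus)
      show "((\<lambda>t. exp (c * of_real t) / c) has_vector_derivative exp (c * of_real t)) (at t within {0..2*pi})" for t
        using has_vector_derivative_divide[OF has_vector_derivative_exp_linear[of c t "{0..2*pi}"], of c] c by simp
    qed simp
    moreover have "exp (c * of_real (2*pi)) = 1"
    proof -
      have "c * of_real (2*pi) = \<i> * (of_int k * (of_real pi * 2))" by (simp add: c_def)
      then show ?thesis using exp_integer_2pi[of "of_int k"] by (simp add: mult_ac)
    qed
    ultimately show ?thesis using False eq by (auto simp: c_def dest: integral_unique)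
  qed
qed

lemma l2_rel_exp_int:
  "l2_rel (\<lambda>t. exp (\<i> * of_int k * of_real t)) (\<lambda>t. exp (\<i> * of_int k * of_real t))"
  by (intro l2_rel_refl sq_integrable_bounded[of _ 1])
     (auto intro!: per_measurable_continuous continuous_intros)

lemma trig_abs: "trig k = abs_l2 (\<lambda>t. exp (\<i> * of_int k * of_real t))"
  by (simp add: trig_def)

lemma rep_trig: "AE t in per_measure. rep_l2 (trig k) t = exp (\<i> * of_int k * of_real t)"
  unfolding trig_abs using l2_rel_exp_int[of k] by (intro rep_abs_l2) (simp add: l2_rel_def)

lemma cinner_trig: "cinner (trig j) (trig k) = (if j = k then 2 * pi else 0)"
proof -
  have "cinner (trig j) (trig k)
      = (\<integral>t. exp (\<i> * of_int j * of_real t) * cnj (exp (\<i> * of_int k * of_real t)) \<partial>per_measure)"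
    unfolding trig_abs by (rule cinner.abs_eq[OF l2_rel_exp_int l2_rel_exp_int])
  also have "\<dots> = (\<integral>t. exp (\<i> * of_int (j - k) * of_real t) \<partial>per_measure)"
    by (rule Bochner_Integration.integral_cong)
       (auto simp: exp_cnj mult_exp_exp algebra_simps)
  finally show ?thesis by (simp only: integral_exp_int) auto
qed

text \<open>\<open>trig k\<close> has squared norm 2 pi, so the division yields the usual Fourier
  coefficient, at the price of a factor 2 pi in the norm identities.\<close>

definition coef :: "l2 \<Rightarrow> int \<Rightarrow> complex" where
  "coef f k = cinner f (trig k) / (2 * pi)"

definition trig_sum :: "int set \<Rightarrow> (int \<Rightarrow> complex) \<Rightarrow> l2" where
  "trig_sum S a = (\<Sum>k\<in>S. cscale (a k) (trig k))"

lemma cinner_trig_right: "cinner f (trig k) = 2 * pi * coef f k"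
  by (simp add: coef_def)

lemma coef_add: "coef (f + g) k = coef f k + coef g k"
  by (simp add: coef_def cinner_add_left add_divide_distrib)

lemma coef_diff: "coef (f - g) k = coef f k - coef g k"
  by (simp add: coef_def cinner_diff_left diff_divide_distrib)

lemma coef_cscale: "coef (cscale c f) k = c * coef f k"
  by (simp add: coef_def cinner_cscale_left)

lemma coef_zero [simp]: "coef 0 k = 0"
  by (simp add: coef_def)

lemma coef_sum: "coef (sum f S) k = (\<Sum>i\<in>S. coef (f i) k)"
  by (simp add: coef_def cinner_sum_left sum_divide_distrib)

lemma coef_trig: "coef (trig j) k = (if j = k then 1 else 0)"
  by (simp add: coef_def cinner_trig)

lemma coef_trig_sum: "finite S \<Longrightarrow> coef (trig_sum S a) k = (if k \<in> S then a k else 0)"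
  by (simp add: trig_sum_def coef_sum coef_cscale coef_trig if_distrib[of "(*) _"] cong: if_cong)

lemma tendsto_coef: "(f \<longlongrightarrow> l) F \<Longrightarrow> ((\<lambda>x. coef (f x) k) \<longlongrightarrow> coef l k) F"
  unfolding coef_def by (intro tendsto_divide tendsto_cinner_left tendsto_const) auto

lemma cinner_trig_sum_right:
  "cinner f (trig_sum S a) = 2 * pi * (\<Sum>k\<in>S. coef f k * cnj (a k))"
  by (simp add: trig_sum_def cinner_sum_right cinner_cscale_right cinner_trig_right sum_distrib_left mult_ac)

lemma norm_trig_sum:
  assumes "finite S" shows "(norm (trig_sum S a))\<^sup>2 = 2 * pi * (\<Sum>k\<in>S. (cmod (a k))\<^sup>2)"
proof -
  have "complex_of_real ((norm (trig_sum S a))\<^sup>2) = of_real (2 * pi * (\<Sum>k\<in>S. (cmod (a k))\<^sup>2))"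
    unfolding cinner_self[symmetric] cinner_trig_sum_right
    using assms by (simp add: coef_trig_sum complex_norm_square[symmetric])
  then show ?thesis by (simp only: of_real_eq_iff)
qed

lemma trig_sum_Diff:
  "finite S \<Longrightarrow> T \<subseteq> S \<Longrightarrow> trig_sum S a - trig_sum T a = trig_sum (S - T) a"
  by (simp add: trig_sum_def sum_diff)

lemma norm_pythagoras:
  assumes "cinner f g = 0" shows "(norm (f + g))\<^sup>2 = (norm f)\<^sup>2 + (norm g)\<^sup>2"
proof -
  have "cinner g f = 0" using assms by (metis cinner_commute complex_cnj_zero)
  then have "complex_of_real ((norm (f + g))\<^sup>2) = of_real ((norm f)\<^sup>2 + (norm g)\<^sup>2)"
    using assms by (simp add: cinner_self[symmetric] cinner_add_left cinner_add_right
        del: of_real_power)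
  then show ?thesis by (simp only: of_real_eq_iff)
qed

lemma norm_minus_trig_sum:
  assumes "finite S"
  shows "(norm f)\<^sup>2 = 2 * pi * (\<Sum>k\<in>S. (cmod (coef f k))\<^sup>2) + (norm (f - trig_sum S (coef f)))\<^sup>2"
proof -
  have "cinner (f - trig_sum S (coef f)) (trig_sum S (coef f)) = 0"
    using assms by (simp add: cinner_trig_sum_right coef_diff coef_trig_sum)
  then have "(norm ((f - trig_sum S (coef f)) + trig_sum S (coef f)))\<^sup>2
      = (norm (f - trig_sum S (coef f)))\<^sup>2 + (norm (trig_sum S (coef f)))\<^sup>2"
    by (rule norm_pythagoras)
  then show ?thesis by (simp add: norm_trig_sum[OF assms])
qed

lemma bessel:
  assumes "finite S" shows "2 * pi * (\<Sum>k\<in>S. (cmod (coef f k))\<^sup>2) \<le> (norm f)\<^sup>2"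
  using norm_minus_trig_sum[OF assms, of f] by simp

lemma inj_on_cis: "inj_on cis {0..<2 * pi}"
proof (rule inj_onI)
  fix s t assume st: "s \<in> {0..<2 * pi}" "t \<in> {0..<2 * pi}" and "cis s = cis t"
  then have "Arg2pi (cis s) = Arg2pi (cis t)" by simp
  moreover have "Arg2pi (cis u) = u" if "u \<in> {0..<2 * pi}" for u
    using that by (intro Arg2pi_unique[of 1]) (auto simp: cis_conv_exp)
  ultimately show "s = t" using st by simp
qed

text \<open>With p t = exp(it) the products of powers of p and \<open>cnj p\<close> are exponentials
  again, so vanishing coefficients are vanishing moments on the unit circle.\<close>

lemma trig_total:
  assumes "\<And>k. coef f k = 0" shows "f = 0"
proof -
  define p where "p t = exp (\<i> * of_real t)" for t :: real
  have p: "continuous_on UNIV p" unfolding p_def by (intro continuous_intros)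
  have pm: "p \<in> borel_measurable per_measure" by (rule per_measurable_continuous[OF p])
  have int: "integrable per_measure (rep_l2 f)"
    by (intro sq_integrable_imp_integrable sq_integrable_rep)
  have "(\<integral>t. rep_l2 f t * (p t ^ k * cnj (p t) ^ l) \<partial>per_measure) = 0" for k l
  proof -
    have "(\<integral>t. rep_l2 f t * (p t ^ k * cnj (p t) ^ l) \<partial>per_measure)
        = (\<integral>t. rep_l2 f t * cnj (exp (\<i> * of_int (int l - int k) * of_real t)) \<partial>per_measure)"
      by (rule Bochner_Integration.integral_cong)
         (auto simp: p_def exp_cnj exp_of_nat_mult[symmetric] mult_exp_exp algebra_simps)
    also have "\<dots> = cinner f (trig (int l - int k))"
      unfolding cinner_rep
    proof (rule integral_cong_AE)
      show "AE t in per_measure. rep_l2 f t * cnj (exp (\<i> * of_int (int l - int k) * of_real t))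
          = rep_l2 f t * cnj (rep_l2 (trig (int l - int k)) t)"
        using rep_trig[of "int l - int k"] by eventually_elim simp
    qed (use integrable_mult_cnj[OF sq_integrable_rep sq_integrable_rep]
          integrable_mult_cnj[OF sq_integrable_rep, of "\<lambda>t. exp (\<i> * of_int (int l - int k) * of_real t)"]
          l2_rel_exp_int[of "int l - int k"] in \<open>auto simp: l2_rel_def\<close>)
    finally show ?thesis using assms by (simp add: cinner_trig_right)
  qed
  then have orth: "(\<integral>t. rep_l2 f t * of_real (G (p t)) \<partial>per_measure) = 0"
    if "continuous_on UNIV G" for G :: "complex \<Rightarrow> real"
    by (intro moments_zero_imp_orthogonal_continuous[OF int pm, of 1] that) (auto simp: p_def)
  have "AE t in per_measure. rep_l2 f t = 0"
  proof (rule per_AE_zero_of_injective[OF int p])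
    have "p = cis" by (auto simp: p_def cis_conv_exp)
    then show "inj_on p {0..<2 * pi}" using inj_on_cis by simp
    show "p (2 * pi) = p 0" by (simp add: p_def mult.commute[of \<i>])
  qed (intro orthogonal_continuous_imp_closed[OF int pm orth])
  moreover have "AE t in per_measure. rep_l2 (0 :: l2) t = 0"
    unfolding zero_l2_def by (rule rep_abs_l2[OF sq_integrable_const])
  ultimately have "AE t in per_measure. rep_l2 f t = rep_l2 (0 :: l2) t" by eventually_elim simp
  then show ?thesis by (rule l2_eqI)
qed

lemma l2_eq_coefI: "(\<And>k. coef f k = coef g k) \<Longrightarrow> f = g"
  using trig_total[of "f - g"] by (simp add: coef_diff)

lemma finite_subset_int_interval:
  fixes F :: "int set" assumes "finite F" obtains N where "F \<subseteq> {- int N..int N}"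
proof -
  define B where "B = Max (abs ` insert 0 F)"
  have B: "\<bar>k\<bar> \<le> B" if "k \<in> F" for k unfolding B_def using that assms by (intro Max_ge) auto
  show ?thesis by (rule that[of "nat B"]) (use B in force)
qed

text \<open>Squared distances of symmetric partial sums are increments of a bounded increasing
  sequence. The lemma is the tool for producing a function with prescribed coefficients.\<close>

lemma riesz_fischer:
  fixes a :: "int \<Rightarrow> complex"
  assumes B: "\<And>n. (\<Sum>k\<in>{- int n..int n}. (cmod (a k))\<^sup>2) \<le> B"
  obtains f where "coef f = a" "(\<lambda>n. trig_sum {- int n..int n} a) \<longlonglongrightarrow> f"
proof -
  let ?s = "\<lambda>n::nat. (\<Sum>k\<in>{- int n..int n}. (cmod (a k))\<^sup>2)"
  have "incseq ?s" by (intro monoI sum_mono2) auto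
  then have "convergent ?s"
    by (rule Bseq_mono_convergent[rotated, unfolded incseq_def[symmetric]])
       (use B in \<open>auto simp: incseq_def abs_of_nonneg[OF sum_nonneg] intro!: BseqI'[of _ B]\<close>)
  then have C: "Cauchy ?s" by (rule convergent_Cauchy)
  have "Cauchy (\<lambda>n. trig_sum {- int n..int n} a)"
  proof (rule metric_CauchyI)
    fix e :: real assume e: "e > 0"
    then obtain M where M: "\<And>m n. m \<ge> M \<Longrightarrow> n \<ge> M \<Longrightarrow> dist (?s m) (?s n) < e\<^sup>2 / (2 * pi)"
      using metric_CauchyD[OF C, of "e\<^sup>2 / (2 * pi)"] by auto
    have *: "norm (trig_sum {- int n..int n} a - trig_sum {- int m..int m} a) < e" if "M \<le> m" "m \<le> n" for m n
    proof -
      have sub: "{- int m..int m} \<subseteq> {- int n..int n}" using that by auto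
      have "(norm (trig_sum {- int n..int n} a - trig_sum {- int m..int m} a))\<^sup>2 = 2 * pi * (?s n - ?s m)"
        using sub by (simp add: trig_sum_Diff norm_trig_sum sum_diff)
      also have "\<dots> < 2 * pi * (e\<^sup>2 / (2 * pi))"
        using M[of n m] that by (intro mult_strict_left_mono) (auto simp: dist_real_def)
      finally show ?thesis using e by (simp add: power2_less_imp_less)
    qed
    have "dist (trig_sum {- int m..int m} a) (trig_sum {- int n..int n} a) < e" if "M \<le> m" "M \<le> n" for m n
      using *[of m n] *[of n m] that by (cases "m \<le> n") (auto simp: dist_norm norm_minus_commute)
    then show "\<exists>M. \<forall>m\<ge>M. \<forall>n\<ge>M. dist (trig_sum {- int m..int m} a) (trig_sum {- int n..int n} a) < e"
      by blast
  qed
  then obtain f where f: "(\<lambda>n. trig_sum {- int n..int n} a) \<longlonglongrightarrow> f"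
    using l2_complete by (auto simp: convergent_def)
  have "coef f k = a k" for k
  proof (rule LIMSEQ_unique[OF tendsto_coef[OF f, of k]])
    have "eventually (\<lambda>n. coef (trig_sum {- int n..int n} a) k = a k) sequentially"
      using eventually_ge_at_top[of "nat \<bar>k\<bar>"] by eventually_elim (auto simp: coef_trig_sum)
    then show "(\<lambda>n. coef (trig_sum {- int n..int n} a) k) \<longlonglongrightarrow> a k" by (rule tendsto_eventually)
  qed
  with f show ?thesis using that by blast
qed

lemma trig_sum_coef_tendsto: "(\<lambda>n. trig_sum {- int n..int n} (coef f)) \<longlonglongrightarrow> f"
proof -
  have "(\<Sum>k\<in>{- int n..int n}. (cmod (coef f k))\<^sup>2) \<le> (norm f)\<^sup>2 / (2 * pi)" for n
    using bessel[of "{- int n..int n}" f] by (simp add: field_simps)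
  then obtain h where "coef h = coef f" "(\<lambda>n. trig_sum {- int n..int n} (coef f)) \<longlonglongrightarrow> h"
    by (rule riesz_fischer)
  then show ?thesis using l2_eq_coefI[of h f] by simp
qed

text \<open>Adding frequencies never increases the distance from f, so convergence of the symmetric
  partial sums carries over to the net of all finite index sets.\<close>

lemma has_sum_fourier: "((\<lambda>k. cscale (coef f k) (trig k)) has_sum f) UNIV"
  unfolding has_sum_def tendsto_iff eventually_finite_subsets_at_top
proof (intro allI impI)
  fix e :: real assume e: "e > 0"
  have "eventually (\<lambda>n. dist (trig_sum {- int n..int n} (coef f)) f < e) sequentially"
    using tendstoD[OF trig_sum_coef_tendsto e] .
  then obtain n where n: "dist (trig_sum {- int n..int n} (coef f)) f < e"
    by (auto simp: eventually_sequentially)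
  have "dist (\<Sum>k\<in>F. cscale (coef f k) (trig k)) f < e"
    if F: "finite F" "{- int n..int n} \<subseteq> F" for F
  proof -
    have "(\<Sum>k\<in>{- int n..int n}. (cmod (coef f k))\<^sup>2) \<le> (\<Sum>k\<in>F. (cmod (coef f k))\<^sup>2)"
      using F by (intro sum_mono2) auto
    then have "2 * pi * (\<Sum>k\<in>{- int n..int n}. (cmod (coef f k))\<^sup>2) \<le> 2 * pi * (\<Sum>k\<in>F. (cmod (coef f k))\<^sup>2)"
      by (intro mult_left_mono) auto
    then have "(norm (f - trig_sum F (coef f)))\<^sup>2 \<le> (norm (f - trig_sum {- int n..int n} (coef f)))\<^sup>2"
      using norm_minus_trig_sum[OF F(1), of f] norm_minus_trig_sum[OF finite_atLeastAtMost_int[of "- int n" "int n"], of f] by linarith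
    then have "norm (f - trig_sum F (coef f)) \<le> norm (f - trig_sum {- int n..int n} (coef f))"
      by (rule power2_le_imp_le) simp
    also have "\<dots> < e" using n by (simp add: dist_norm norm_minus_commute)
    finally show ?thesis by (simp add: dist_norm norm_minus_commute trig_sum_def)
  qed
  then show "\<exists>X. finite X \<and> X \<subseteq> UNIV \<and>
      (\<forall>Y. finite Y \<and> X \<subseteq> Y \<and> Y \<subseteq> UNIV \<longrightarrow> dist (\<Sum>k\<in>Y. cscale (coef f k) (trig k)) f < e)"
    by (intro exI[of _ "{- int n..int n}"]) auto
qed

lemma has_sum_coef_unique:
  assumes "((\<lambda>k. cscale (a k) (trig k)) has_sum f) UNIV" shows "coef f = a"
proof
  fix j
  have "((\<lambda>F. \<Sum>k\<in>F. cscale (a k) (trig k)) \<longlongrightarrow> f) (finite_subsets_at_top UNIV)"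
    using assms by (simp add: has_sum_def)
  from tendsto_coef[OF this, of j]
  have lim: "((\<lambda>F. coef (\<Sum>k\<in>F. cscale (a k) (trig k)) j) \<longlongrightarrow> coef f j) (finite_subsets_at_top UNIV)" .
  have "eventually (\<lambda>F. coef (\<Sum>k\<in>F. cscale (a k) (trig k)) j = a j) (finite_subsets_at_top UNIV)"
    unfolding eventually_finite_subsets_at_top trig_sum_def[symmetric]
    by (intro exI[of _ "{j}"]) (auto simp: coef_trig_sum)
  then have "((\<lambda>F. coef (\<Sum>k\<in>F. cscale (a k) (trig k)) j) \<longlongrightarrow> a j) (finite_subsets_at_top UNIV)"
    by (rule tendsto_eventually)
  then show "coef f j = a j"
    by (rule tendsto_unique[OF finite_subsets_at_top_neq_bot lim])
qed

text \<open>The coefficients in the definition of \<open>sobolev\<close> are forced by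
  \<open>has_sum_coef_unique\<close>, and for nonnegative terms unordered summability amounts to a
  bound on the symmetric partial sums.\<close>

lemma sobolev_iff:
  "f \<in> sobolev r \<longleftrightarrow>
    (\<exists>B. \<forall>n. (\<Sum>k\<in>{- int n..int n}. (1 + (real_of_int k)\<^sup>2) powr r * (cmod (coef f k))\<^sup>2) \<le> B)"
    (is "_ \<longleftrightarrow> (\<exists>B. \<forall>n. ?s n \<le> B)")
proof
  assume "f \<in> sobolev r"
  then obtain a where a: "(\<lambda>k. (1 + (real_of_int k)\<^sup>2) powr r * (cmod (a k))\<^sup>2) summable_on UNIV"
    "((\<lambda>k. cscale (a k) (trig k)) has_sum f) UNIV"
    by (auto simp: sobolev_def)
  have "?s n \<le> infsum (\<lambda>k. (1 + (real_of_int k)\<^sup>2) powr r * (cmod (coef f k))\<^sup>2) UNIV" for n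
    using a(1) unfolding has_sum_coef_unique[OF a(2)]
    by (intro finite_sum_le_infsum) auto
  then show "\<exists>B. \<forall>n. ?s n \<le> B" by blast
next
  assume "\<exists>B. \<forall>n. ?s n \<le> B"
  then obtain B where B: "\<And>n. ?s n \<le> B" by blast
  have "(\<lambda>k. (1 + (real_of_int k)\<^sup>2) powr r * (cmod (coef f k))\<^sup>2) summable_on UNIV"
  proof (rule nonneg_bdd_above_summable_on)
    show "bdd_above (sum (\<lambda>k. (1 + (real_of_int k)\<^sup>2) powr r * (cmod (coef f k))\<^sup>2) ` {F. F \<subseteq> UNIV \<and> finite F})"
    proof (rule bdd_aboveI[of _ B], clarify)
      fix F :: "int set" assume "finite F"
      then obtain N where N: "F \<subseteq> {- int N..int N}" by (rule finite_subset_int_interval)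
      then have "(\<Sum>k\<in>F. (1 + (real_of_int k)\<^sup>2) powr r * (cmod (coef f k))\<^sup>2) \<le> ?s N"
        by (intro sum_mono2) auto
      also have "\<dots> \<le> B" by (rule B)
      finally show "(\<Sum>k\<in>F. (1 + (real_of_int k)\<^sup>2) powr r * (cmod (coef f k))\<^sup>2) \<le> B" .
    qed
  qed auto
  then show "f \<in> sobolev r" using has_sum_fourier by (auto simp: sobolev_def)
qed

section \<open>Logarithmic energy\<close>

lemma borel_measurable_cnj [measurable]:
  "f \<in> borel_measurable M \<Longrightarrow> (\<lambda>x. cnj (f x)) \<in> borel_measurable M"
  by (rule measurable_compose[of _ _ borel])
     (auto intro!: borel_measurable_continuous_onI continuous_intros)

text \<open>The quotient is the integral of exp(-sc) over c in [a, b]; after exchanging the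
  integrals, 1/c is left.\<close>

lemma nn_integral_frullani:
  fixes a b :: real assumes "0 < a" "a \<le> b"
  shows "(\<integral>\<^sup>+s. ennreal (indicator {0<..} s * ((exp (- s * a) - exp (- s * b)) / s)) \<partial>lborel) = ennreal (ln b - ln a)"
proof -

  have "(\<integral>\<^sup>+s. ennreal (indicator {0<..} s * ((exp (- s * a) - exp (- s * b)) / s)) \<partial>lborel)
      = (\<integral>\<^sup>+s. (\<integral>\<^sup>+c. indicator {0<..} s * (ennreal (exp (- s * c)) * indicator {a..b} c) \<partial>lborel) \<partial>lborel)"
  proof (rule nn_integral_cong)
    fix s :: real
    show "ennreal (indicator {0<..} s * ((exp (- s * a) - exp (- s * b)) / s))
        = (\<integral>\<^sup>+c. indicator {0<..} s * (ennreal (exp (- s * c)) * indicator {a..b} c) \<partial>lborel)"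
    proof (cases "s > 0")
      case True
      have "(\<integral>\<^sup>+c. ennreal (exp (- s * c)) * indicator {a..b} c \<partial>lborel)
          = (- exp (- s * b) / s) - (- exp (- s * a) / s)"
      proof (rule nn_integral_FTC_Icc)
        show "DERIV (\<lambda>c. - exp (- s * c) / s) x :> exp (- s * x)" for x
          using True by (auto intro!: derivative_eq_intros)
      qed (use assms in auto)
      then show ?thesis using True by (simp add: diff_divide_distrib)
    qed simp
  qed
  also have "\<dots> = (\<integral>\<^sup>+c. (\<integral>\<^sup>+s. indicator {0<..} s * (ennreal (exp (- s * c)) * indicator {a..b} c) \<partial>lborel) \<partial>lborel)"
    by (rule lborel_pair.Fubini'[symmetric]) measurable
  also have "\<dots> = (\<integral>\<^sup>+c. ennreal (1 / c) * indicator {a..b} c \<partial>lborel)"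
  proof (rule nn_integral_cong)
    fix c :: real
    show "(\<integral>\<^sup>+s. indicator {0<..} s * (ennreal (exp (- s * c)) * indicator {a..b} c) \<partial>lborel)
        = ennreal (1 / c) * indicator {a..b} c"
    proof (cases "c \<in> {a..b}")
      case True
      then have c: "c > 0" using assms by auto
      have "(\<integral>\<^sup>+s. indicator {0<..} s * (ennreal (exp (- s * c)) * indicator {a..b} c) \<partial>lborel)
          = (\<integral>\<^sup>+s. ennreal (exp (- s * c)) * indicator {0..} s \<partial>lborel)"
      proof (rule nn_integral_cong_AE)
        show "AE s in lborel. indicator {0<..} s * (ennreal (exp (- s * c)) * indicator {a..b} c)
            = ennreal (exp (- s * c)) * indicator {0..} s"
          using AE_lborel_singleton[of 0] by eventually_elim (use True in \<open>auto simp: indicator_def\<close>)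
      qed
      also have "\<dots> = ennreal (0 - (- exp (- 0 * c) / c))"
      proof (rule nn_integral_FTC_atLeast)
        show "DERIV (\<lambda>s. - exp (- s * c) / c) x :> exp (- x * c)" for x
          using c by (auto intro!: derivative_eq_intros)
        have "filterlim (\<lambda>s. - s * c) at_bot at_top"
          using c by (auto intro!: filterlim_uminus_at_bot[THEN iffD2] filterlim_at_top_mult_tendsto_pos[OF tendsto_const] filterlim_ident
              simp: mult.commute)
        then have "((\<lambda>s. exp (- s * c)) \<longlongrightarrow> 0) at_top"
          by (rule filterlim_compose[OF exp_at_bot])
        then have "((\<lambda>s. - exp (- s * c) / c) \<longlongrightarrow> - 0 / c) at_top"
          by (intro tendsto_divide tendsto_minus tendsto_const) (use c in auto)
        then show "((\<lambda>s. - exp (- s * c) / c) \<longlongrightarrow> 0) at_top" by simp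
      qed auto
      finally show ?thesis using True by simp
    qed auto
  qed
  also have "\<dots> = ln b - ln a"
  proof (rule nn_integral_FTC_Icc)
    show "DERIV ln x :> 1 / x" if "x \<in> {a..b}" for x
      using that assms by (auto intro!: derivative_eq_intros)
  qed (use assms in auto)
  finally show ?thesis .
qed

lemma
  fixes a :: real assumes a: "a > 0"
  shows frullani_integrable:
      "integrable lborel (\<lambda>s. indicator {0<..} s * ((exp (- s * a) - exp (- s)) / s))"
    and frullani: "(\<integral>s. indicator {0<..} s * ((exp (- s * a) - exp (- s)) / s) \<partial>lborel) = - ln a"
    and frullani_norm: "(\<integral>s. norm (indicator {0<..} s * ((exp (- s * a) - exp (- s)) / s)) \<partial>lborel) = \<bar>ln a\<bar>"
proof -
  let ?f = "\<lambda>s. indicator {0<..} s * ((exp (- s * a) - exp (- s)) / s) :: real"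
  \<comment> \<open>The integrand has a single sign on the half-line, determined by whether a \<le>
    1. With \<open>sg\<close> as that sign, one nonnegative integral gives both the value and the
    L^1 norm.\<close>
  have "\<exists>sg. \<bar>sg\<bar> = 1 \<and> sg * ln a \<le> 0 \<and> has_bochner_integral lborel (\<lambda>s. sg * ?f s) (- (sg * ln a)) \<and>
      (\<forall>s. sg * ?f s \<ge> 0)"
  proof (cases "a \<le> 1")
    case True
    have nonneg: "?f s \<ge> 0" for s
    proof (cases "s > 0")
      case s: True
      then have "s * a \<le> s * 1" using True by (intro mult_left_mono) auto
      then show ?thesis using s by simp
    qed simp
    have "has_bochner_integral lborel ?f (ln 1 - ln a)"
      using nn_integral_frullani[OF a True] nonneg True a
      by (intro has_bochner_integral_nn_integral) auto
    then show ?thesis using nonneg True a by (intro exI[of _ 1]) auto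
  next
    case False
    have nonneg: "- ?f s \<ge> 0" for s
    proof (cases "s > 0")
      case s: True
      then have "s * 1 \<le> s * a" using False by (intro mult_left_mono) auto
      then show ?thesis using s by (simp add: field_simps)
    qed simp
    have eq: "indicator {0<..} s * ((exp (- s * 1) - exp (- s * a)) / s) = - ?f s" for s
      by (auto simp: indicator_def field_simps)
    have "has_bochner_integral lborel (\<lambda>s. - ?f s) (ln a - ln 1)"
      using nn_integral_frullani[of 1 a] nonneg False a unfolding eq
      by (intro has_bochner_integral_nn_integral) auto
    then show ?thesis using nonneg False a by (intro exI[of _ "-1"]) auto
  qed
  then obtain sg where sg: "\<bar>sg\<bar> = 1" "sg * ln a \<le> 0"
    "has_bochner_integral lborel (\<lambda>s. sg * ?f s) (- (sg * ln a))" "\<And>s. sg * ?f s \<ge> 0" by blast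
  have "sg * sg = 1" using sg(1) by (auto simp: abs_if split: if_splits)
  then have eq: "?f s = sg * (sg * ?f s)" for s by (simp add: mult.assoc[symmetric])
  have "has_bochner_integral lborel (\<lambda>s. sg * (sg * ?f s)) (sg * (- (sg * ln a)))"
    by (intro has_bochner_integral_mult_right sg)
  then have has: "has_bochner_integral lborel ?f (- ln a)"
    using \<open>sg * sg = 1\<close> by (simp only: eq[symmetric]) (simp add: mult.assoc[symmetric])
  then show "integrable lborel ?f" "integral\<^sup>L lborel ?f = - ln a"
    by (auto simp: has_bochner_integral_iff)
  have "norm (?f s) = sg * ?f s" for s
    using sg(4)[of s] sg(1) by (metis abs_mult abs_of_nonneg mult_1 real_norm_def)
  then have "(\<integral>s. norm (?f s) \<partial>lborel) = - (sg * ln a)"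
    using sg(3) by (simp add: has_bochner_integral_iff)
  also have "\<dots> = \<bar>ln a\<bar>" using sg(1,2) by (metis abs_mult abs_of_nonpos mult_1)
  finally show "(\<integral>s. norm (?f s) \<partial>lborel) = \<bar>ln a\<bar>" .
qed

section \<open>Gaussian and logarithmic energies of a charge\<close>

lemma (in sigma_finite_measure)
  fixes f g :: "'a \<Rightarrow> complex"
  assumes f: "integrable M f" and g: "integrable M g"
  shows integrable_prod: "integrable (M \<Otimes>\<^sub>M M) (\<lambda>z. f (fst z) * g (snd z))"
    and integral_prod: "(\<integral>z. f (fst z) * g (snd z) \<partial>(M \<Otimes>\<^sub>M M)) = (\<integral>x. f x \<partial>M) * (\<integral>x. g x \<partial>M)"
proof -
  interpret self_pair: pair_sigma_finite M M ..
  have [measurable]: "f \<in> borel_measurable M" "g \<in> borel_measurable M" using f g by auto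
  show *: "integrable (M \<Otimes>\<^sub>M M) (\<lambda>z. f (fst z) * g (snd z))"
    by (rule self_pair.Fubini_integrable) (use f g in \<open>auto simp: norm_mult\<close>)
  show "(\<integral>z. f (fst z) * g (snd z) \<partial>(M \<Otimes>\<^sub>M M)) = (\<integral>x. f x \<partial>M) * (\<integral>x. g x \<partial>M)"
    using self_pair.integral_fst'[OF *] by simp
qed

text \<open>Once exp(-s|x|^2) is absorbed into h, the binomial expansion of (x cnj y + y cnj x)^n
  separates the variables, and the n-th term becomes a nonnegative combination of squared moduli of
  moments. The formula thus shows that the energy is nonnegative and that it controls every single
  moment.\<close>

lemma (in sigma_finite_measure) gaussian_energy_sums:
  fixes \<phi> p :: "'a \<Rightarrow> complex" and s :: real
  assumes \<phi>: "integrable M \<phi>" and p[measurable]: "p \<in> borel_measurable M"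
    and R: "\<And>x. x \<in> space M \<Longrightarrow> norm (p x) \<le> R" and s: "s > 0"
  defines "h \<equiv> \<lambda>x. \<phi> x * of_real (exp (- s * (cmod (p x))\<^sup>2))"
  shows "integrable M h"
    and "(\<lambda>n. s ^ n / fact n * (\<Sum>k\<le>n. real (n choose k) *
            (cmod (\<integral>x. h x * (p x ^ (n - k) * cnj (p x) ^ k) \<partial>M))\<^sup>2)) sums
          Re (\<integral>z. cnj (\<phi> (fst z)) * \<phi> (snd z) * exp (- s * (cmod (p (fst z) - p (snd z)))\<^sup>2) \<partial>(M \<Otimes>\<^sub>M M))"
proof -
  have [measurable]: "\<phi> \<in> borel_measurable M" using \<phi> by auto
  show h: "integrable M h"
    unfolding h_def by (rule integrable_mult_continuous_image[OF \<phi> p R]) (auto intro!: continuous_intros)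
  then have [measurable]: "h \<in> borel_measurable M" by auto
  define X where "X z = p (fst z) * cnj (p (snd z))" for z
  define H where "H z = cnj (h (fst z)) * h (snd z)" for z
  define f where "f n z = H z * ((of_real s * (X z + cnj (X z))) ^ n / fact n)" for n :: nat and z
  have Hint: "integrable (M \<Otimes>\<^sub>M M) H"
    unfolding H_def using h by (intro integrable_prod) auto
  have Hm [measurable]: "H \<in> borel_measurable (M \<Otimes>\<^sub>M M)" using Hint by auto
  have Xm [measurable]: "X \<in> borel_measurable (M \<Otimes>\<^sub>M M)" unfolding X_def by measurable
  have hp: "integrable M (\<lambda>x. h x * (p x ^ i * cnj (p x) ^ j))" for i j
    by (rule integrable_mult_continuous_image[OF h p R]) (auto intro!: continuous_intros)
  define m where "m i j = (\<integral>x. h x * (p x ^ i * cnj (p x) ^ j) \<partial>M)" for i j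
  have f_expand: "f n z = (\<Sum>k\<le>n. of_real (s ^ n / fact n * real (n choose k)) *
      (cnj (h (fst z) * (p (fst z) ^ (n - k) * cnj (p (fst z)) ^ k)) * (h (snd z) * (p (snd z) ^ (n - k) * cnj (p (snd z)) ^ k))))" for n z
    unfolding f_def H_def power_mult_distrib[of "of_real s"] binomial_ring sum_distrib_left sum_divide_distrib
    by (intro sum.cong refl) (simp add: X_def power_mult_distrib field_simps)
  have term_int: "integrable (M \<Otimes>\<^sub>M M)
      (\<lambda>z. cnj (h (fst z) * (p (fst z) ^ i * cnj (p (fst z)) ^ j)) * (h (snd z) * (p (snd z) ^ i * cnj (p (snd z)) ^ j)))"
    and term_val: "(\<integral>z. cnj (h (fst z) * (p (fst z) ^ i * cnj (p (fst z)) ^ j)) * (h (snd z) * (p (snd z) ^ i * cnj (p (snd z)) ^ j)) \<partial>(M \<Otimes>\<^sub>M M))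
        = of_real ((cmod (m i j))\<^sup>2)" for i j
  proof -
    have c: "integrable M (\<lambda>x. cnj (h x * (p x ^ i * cnj (p x) ^ j)))"
      by (rule integrable_cnj[OF hp])
    show "integrable (M \<Otimes>\<^sub>M M)
      (\<lambda>z. cnj (h (fst z) * (p (fst z) ^ i * cnj (p (fst z)) ^ j)) * (h (snd z) * (p (snd z) ^ i * cnj (p (snd z)) ^ j)))"
      by (rule integrable_prod[OF c hp])
    have "(\<integral>z. cnj (h (fst z) * (p (fst z) ^ i * cnj (p (fst z)) ^ j)) * (h (snd z) * (p (snd z) ^ i * cnj (p (snd z)) ^ j)) \<partial>(M \<Otimes>\<^sub>M M))
        = (\<integral>x. cnj (h x * (p x ^ i * cnj (p x) ^ j)) \<partial>M) * m i j"
      unfolding m_def by (rule integral_prod[OF c hp])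
    also have "\<dots> = cnj (m i j) * m i j" unfolding m_def by (simp only: Bochner_Integration.integral_cnj)
    also have "\<dots> = of_real ((cmod (m i j))\<^sup>2)" by (metis complex_norm_square mult.commute)
    finally show "(\<integral>z. cnj (h (fst z) * (p (fst z) ^ i * cnj (p (fst z)) ^ j)) * (h (snd z) * (p (snd z) ^ i * cnj (p (snd z)) ^ j)) \<partial>(M \<Otimes>\<^sub>M M))
        = of_real ((cmod (m i j))\<^sup>2)" .
  qed
  have f_int: "integrable (M \<Otimes>\<^sub>M M) (f n)" for n
    unfolding f_expand[abs_def] by (intro Bochner_Integration.integrable_sum integrable_mult_right term_int)
  have f_val: "(\<integral>z. f n z \<partial>(M \<Otimes>\<^sub>M M))
      = of_real (s ^ n / fact n * (\<Sum>k\<le>n. real (n choose k) * (cmod (m (n - k) k))\<^sup>2))" for n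
    unfolding f_expand
    by (subst Bochner_Integration.integral_sum)
       (auto intro!: integrable_mult_right term_int simp del: complex_cnj_mult complex_cnj_power
         simp: term_val sum_distrib_left mult.assoc)
  have f_sums: "(\<lambda>n. f n z) sums (H z * exp (of_real s * (X z + cnj (X z))))" for z
  proof -
    have "(\<lambda>n. (of_real s * (X z + cnj (X z))) ^ n /\<^sub>R fact n) sums exp (of_real s * (X z + cnj (X z)))"
      by (rule exp_converges)
    then show ?thesis
      unfolding f_def by (intro sums_mult) (simp add: scaleR_conv_of_real divide_inverse mult.commute)
  qed
  \<comment> \<open>Since \<open>p\<close> is bounded, all terms are dominated by an exponential
    series times |H|, which permits termwise integration.\<close>
  have RX: "cmod (of_real s * (X z + cnj (X z))) \<le> 2 * s * R\<^sup>2" if "z \<in> space (M \<Otimes>\<^sub>M M)" for z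
  proof -
    have "cmod (X z) \<le> R * R"
      unfolding X_def norm_mult complex_mod_cnj using that R
      by (intro mult_mono R) (auto simp: space_pair_measure intro: order_trans[OF norm_ge_zero])
    then have "cmod (X z + cnj (X z)) \<le> 2 * R\<^sup>2"
      using norm_triangle_ineq[of "X z" "cnj (X z)"] by (simp add: power2_eq_square)
    then show ?thesis using s by (simp add: norm_mult mult_left_mono)
  qed
  have f_norm: "norm (f n z) \<le> norm (H z) * ((2 * s * R\<^sup>2) ^ n / fact n)" if "z \<in> space (M \<Otimes>\<^sub>M M)" for n z
    unfolding f_def norm_mult norm_divide norm_power norm_fact
    by (intro mult_left_mono divide_right_mono power_mono) (use RX[OF that] in \<open>auto simp: norm_mult\<close>)
  have sm: "summable (\<lambda>n. c * ((2 * s * R\<^sup>2) ^ n / fact n))" for c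
    using summable_exp[of "2 * s * R\<^sup>2"] by (intro summable_mult) (simp add: divide_inverse mult.commute)
  have "(\<lambda>n. \<integral>z. f n z \<partial>(M \<Otimes>\<^sub>M M)) sums (\<integral>z. (\<Sum>n. f n z) \<partial>(M \<Otimes>\<^sub>M M))"
  proof (rule sums_integral)
    show "AE z in M \<Otimes>\<^sub>M M. summable (\<lambda>n. norm (f n z))"
    proof (rule AE_I2)
      fix z assume "z \<in> space (M \<Otimes>\<^sub>M M)"
      then show "summable (\<lambda>n. norm (f n z))"
        by (intro summable_comparison_test'[OF sm[of "norm (H z)"]]) (use f_norm in auto)
    qed
    show "summable (\<lambda>n. \<integral>z. norm (f n z) \<partial>(M \<Otimes>\<^sub>M M))"
    proof (rule summable_comparison_test'[OF sm[of "\<integral>z. norm (H z) \<partial>(M \<Otimes>\<^sub>M M)"]])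
      fix n :: nat
      have "(\<integral>z. norm (f n z) \<partial>(M \<Otimes>\<^sub>M M)) \<le> (\<integral>z. norm (H z) * ((2 * s * R\<^sup>2) ^ n / fact n) \<partial>(M \<Otimes>\<^sub>M M))"
        by (rule integral_mono) (use f_int Hint f_norm in auto)
      then show "norm (\<integral>z. norm (f n z) \<partial>(M \<Otimes>\<^sub>M M)) \<le> (\<integral>z. norm (H z) \<partial>(M \<Otimes>\<^sub>M M)) * ((2 * s * R\<^sup>2) ^ n / fact n)"
        by simp
    qed
  qed (rule f_int)
  also have "(\<integral>z. (\<Sum>n. f n z) \<partial>(M \<Otimes>\<^sub>M M)) = (\<integral>z. H z * exp (of_real s * (X z + cnj (X z))) \<partial>(M \<Otimes>\<^sub>M M))"
    by (rule Bochner_Integration.integral_cong) (simp_all add: sums_unique[OF f_sums, symmetric])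
  also have "\<dots> = (\<integral>z. cnj (\<phi> (fst z)) * \<phi> (snd z) * exp (- s * (cmod (p (fst z) - p (snd z)))\<^sup>2) \<partial>(M \<Otimes>\<^sub>M M))"
  proof (rule Bochner_Integration.integral_cong)
    fix z
    let ?x = "p (fst z)" and ?y = "p (snd z)"
    have eq: "complex_of_real ((cmod (?x - ?y))\<^sup>2) = of_real ((cmod ?x)\<^sup>2) + of_real ((cmod ?y)\<^sup>2) - (X z + cnj (X z))"
      unfolding complex_norm_square X_def by (simp add: algebra_simps)
    have "exp (- of_real s * complex_of_real ((cmod (?x - ?y))\<^sup>2))
        = exp (- of_real s * of_real ((cmod ?x)\<^sup>2) + - of_real s * of_real ((cmod ?y)\<^sup>2) + of_real s * (X z + cnj (X z)))"
      unfolding eq by (simp add: algebra_simps)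
    also have "\<dots> = exp (- of_real s * of_real ((cmod ?x)\<^sup>2)) * exp (- of_real s * of_real ((cmod ?y)\<^sup>2))
        * exp (of_real s * (X z + cnj (X z)))"
      by (simp only: exp_add)
    finally have "exp (- of_real s * complex_of_real ((cmod (?x - ?y))\<^sup>2))
      = exp (- of_real s * of_real ((cmod ?x)\<^sup>2)) * exp (- of_real s * of_real ((cmod ?y)\<^sup>2))
        * exp (of_real s * (X z + cnj (X z)))" .
    then show "H z * exp (of_real s * (X z + cnj (X z)))
      = cnj (\<phi> (fst z)) * \<phi> (snd z) * complex_of_real (exp (- s * (cmod (?x - ?y))\<^sup>2))"
      by (simp add: H_def h_def exp_of_real[symmetric] exp_cnj mult_ac)
  qed simp
  finally have fs: "(\<lambda>n. of_real (s ^ n / fact n * (\<Sum>k\<le>n. real (n choose k) * (cmod (m (n - k) k))\<^sup>2))) sums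
      (\<integral>z. cnj (\<phi> (fst z)) * \<phi> (snd z) * exp (- s * (cmod (p (fst z) - p (snd z)))\<^sup>2) \<partial>(M \<Otimes>\<^sub>M M))"
    unfolding f_val .
  show "(\<lambda>n. s ^ n / fact n * (\<Sum>k\<le>n. real (n choose k) *
            (cmod (\<integral>x. h x * (p x ^ (n - k) * cnj (p x) ^ k) \<partial>M))\<^sup>2)) sums
          Re (\<integral>z. cnj (\<phi> (fst z)) * \<phi> (snd z) * exp (- s * (cmod (p (fst z) - p (snd z)))\<^sup>2) \<partial>(M \<Otimes>\<^sub>M M))"
    using sums_Re[OF fs] unfolding Re_complex_of_real m_def .
qed

text \<open>The conclusion says that the image of the charge under \<open>p\<close> is zero. An
  abstract measure space with a map \<open>p\<close> into the plane, rather than a measure on the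
  plane, allows one charge to live on two curves at once.\<close>

lemma (in sigma_finite_measure) log_energy_zero_imp_orthogonal:
  fixes \<phi> p :: "'a \<Rightarrow> complex" and G :: "complex \<Rightarrow> real"
  assumes \<phi>: "integrable M \<phi>" and p[measurable]: "p \<in> borel_measurable M"
    and R: "\<And>x. x \<in> space M \<Longrightarrow> norm (p x) \<le> R"
    and ne: "\<And>x. x \<in> space M \<Longrightarrow> AE y in M. p x \<noteq> p y"
    and int: "\<And>x. x \<in> space M \<Longrightarrow> integrable M (\<lambda>y. \<phi> y * ln (cmod (p x - p y)))"
    and bd: "\<And>x. x \<in> space M \<Longrightarrow> (\<integral>y. norm (\<phi> y * ln (cmod (p x - p y))) \<partial>M) \<le> B"
    and neutral: "(\<integral>x. \<phi> x \<partial>M) = 0"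
    and energy: "(\<integral>x. cnj (\<phi> x) * (\<integral>y. \<phi> y * ln (cmod (p x - p y)) \<partial>M) \<partial>M) = 0"
    and G: "continuous_on UNIV G"
  shows "(\<integral>x. \<phi> x * of_real (G (p x)) \<partial>M) = 0"
proof -
  interpret MM: pair_sigma_finite M M ..
  interpret PL: pair_sigma_finite "M \<Otimes>\<^sub>M M" "lborel :: real measure" ..
  have [measurable]: "\<phi> \<in> borel_measurable M" using \<phi> by auto
  define W where "W z = cnj (\<phi> (fst z)) * \<phi> (snd z)" for z
  define a where "a z = (cmod (p (fst z) - p (snd z)))\<^sup>2" for z
  have [measurable]: "W \<in> borel_measurable (M \<Otimes>\<^sub>M M)" unfolding W_def by measurable
  have [measurable]: "a \<in> borel_measurable (M \<Otimes>\<^sub>M M)" unfolding a_def by measurable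
  have c\<phi>: "integrable M (\<lambda>x. cnj (\<phi> x))" using \<phi> by simp
  have Wint: "integrable (M \<Otimes>\<^sub>M M) W" unfolding W_def by (rule integrable_prod[OF c\<phi> \<phi>])
  have W0: "(\<integral>z. W z \<partial>(M \<Otimes>\<^sub>M M)) = 0" unfolding W_def using integral_prod[OF c\<phi> \<phi>] neutral by simp
  have ln_a: "ln (a z) = 2 * ln (cmod (p (fst z) - p (snd z)))" for z
    by (cases "p (fst z) = p (snd z)") (simp_all add: a_def ln_realpow)
  have apos: "AE z in M \<Otimes>\<^sub>M M. a z > 0"
  proof -
    have "AE x in M. AE y in M. a (x, y) > 0"
    proof (rule AE_I2)
      fix x assume "x \<in> space M"
      from ne[OF this] show "AE y in M. a (x, y) > 0"
        by eventually_elim (simp add: a_def)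
    qed
    moreover have "{z \<in> space (M \<Otimes>\<^sub>M M). a z > 0} \<in> sets (M \<Otimes>\<^sub>M M)" by measurable
    ultimately show ?thesis by (rule MM.AE_pair_measure[rotated])
  qed
  have WL: "integrable (M \<Otimes>\<^sub>M M) (\<lambda>z. W z * ln (a z))"
  proof (rule MM.Fubini_integrable)
    have eq: "W (x, y) * ln (a (x, y)) = 2 * cnj (\<phi> x) * (\<phi> y * ln (cmod (p x - p y)))" for x y
      unfolding ln_a by (simp add: W_def)
    show "AE x in M. integrable M (\<lambda>y. W (x, y) * ln (a (x, y)))"
      unfolding eq using int by (intro AE_I2 integrable_mult_right) auto
    show "integrable M (\<lambda>x. \<integral>y. norm (W (x, y) * ln (a (x, y))) \<partial>M)"
    proof (rule Bochner_Integration.integrable_bound[where f = "\<lambda>x. 2 * norm (\<phi> x) * B"])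
      show "AE x in M. norm (\<integral>y. norm (W (x, y) * ln (a (x, y))) \<partial>M) \<le> norm (2 * norm (\<phi> x) * B)"
      proof (rule AE_I2)
        fix x assume x: "x \<in> space M"
        have "(\<integral>y. norm (W (x, y) * ln (a (x, y))) \<partial>M)
            = 2 * norm (\<phi> x) * (\<integral>y. norm (\<phi> y * ln (cmod (p x - p y))) \<partial>M)"
          unfolding eq norm_mult[of "2 * cnj (\<phi> x)"] by (simp add: norm_mult)
        also have "\<dots> \<le> 2 * norm (\<phi> x) * B" using bd[OF x] by (intro mult_left_mono) auto
        finally have "(\<integral>y. norm (W (x, y) * ln (a (x, y))) \<partial>M) \<le> 2 * norm (\<phi> x) * B" .
        moreover have "(\<integral>y. norm (W (x, y) * ln (a (x, y))) \<partial>M) \<ge> 0" by simp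
        ultimately show "norm (\<integral>y. norm (W (x, y) * ln (a (x, y))) \<partial>M) \<le> norm (2 * norm (\<phi> x) * B)"
          by (simp only: real_norm_def)
      qed
    qed (use \<phi> in \<open>auto\<close>)
  qed measurable
  define k where "k s b = indicator {0<..} s * ((exp (- s * b) - exp (- s)) / s)" for s b :: real
  have [measurable]: "(\<lambda>z. k (snd z) (a (fst z))) \<in> borel_measurable ((M \<Otimes>\<^sub>M M) \<Otimes>\<^sub>M lborel)"
    unfolding k_def by measurable
  \<comment> \<open>By \<open>frullani_norm\<close> the L^1 norm in s is |ln a|, which is integrable
    against |W| by \<open>WL\<close>; hence the integral over s may be exchanged with the double
    integral.\<close>
  have full: "integrable ((M \<Otimes>\<^sub>M M) \<Otimes>\<^sub>M lborel) (\<lambda>(z, s). W z * of_real (k s (a z)))"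
  proof (rule PL.Fubini_integrable)
    show "(\<lambda>(z, s). W z * of_real (k s (a z))) \<in> borel_measurable ((M \<Otimes>\<^sub>M M) \<Otimes>\<^sub>M lborel)"
      unfolding split_beta by measurable
    show "AE z in M \<Otimes>\<^sub>M M. integrable lborel (\<lambda>s. case (z, s) of (z, s) \<Rightarrow> W z * of_real (k s (a z)))"
      using apos
    proof eventually_elim
      case (elim z)
      then have "integrable lborel (\<lambda>s. k s (a z))" unfolding k_def by (rule frullani_integrable)
      then show ?case by simp
    qed
    have "integrable (M \<Otimes>\<^sub>M M) (\<lambda>z. norm (W z * ln (a z)))" using WL by simp
    moreover have "AE z in M \<Otimes>\<^sub>M M. (\<integral>s. norm (case (z, s) of (z, s) \<Rightarrow> W z * of_real (k s (a z))) \<partial>lborel) = norm (W z * ln (a z))"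
      using apos
    proof eventually_elim
      case (elim z)
      have "(\<integral>s. \<bar>k s (a z)\<bar> \<partial>lborel) = \<bar>ln (a z)\<bar>"
        using frullani_norm[OF elim] unfolding k_def real_norm_def .
      then show ?case by (simp add: norm_mult)
    qed
    moreover have "(\<lambda>z. \<integral>s. norm (case (z, s) of (z, s) \<Rightarrow> W z * of_real (k s (a z))) \<partial>lborel) \<in> borel_measurable (M \<Otimes>\<^sub>M M)"
      unfolding split_beta by measurable
    ultimately show "integrable (M \<Otimes>\<^sub>M M) (\<lambda>z. \<integral>s. norm (case (z, s) of (z, s) \<Rightarrow> W z * of_real (k s (a z))) \<partial>lborel)"
      by (subst integrable_cong_AE[where g = "\<lambda>z. norm (W z * ln (a z))"]) auto
  qed
  define \<Gamma> where "\<Gamma> s = (\<integral>z. W z * of_real (exp (- s * a z)) \<partial>(M \<Otimes>\<^sub>M M))" for s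
  have Gint: "integrable (M \<Otimes>\<^sub>M M) (\<lambda>z. W z * of_real (exp (- s * a z)))" if "s > 0" for s
    by (rule Bochner_Integration.integrable_bound[OF Wint])
       (use that in \<open>auto simp: norm_mult a_def intro!: mult_left_le\<close>)
  \<comment> \<open>Neutrality enters here: the exp(-s) part is multiplied by the integral of W, the
    squared modulus of the total charge.\<close>
  have inner: "(\<integral>z. W z * of_real (k s (a z)) \<partial>(M \<Otimes>\<^sub>M M)) = of_real (indicator {0<..} s / s) * \<Gamma> s" for s
  proof (cases "s > 0")
    case True
    have "(\<integral>z. W z * of_real (k s (a z)) \<partial>(M \<Otimes>\<^sub>M M))
        = (\<integral>z. of_real (1 / s) * (W z * of_real (exp (- s * a z))) - of_real (exp (- s) / s) * W z \<partial>(M \<Otimes>\<^sub>M M))"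
      using True by (intro Bochner_Integration.integral_cong) (auto simp: k_def field_simps)
    also have "\<dots> = of_real (1 / s) * \<Gamma> s - of_real (exp (- s) / s) * (\<integral>z. W z \<partial>(M \<Otimes>\<^sub>M M))"
      unfolding \<Gamma>_def
      by (subst Bochner_Integration.integral_diff)
         (use Gint[OF True] Wint in \<open>auto simp del: of_real_divide of_real_exp\<close>)
    finally show ?thesis using W0 True by simp
  qed (simp add: k_def)
  have "(\<integral>s. of_real (indicator {0<..} s / s) * \<Gamma> s \<partial>lborel)
      = (\<integral>s. (\<integral>z. W z * of_real (k s (a z)) \<partial>(M \<Otimes>\<^sub>M M)) \<partial>lborel)"
    by (simp only: inner)
  also have "\<dots> = (\<integral>z. (\<integral>s. W z * of_real (k s (a z)) \<partial>lborel) \<partial>(M \<Otimes>\<^sub>M M))"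
    by (rule PL.Fubini_integral[OF full])
  also have "\<dots> = (\<integral>z. - (W z * ln (a z)) \<partial>(M \<Otimes>\<^sub>M M))"
  proof (rule integral_cong_AE)
    show "AE z in M \<Otimes>\<^sub>M M. (\<integral>s. W z * of_real (k s (a z)) \<partial>lborel) = - (W z * ln (a z))"
      using apos
    proof eventually_elim
      case (elim z)
      have "(\<integral>s. k s (a z) \<partial>lborel) = - ln (a z)"
        using frullani[OF elim] unfolding k_def .
      then show ?case by simp
    qed
    show "(\<lambda>z. \<integral>s. W z * of_real (k s (a z)) \<partial>lborel) \<in> borel_measurable (M \<Otimes>\<^sub>M M)"
      by measurable
  qed measurable
  also have "\<dots> = - (\<integral>x. (\<integral>y. W (x, y) * ln (a (x, y)) \<partial>M) \<partial>M)"
    using MM.integral_fst'[OF WL] by simp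
  also have "(\<integral>x. (\<integral>y. W (x, y) * ln (a (x, y)) \<partial>M) \<partial>M)
      = 2 * (\<integral>x. cnj (\<phi> x) * (\<integral>y. \<phi> y * ln (cmod (p x - p y)) \<partial>M) \<partial>M)"
    unfolding ln_a by (simp add: W_def mult.assoc mult.left_commute[of _ 2])
  finally have I0: "(\<integral>s. of_real (indicator {0<..} s / s) * \<Gamma> s \<partial>lborel) = 0" using energy by simp
  have Iint: "integrable lborel (\<lambda>s. of_real (indicator {0<..} s / s) * \<Gamma> s)"
    using PL.integrable_snd[OF full] unfolding inner .
  have sums: "(\<lambda>n. s ^ n / fact n * (\<Sum>k\<le>n. real (n choose k) *
            (cmod (\<integral>x. \<phi> x * of_real (exp (- s * (cmod (p x))\<^sup>2)) * (p x ^ (n - k) * cnj (p x) ^ k) \<partial>M))\<^sup>2)) sums Re (\<Gamma> s)"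
    if "s > 0" for s
    using gaussian_energy_sums(2)[OF \<phi> p R that] unfolding \<Gamma>_def W_def a_def by (simp add: mult.assoc)
  have Gpos: "Re (\<Gamma> s) \<ge> 0" if "s > 0" for s
    by (rule sums_le[OF _ sums_zero sums[OF that]]) (intro mult_nonneg_nonneg sum_nonneg; use that in simp)
  have "(\<integral>s. indicator {0<..} s / s * Re (\<Gamma> s) \<partial>lborel) = Re (\<integral>s. of_real (indicator {0<..} s / s) * \<Gamma> s \<partial>lborel)"
    using integral_Re[OF Iint] by simp
  then have "(\<integral>s. indicator {0<..} s / s * Re (\<Gamma> s) \<partial>lborel) = 0" using I0 by simp
  moreover have "integrable lborel (\<lambda>s. indicator {0<..} s / s * Re (\<Gamma> s))"
    using integrable_Re[OF Iint] by simp
  ultimately have "AE s in lborel. indicator {0<..} s / s * Re (\<Gamma> s) = 0"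
    by (subst (asm) integral_nonneg_eq_0_iff_AE) (auto simp: indicator_def Gpos)
  \<comment> \<open>A single positive s with zero energy suffices, and the exceptional null set
    cannot contain the whole unit interval.\<close>
  then have "AE s in lborel. s \<notin> {0<..<1} \<or> Re (\<Gamma> s) = 0"
    by eventually_elim (auto simp: indicator_def)
  moreover have "\<not> (AE s in lborel. s \<notin> {0<..<1 :: real})"
  proof
    assume "AE s in lborel. s \<notin> {0<..<1 :: real}"
    then have "emeasure lborel {0<..<1 :: real} = 0"
      by (subst (asm) AE_iff_measurable[of "{0<..<1}"]) auto
    then show False by simp
  qed
  ultimately obtain s where s: "s > 0" "Re (\<Gamma> s) = 0"
    by (metis (mono_tags, lifting) eventually_mono greaterThanLessThan_iff)
  define h where "h x = \<phi> x * of_real (exp (- s * (cmod (p x))\<^sup>2))" for x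
  have mom: "(\<integral>x. h x * (p x ^ i * cnj (p x) ^ j) \<partial>M) = 0" for i j
  proof -
    define t where "t n = s ^ n / fact n * (\<Sum>k\<le>n. real (n choose k) *
            (cmod (\<integral>x. h x * (p x ^ (n - k) * cnj (p x) ^ k) \<partial>M))\<^sup>2)" for n
    have t: "t sums 0" using sums[OF s(1)] s(2) unfolding t_def[abs_def] h_def by simp
    have "t n \<ge> 0" for n unfolding t_def using s(1)
      by (intro mult_nonneg_nonneg sum_nonneg) auto
    then have "t (i + j) = 0"
      using t suminf_eq_zero_iff[of t] by (simp add: sums_iff)
    then have "(\<Sum>k\<le>i+j. real ((i + j) choose k) *
            (cmod (\<integral>x. h x * (p x ^ (i + j - k) * cnj (p x) ^ k) \<partial>M))\<^sup>2) = 0"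
      using s by (simp add: t_def)
    then have "\<forall>k\<in>{..i+j}. real ((i + j) choose k) *
            (cmod (\<integral>x. h x * (p x ^ (i + j - k) * cnj (p x) ^ k) \<partial>M))\<^sup>2 = 0"
      by (subst (asm) sum_nonneg_eq_0_iff) auto
    then have "real ((i + j) choose j) * (cmod (\<integral>x. h x * (p x ^ (i + j - j) * cnj (p x) ^ j) \<partial>M))\<^sup>2 = 0"
      by (rule bspec) simp
    then show ?thesis by simp
  qed
  \<comment> \<open>The Gaussian weight inside h is undone by testing with G(z) exp(s|z|^2), which
    is again continuous.\<close>
  have "(\<integral>x. h x * of_real (G (p x) * exp (s * (cmod (p x))\<^sup>2)) \<partial>M) = 0"
    by (rule moments_zero_imp_orthogonal_continuous[OF _ p R mom, where G = "\<lambda>z. G z * exp (s * (cmod z)\<^sup>2)"])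
       (use gaussian_energy_sums(1)[OF \<phi> p R s(1)] in \<open>auto simp: h_def[abs_def] intro!: continuous_intros G\<close>)
  moreover have "h x * of_real (G (p x) * exp (s * (cmod (p x))\<^sup>2)) = \<phi> x * of_real (G (p x))" for x
  proof -
    have "exp (- s * (cmod (p x))\<^sup>2) * exp (s * (cmod (p x))\<^sup>2) = 1" by (simp add: mult_exp_exp)
    then have "complex_of_real (exp (- s * (cmod (p x))\<^sup>2)) * of_real (exp (s * (cmod (p x))\<^sup>2)) = 1"
      by (metis of_real_1 of_real_mult)
    then show ?thesis unfolding h_def by (simp add: mult_ac del: of_real_exp)
  qed
  ultimately show ?thesis by (simp only:)
qed

section \<open>Logarithmic potentials of regular loops\<close>

text \<open>Within distance 1 of b each side contributes at most 2, the integral of u^(-1/2) over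
  [0, 1]; elsewhere the integrand is at most 1 on an interval of length 2 pi. The bound is uniform
  in b.\<close>

lemma nn_integral_inverse_sqrt:
  "(\<integral>\<^sup>+s. ennreal (1 / sqrt \<bar>s - b\<bar>) \<partial>per_measure) \<le> ennreal (4 + 2 * pi)"
proof -
  define f where "f u = ennreal (1 / sqrt u) * indicator {0..1} u" for u :: real
  have [measurable]: "f \<in> borel_measurable borel" unfolding f_def by measurable
  have "((\<lambda>u. 1 / sqrt u) has_integral 2) {0..1::real}"
  proof (rule has_integral_eq[rotated])
    show "((\<lambda>u. u powr (-1/2)) has_integral 2) {0..1::real}"
      using has_integral_powr_from_0[of "-1/2" 1] by simp
    show "u powr (-1/2) = 1 / sqrt u" if "u \<in> {0..1}" for u :: real
      using that by (cases "u = 0") (auto simp: powr_minus_divide powr_half_sqrt[symmetric])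
  qed
  then have f2: "(\<integral>\<^sup>+u. f u \<partial>lborel) = 2"
    unfolding f_def using nn_integral_has_integral_lebesgue'[of "{0..1}" "\<lambda>u. 1 / sqrt u" 2] by simp
  have le: "ennreal (1 / sqrt \<bar>u\<bar>) \<le> 1 + (f u + f (- u))" for u :: real
  proof (cases "\<bar>u\<bar> \<le> 1")
    case True
    then have "ennreal (1 / sqrt \<bar>u\<bar>) \<le> f u + f (- u)"
      by (cases "u \<ge> 0") (auto simp: f_def intro: add_increasing add_increasing2)
    then show ?thesis by (simp add: add_increasing)
  next
    case False
    then have "1 / sqrt \<bar>u\<bar> \<le> 1" by simp
    then have "ennreal (1 / sqrt \<bar>u\<bar>) \<le> 1" using ennreal_leI by fastforce
    then show ?thesis by (simp add: add_increasing2)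
  qed
  have "(\<integral>\<^sup>+s. ennreal (1 / sqrt \<bar>s - b\<bar>) \<partial>per_measure)
      = (\<integral>\<^sup>+s. ennreal (1 / sqrt \<bar>s - b\<bar>) * indicator {0<..<2*pi} s \<partial>lborel)"
    by (subst nn_integral_restrict_space) auto
  also have "\<dots> \<le> (\<integral>\<^sup>+s. indicator {0<..<2*pi} s + (f (s - b) + f (b - s)) \<partial>lborel)"
  proof (rule nn_integral_mono)
    show "ennreal (1 / sqrt \<bar>s - b\<bar>) * indicator {0<..<2*pi} s
        \<le> indicator {0<..<2*pi} s + (f (s - b) + f (b - s))" for s
      using le[of "s - b"] by (auto simp: indicator_def)
  qed
  also have "\<dots> = ennreal (2 * pi) + ((\<integral>\<^sup>+s. f (s - b) \<partial>lborel) + (\<integral>\<^sup>+s. f (b - s) \<partial>lborel))"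
    by (subst nn_integral_add; simp?)+
  also have "(\<integral>\<^sup>+s. f (s - b) \<partial>lborel) = 2"
    using nn_integral_real_affine[of f 1 "- b"] f2 by simp
  also have "(\<integral>\<^sup>+s. f (b - s) \<partial>lborel) = 2"
    using nn_integral_real_affine[of f "-1" b] f2 by simp
  also have "ennreal (2 * pi) + (2 + 2) = ennreal (4 + 2 * pi)"
    by (simp add: ennreal_plus[symmetric] add.commute del: ennreal_plus flip: ennreal_numeral)
  finally show ?thesis .
qed

text \<open>For a < 1 put q = a^(-1/4): then -ln a = 4 ln q \<le> 4 q, and squaring costs only an
  inverse square root. For a \<ge> 1 one has ln a \<le> a.\<close>

lemma ln_square_le:
  fixes a :: real assumes "a \<ge> 0" shows "(ln a)\<^sup>2 \<le> 16 / sqrt a + a\<^sup>2"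
proof -
  consider "a = 0" | "0 < a" "a < 1" | "a \<ge> 1" using assms by linarith
  then show ?thesis
  proof cases
    case 2
    define q where "q = 1 / sqrt (sqrt a)"
    have q: "q > 0" "q\<^sup>2 = 1 / sqrt a" using 2 by (simp_all add: q_def power_divide)
    have "ln q = - ln a / 4" using 2 by (simp add: q_def ln_div ln_sqrt)
    then have "- ln a \<le> 4 * q" using ln_le_minus_one[OF q(1)] by linarith
    moreover have "0 \<le> - ln a" using 2 by simp
    ultimately have "(- ln a)\<^sup>2 \<le> (4 * q)\<^sup>2" by (intro power_mono)
    also have "\<dots> = 16 / sqrt a" by (simp add: power_mult_distrib q(2))
    finally show ?thesis by (simp add: add_increasing2)
  next
    case 3
    have "ln a \<le> a" using 3 ln_le_minus_one[of a] by linarith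
    then have "(ln a)\<^sup>2 \<le> a\<^sup>2" using 3 by (intro power_mono) auto
    then show ?thesis using 3 by (simp add: add_increasing)
  qed simp
qed

lemma periodic_shift:
  fixes f :: "real \<Rightarrow> 'a"
  assumes f: "\<And>s. f (s + 2 * pi) = f s"
  shows "f (s + 2 * pi * of_int k) = f s"
proof -
  have n: "f (s + 2 * pi * real n) = f s" for s n
  proof (induction n)
    case (Suc n)
    then show ?case using f[of "s + 2 * pi * real n"] by (simp add: algebra_simps)
  qed simp
  show ?thesis
  proof (cases "k \<ge> 0")
    case True then show ?thesis using n[of s "nat k"] by simp
  next
    case False then show ?thesis using n[of "s + 2 * pi * of_int k" "nat (- k)"] by simp
  qed
qed

lemma shift_into_period: "\<exists>k::int. s + 2 * pi * of_int k \<in> {0..<2 * pi}"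
  by (rule exI[of _ "- \<lfloor>s / (2*pi)\<rfloor>"])
     (use floor_divide_lower[of "2 * pi" s] floor_divide_upper[of "2 * pi" s] in \<open>auto simp: algebra_simps\<close>)

text \<open>Quantitative regularity of a simple closed curve: a chord-arc bound from below and a
  second-order Taylor estimate. Both are confined to parameter distances up to half a period, since
  beyond it the curve returns to its starting point. The constants are parameters because the final
  Fourier estimate is expressed through M / m.\<close>

locale regular_loop =
  fixes \<gamma> \<gamma>' :: "real \<Rightarrow> complex" and m M :: real
  assumes periodic: "\<gamma> (s + 2 * pi) = \<gamma> s"
    and deriv: "(\<gamma> has_vector_derivative \<gamma>' s) (at s)"
    and cont': "continuous_on UNIV \<gamma>'"
    and m_pos: "m > 0"
    and lower: "\<bar>t - s\<bar> \<le> pi \<Longrightarrow> m * \<bar>t - s\<bar> \<le> cmod (\<gamma> t - \<gamma> s)"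
    and taylor: "\<bar>t - s\<bar> \<le> pi \<Longrightarrow> cmod (\<gamma> t - \<gamma> s - (t - s) *\<^sub>R \<gamma>' t) \<le> M * (t - s)\<^sup>2"
begin

lemma cont: "continuous_on UNIV \<gamma>"
  using deriv by (meson continuous_at_imp_continuous_on has_vector_derivative_continuous)

lemma measurable_borel [measurable]: "\<gamma> \<in> borel_measurable borel"
  by (rule borel_measurable_continuous_onI[OF cont])

lemma measurable_per [measurable]: "\<gamma> \<in> borel_measurable per_measure"
  by (rule per_measurable_continuous[OF cont])

lemma periodic': "\<gamma> (s - 2 * pi) = \<gamma> s"
  using periodic[of "s - 2 * pi"] by simp

text \<open>Moves s by at most one period so that it comes within half a period of t, where the
  estimates of the locale apply.\<close>

lemma shift_cases:
  assumes "0 \<le> s" "s \<le> 2 * pi" "0 \<le> t" "t \<le> 2 * pi"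
  obtains c where "c \<in> {0, 2 * pi, - 2 * pi}" "\<bar>s - t + c\<bar> \<le> pi" "\<And>s. \<gamma> (s + c) = \<gamma> s"
proof -
  consider "\<bar>s - t\<bar> \<le> pi" | "s - t > pi" | "s - t < - pi" by linarith
  then show ?thesis
  proof cases
    case 1 then show ?thesis by (intro that[of 0]) auto
  next
    case 2 then show ?thesis by (intro that[of "- 2 * pi"]) (use assms periodic' in auto)
  next
    case 3 then show ?thesis by (intro that[of "2 * pi"]) (use assms periodic in auto)
  qed
qed

lemma inj: "inj_on \<gamma> {0..<2 * pi}"
proof (rule inj_onI)
  fix s t assume st: "s \<in> {0..<2 * pi}" "t \<in> {0..<2 * pi}" and eq: "\<gamma> s = \<gamma> t"
  obtain c where c: "c \<in> {0, 2 * pi, - 2 * pi}" "\<bar>s - t + c\<bar> \<le> pi" "\<And>s. \<gamma> (s + c) = \<gamma> s"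
    using st by (elim shift_cases[of s t, rotated 4]) auto
  have "\<bar>s + c - t\<bar> \<le> pi" using c(2) by (simp add: algebra_simps)
  from lower[OF this] have "m * \<bar>s + c - t\<bar> \<le> 0" unfolding c(3) eq by simp
  then have "s + c = t" using m_pos by (simp add: mult_le_0_iff)
  then show "s = t" using c(1) st by auto
qed

lemma AE_neq: "AE s in per_measure. x \<noteq> \<gamma> s"
proof -
  have "{s \<in> {0<..<2 * pi}. \<gamma> s = x} \<subseteq> {the_inv_into {0..<2 * pi} \<gamma> x}"
    using the_inv_into_f_f[OF inj] by auto
  then have "finite {s \<in> {0<..<2 * pi}. \<gamma> s = x}" using finite_subset by blast
  then have "AE s in lborel. s \<notin> {s \<in> {0<..<2 * pi}. \<gamma> s = x}"
    by (intro AE_not_in) (simp add: finite_imp_null_set_lborel)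
  then show ?thesis
    by (subst AE_restrict_space_iff) (auto elim!: eventually_mono)
qed

lemma bounded: obtains R where "\<And>s. cmod (\<gamma> s) \<le> R" "R \<ge> 0"
proof -
  have "compact (\<gamma> ` {0..2*pi})" by (intro compact_continuous_image continuous_on_subset[OF cont]) auto
  then obtain R where R: "\<And>s. s \<in> {0..2*pi} \<Longrightarrow> cmod (\<gamma> s) \<le> R"
    by (meson bounded_iff compact_imp_bounded imageI)
  have "cmod (\<gamma> s) \<le> R" for s
  proof -
    obtain k :: int where "s + 2 * pi * of_int k \<in> {0..<2 * pi}" using shift_into_period by blast
    then have "s + 2 * pi * of_int k \<in> {0..2 * pi}" by simp
    from R[OF this] show ?thesis by (simp only: periodic_shift[where f = \<gamma>, OF periodic])
  qed
  then show ?thesis using that[of R] norm_ge_zero order_trans by blast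
qed

text \<open>The bound is uniform over all x in the plane, on the curve or off it. If s0 parametrizes
  a point of the curve nearest to x, then |\<gamma>(s) - \<gamma>(s0)| \<le> 2 |x - \<gamma>(s)|,
  and the chord-arc bound at s0 takes over.\<close>

lemma weakly_singular:
  obtains B where "B \<ge> 0" "\<And>x. (\<integral>\<^sup>+s. ennreal (1 / sqrt (cmod (x - \<gamma> s))) \<partial>per_measure) \<le> ennreal B"
proof -
  define B where "B = sqrt (2 / m) * (3 * (4 + 2 * pi))"
  have "(\<integral>\<^sup>+s. ennreal (1 / sqrt (cmod (x - \<gamma> s))) \<partial>per_measure) \<le> ennreal B" for x
  proof -
    have "continuous_on {0..2*pi} (\<lambda>s. cmod (x - \<gamma> s))"
      by (intro continuous_intros continuous_on_subset[OF cont]) auto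
    then obtain s0 where s0: "s0 \<in> {0..2*pi}" "\<And>s. s \<in> {0..2*pi} \<Longrightarrow> cmod (x - \<gamma> s0) \<le> cmod (x - \<gamma> s)"
      using continuous_attains_inf[of "{0..2*pi}" "\<lambda>s. cmod (x - \<gamma> s)"] by auto
    \<comment> \<open>The three terms are the singularity at s0 and its copies one period to each
      side; the shift c selects one of them.\<close>
    define g where "g s = 1 / sqrt \<bar>s - s0\<bar> + 1 / sqrt \<bar>s - (s0 - 2*pi)\<bar> + 1 / sqrt \<bar>s - (s0 + 2*pi)\<bar>" for s
    have pointwise: "1 / sqrt (cmod (x - \<gamma> s)) \<le> sqrt (2 / m) * g s"
      if s: "0 < s" "s < 2 * pi" "s \<noteq> s0" "s \<noteq> s0 - 2 * pi" "s \<noteq> s0 + 2 * pi" for s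
    proof -
      obtain c where c: "c \<in> {0, 2 * pi, - 2 * pi}" "\<bar>s - s0 + c\<bar> \<le> pi" "\<And>s. \<gamma> (s + c) = \<gamma> s"
        using s s0 by (elim shift_cases[of s s0, rotated 4]) auto
      define d where "d = \<bar>s - s0 + c\<bar>"
      have d: "d > 0" using c(1) s by (auto simp: d_def)
      have "m * d \<le> cmod (\<gamma> (s + c) - \<gamma> s0)"
        using lower[of "s + c" s0] c(2) by (simp add: d_def algebra_simps)
      also have "\<dots> = cmod ((x - \<gamma> s0) - (x - \<gamma> s))" using c(3) by simp
      also have "\<dots> \<le> cmod (x - \<gamma> s0) + cmod (x - \<gamma> s)" by (rule norm_triangle_ineq4)
      also have "\<dots> \<le> 2 * cmod (x - \<gamma> s)" using s0(2)[of s] s by simp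
      finally have le: "m / 2 * d \<le> cmod (x - \<gamma> s)" by simp
      have pos: "m / 2 * d > 0" using m_pos d by simp
      have "cmod (x - \<gamma> s) > 0" using le pos by linarith
      then have "1 / sqrt (cmod (x - \<gamma> s)) \<le> 1 / sqrt (m / 2 * d)"
        using le pos by (intro divide_left_mono mult_pos_pos) auto
      also have "\<dots> = sqrt (2 / m) * (1 / sqrt d)" by (simp add: real_sqrt_mult real_sqrt_divide)
      also have "\<dots> \<le> sqrt (2 / m) * g s"
      proof (rule mult_left_mono)
        have "1 / sqrt d \<in> {1 / sqrt \<bar>s - s0\<bar>, 1 / sqrt \<bar>s - (s0 - 2*pi)\<bar>, 1 / sqrt \<bar>s - (s0 + 2*pi)\<bar>}"
          using c(1) by (auto simp: d_def algebra_simps)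
        then show "1 / sqrt d \<le> g s" by (auto simp: g_def add_increasing add_increasing2)
      qed (use m_pos in auto)
      finally show ?thesis .
    qed
    have ae: "AE s in per_measure. s \<noteq> b" for b :: real
      using AE_lborel_singleton[of b] by (subst AE_restrict_space_iff) (auto elim!: eventually_mono)
    have "(\<integral>\<^sup>+s. ennreal (1 / sqrt (cmod (x - \<gamma> s))) \<partial>per_measure)
        \<le> (\<integral>\<^sup>+s. ennreal (sqrt (2 / m)) * ennreal (g s) \<partial>per_measure)"
    proof (rule nn_integral_mono_AE)
      show "AE s in per_measure. ennreal (1 / sqrt (cmod (x - \<gamma> s))) \<le> ennreal (sqrt (2 / m)) * ennreal (g s)"
        using ae[of s0] ae[of "s0 - 2 * pi"] ae[of "s0 + 2 * pi"] AE_space[of per_measure]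
      proof eventually_elim
        case (elim s)
        then have "ennreal (1 / sqrt (cmod (x - \<gamma> s))) \<le> ennreal (sqrt (2 / m) * g s)"
          by (intro ennreal_leI pointwise) auto
        then show ?case using m_pos by (simp add: ennreal_mult g_def)
      qed
    qed
    also have "\<dots> = ennreal (sqrt (2 / m)) * (\<integral>\<^sup>+s. ennreal (g s) \<partial>per_measure)"
      unfolding g_def by (intro nn_integral_cmult per_measurable_borel) measurable
    also have "(\<integral>\<^sup>+s. ennreal (g s) \<partial>per_measure) = (\<integral>\<^sup>+s. ennreal (1 / sqrt \<bar>s - s0\<bar>) \<partial>per_measure)
        + (\<integral>\<^sup>+s. ennreal (1 / sqrt \<bar>s - (s0 - 2*pi)\<bar>) \<partial>per_measure)
        + (\<integral>\<^sup>+s. ennreal (1 / sqrt \<bar>s - (s0 + 2*pi)\<bar>) \<partial>per_measure)"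
      unfolding g_def
      by (subst nn_integral_add[symmetric]; (intro per_measurable_borel)?; measurable?)+
    also have "\<dots> \<le> ennreal (4 + 2 * pi) + ennreal (4 + 2 * pi) + ennreal (4 + 2 * pi)"
      by (intro add_mono nn_integral_inverse_sqrt)
    also have "\<dots> = ennreal (3 * (4 + 2 * pi))"
      by (simp add: ennreal_plus[symmetric] del: ennreal_plus)
    finally show ?thesis using m_pos
      by (simp add: B_def ennreal_mult mult_left_mono)
  qed
  moreover have "B \<ge> 0" using m_pos by (simp add: B_def)
  ultimately show ?thesis using that by blast
qed

text \<open>The logarithmic potential of the density f on the curve, evaluated anywhere in the
  plane. On the curve itself, Symm's operator is -1/pi times it
  (\<open>symm_op_pot\<close>).\<close>

definition pot :: "(real \<Rightarrow> complex) \<Rightarrow> complex \<Rightarrow> complex" where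
  "pot f x = (\<integral>s. f s * of_real (ln (cmod (x - \<gamma> s))) \<partial>per_measure)"

lemma ln_sq:
  obtains C where "\<And>x. cmod x \<le> X \<Longrightarrow> integrable per_measure (\<lambda>s. (ln (cmod (x - \<gamma> s)))\<^sup>2)"
    "\<And>x. cmod x \<le> X \<Longrightarrow> (\<integral>s. (ln (cmod (x - \<gamma> s)))\<^sup>2 \<partial>per_measure) \<le> C" "C \<ge> 0"
proof -
  obtain B where B: "B \<ge> 0" "\<And>x. (\<integral>\<^sup>+s. ennreal (1 / sqrt (cmod (x - \<gamma> s))) \<partial>per_measure) \<le> ennreal B"
    using weakly_singular by blast
  obtain R where R: "\<And>s. cmod (\<gamma> s) \<le> R" "R \<ge> 0" using bounded by blast
  define C where "C = 16 * B + (\<bar>X\<bar> + R)\<^sup>2 * (2 * pi)"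
  have C: "(\<integral>\<^sup>+s. ennreal ((ln (cmod (x - \<gamma> s)))\<^sup>2) \<partial>per_measure) \<le> ennreal C" if x: "cmod x \<le> X" for x
  proof -
    have "(ln (cmod (x - \<gamma> s)))\<^sup>2 \<le> 16 * (1 / sqrt (cmod (x - \<gamma> s))) + (\<bar>X\<bar> + R)\<^sup>2" for s
    proof -
      have "cmod (x - \<gamma> s) \<le> \<bar>X\<bar> + R"
        using norm_triangle_ineq4[of x "\<gamma> s"] R(1)[of s] x by linarith
      then have "(cmod (x - \<gamma> s))\<^sup>2 \<le> (\<bar>X\<bar> + R)\<^sup>2" by (intro power_mono) auto
      then show ?thesis using ln_square_le[of "cmod (x - \<gamma> s)"] by simp
    qed
    then have "(\<integral>\<^sup>+s. ennreal ((ln (cmod (x - \<gamma> s)))\<^sup>2) \<partial>per_measure)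
        \<le> (\<integral>\<^sup>+s. 16 * ennreal (1 / sqrt (cmod (x - \<gamma> s))) + ennreal ((\<bar>X\<bar> + R)\<^sup>2) \<partial>per_measure)"
      by (intro nn_integral_mono)
         (simp add: ennreal_plus[symmetric] ennreal_mult[symmetric] ennreal_leI del: ennreal_plus flip: ennreal_numeral)
    also have "\<dots> = 16 * (\<integral>\<^sup>+s. ennreal (1 / sqrt (cmod (x - \<gamma> s))) \<partial>per_measure)
        + ennreal ((\<bar>X\<bar> + R)\<^sup>2) * ennreal (2 * pi)"
      by (subst nn_integral_add; simp add: nn_integral_cmult emeasure_restrict_space)
    also have "\<dots> \<le> 16 * ennreal B + ennreal ((\<bar>X\<bar> + R)\<^sup>2) * ennreal (2 * pi)"
      by (intro add_mono mult_left_mono B) auto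
    also have "\<dots> = ennreal C"
      using B(1) by (simp add: C_def ennreal_plus ennreal_mult)
    finally show ?thesis .
  qed
  have int: "integrable per_measure (\<lambda>s. (ln (cmod (x - \<gamma> s)))\<^sup>2)" if "cmod x \<le> X" for x
    by (rule integrableI_bounded) (use C[OF that] in \<open>auto simp: le_less_trans\<close>)
  have C0: "C \<ge> 0" using B(1) by (simp add: C_def)
  have "(\<integral>s. (ln (cmod (x - \<gamma> s)))\<^sup>2 \<partial>per_measure) \<le> C" if "cmod x \<le> X" for x
  proof -
    have "ennreal (\<integral>s. (ln (cmod (x - \<gamma> s)))\<^sup>2 \<partial>per_measure) \<le> ennreal C"
      using C[OF that] int[OF that] by (subst nn_integral_eq_integral[symmetric]) auto
    then show ?thesis using C0 by (simp add: ennreal_le_iff)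
  qed
  then show ?thesis using that int C0 by blast
qed

lemma pot_integrable:
  assumes f: "sq_integrable f"
  shows "integrable per_measure (\<lambda>s. f s * of_real (ln (cmod (x - \<gamma> s))))"
proof -
  obtain C where C: "\<And>y. cmod y \<le> cmod x \<Longrightarrow> integrable per_measure (\<lambda>s. (ln (cmod (y - \<gamma> s)))\<^sup>2)"
    using ln_sq[of "cmod x"] by blast
  have "sq_integrable (\<lambda>s. of_real (ln (cmod (x - \<gamma> s))))"
    unfolding sq_integrable_def using C[of x] by simp
  from integrable_mult_cnj[OF f this] show ?thesis by simp
qed

text \<open>Young's inequality splits the product, so that the same C serves all densities f and all
  x in the disc of radius X.\<close>

lemma pot_bound:
  "\<exists>C\<ge>0. \<forall>f x. sq_integrable f \<longrightarrow> cmod x \<le> X \<longrightarrow>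
    (\<integral>s. norm (f s * of_real (ln (cmod (x - \<gamma> s)))) \<partial>per_measure) \<le> (\<integral>s. (cmod (f s))\<^sup>2 \<partial>per_measure) + C"
proof -
  obtain C where C: "\<And>x. cmod x \<le> X \<Longrightarrow> integrable per_measure (\<lambda>s. (ln (cmod (x - \<gamma> s)))\<^sup>2)"
    "\<And>x. cmod x \<le> X \<Longrightarrow> (\<integral>s. (ln (cmod (x - \<gamma> s)))\<^sup>2 \<partial>per_measure) \<le> C" "C \<ge> 0"
    using ln_sq[of X] by blast
  have "(\<integral>s. norm (f s * of_real (ln (cmod (x - \<gamma> s)))) \<partial>per_measure) \<le> (\<integral>s. (cmod (f s))\<^sup>2 \<partial>per_measure) + C"
    if f: "sq_integrable f" and x: "cmod x \<le> X" for f x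
  proof -
    have fi: "integrable per_measure (\<lambda>s. (cmod (f s))\<^sup>2)" using f by (simp add: sq_integrable_def)
    have "(\<integral>s. norm (f s * of_real (ln (cmod (x - \<gamma> s)))) \<partial>per_measure)
        \<le> (\<integral>s. (cmod (f s))\<^sup>2 + (ln (cmod (x - \<gamma> s)))\<^sup>2 \<partial>per_measure)"
    proof (rule integral_mono)
      show "norm (f s * of_real (ln (cmod (x - \<gamma> s)))) \<le> (cmod (f s))\<^sup>2 + (ln (cmod (x - \<gamma> s)))\<^sup>2" for s
      proof -
        have "0 \<le> (cmod (f s) - \<bar>ln (cmod (x - \<gamma> s))\<bar>)\<^sup>2" by simp
        then have "2 * (cmod (f s) * \<bar>ln (cmod (x - \<gamma> s))\<bar>) \<le> (cmod (f s))\<^sup>2 + (ln (cmod (x - \<gamma> s)))\<^sup>2"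
          by (simp add: power2_diff)
        moreover have "0 \<le> cmod (f s) * \<bar>ln (cmod (x - \<gamma> s))\<bar>" by simp
        ultimately show ?thesis unfolding norm_mult norm_of_real by linarith
      qed
    qed (use pot_integrable[OF f] fi C(1)[OF x] in auto)
    also have "\<dots> = (\<integral>s. (cmod (f s))\<^sup>2 \<partial>per_measure) + (\<integral>s. (ln (cmod (x - \<gamma> s)))\<^sup>2 \<partial>per_measure)"
      by (rule Bochner_Integration.integral_add[OF fi C(1)[OF x]])
    also have "\<dots> \<le> (\<integral>s. (cmod (f s))\<^sup>2 \<partial>per_measure) + C" using C(2)[OF x] by simp
    finally show ?thesis .
  qed
  then show ?thesis using C(3) by blast
qed

text \<open>The potential is the uniform limit of potentials whose logarithm is cut off below at ln
  (e n); these are Lipschitz. Uniformity over the whole plane rests on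
  \<open>weakly_singular\<close>.\<close>

lemma continuous_pot:
  assumes f: "sq_integrable f" shows "continuous_on UNIV (pot f)"
proof -
  have [measurable]: "f \<in> borel_measurable per_measure" using f by (rule sq_integrable_measurable)
  have f1: "integrable per_measure (\<lambda>s. cmod (f s))" using sq_integrable_imp_integrable[OF f] by simp
  have f2: "integrable per_measure (\<lambda>s. (cmod (f s))\<^sup>2)" using f by (simp add: sq_integrable_def)
  obtain B where B: "B \<ge> 0" "\<And>x. (\<integral>\<^sup>+s. ennreal (1 / sqrt (cmod (x - \<gamma> s))) \<partial>per_measure) \<le> ennreal B"
    using weakly_singular by blast
  have Bint: "integrable per_measure (\<lambda>s. 1 / sqrt (cmod (x - \<gamma> s)))" for x
    by (rule integrableI_bounded) (use B(2)[of x] in \<open>auto simp: le_less_trans\<close>)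
  have Bval: "(\<integral>s. 1 / sqrt (cmod (x - \<gamma> s)) \<partial>per_measure) \<le> B" for x
  proof -
    have "ennreal (\<integral>s. 1 / sqrt (cmod (x - \<gamma> s)) \<partial>per_measure) \<le> ennreal B"
      using B(2)[of x] Bint[of x] by (subst nn_integral_eq_integral[symmetric]) auto
    then show ?thesis using B(1) by (simp add: ennreal_le_iff)
  qed
  define e where "e n = 1 / (real n + 1)" for n
  have e: "e n > 0" for n by (simp add: e_def)
  define u where "u n x = (\<integral>s. f s * of_real (ln (max (cmod (x - \<gamma> s)) (e n))) \<partial>per_measure)" for n x
  have lip: "\<bar>ln (max a c) - ln (max b c)\<bar> \<le> \<bar>a - b\<bar> / c" if "c > 0" for a b c :: real
  proof -
    have *: "ln (max a c) - ln (max b c) \<le> \<bar>a - b\<bar> / c" for a b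
    proof -
      have "max a c > 0" "max b c > 0" using that by auto
      then have "ln (max a c) - ln (max b c) = ln (max a c / max b c)"
        by (simp add: ln_div)
      also have "\<dots> \<le> max a c / max b c - 1" using that by (intro ln_le_minus_one) auto
      also have "\<dots> = (max a c - max b c) / max b c" using that by (simp add: diff_divide_distrib)
      also have "\<dots> \<le> \<bar>a - b\<bar> / max b c" using that by (intro divide_right_mono) auto
      also have "\<dots> \<le> \<bar>a - b\<bar> / c" using that by (intro divide_left_mono) auto
      finally show ?thesis .
    qed
    show ?thesis
      by (rule abs_leI) (use *[of a b] *[of b a] abs_minus_commute[of a b] in simp_all)
  qed
  have ln_split: "ln (max a c) = ln a + max 0 (ln c - ln a)" if "c > 0" "a > 0" for a c :: real
    using that by (auto simp: max_def)
  have uint: "integrable per_measure (\<lambda>s. f s * of_real (ln (max (cmod (x - \<gamma> s)) (e n))))" for n x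
  proof (rule Bochner_Integration.integrable_bound)
    show "integrable per_measure (\<lambda>s. norm (f s * of_real (ln (cmod (x - \<gamma> s)))) + \<bar>ln (e n)\<bar> * cmod (f s))"
      using pot_integrable[OF f, of x] f1 by (intro Bochner_Integration.integrable_add) auto
    show "AE s in per_measure. norm (f s * of_real (ln (max (cmod (x - \<gamma> s)) (e n))))
        \<le> norm (norm (f s * of_real (ln (cmod (x - \<gamma> s)))) + \<bar>ln (e n)\<bar> * cmod (f s))"
    proof (rule AE_I2)
      fix s
      have "\<bar>ln (max (cmod (x - \<gamma> s)) (e n))\<bar> \<le> \<bar>ln (cmod (x - \<gamma> s))\<bar> + \<bar>ln (e n)\<bar>"
        by (auto simp: max_def)
      then have "cmod (f s) * \<bar>ln (max (cmod (x - \<gamma> s)) (e n))\<bar>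
          \<le> cmod (f s) * (\<bar>ln (cmod (x - \<gamma> s))\<bar> + \<bar>ln (e n)\<bar>)" by (intro mult_left_mono) auto
      then show "norm (f s * of_real (ln (max (cmod (x - \<gamma> s)) (e n))))
          \<le> norm (norm (f s * of_real (ln (cmod (x - \<gamma> s)))) + \<bar>ln (e n)\<bar> * cmod (f s))"
        by (simp add: norm_mult algebra_simps)
    qed
  qed measurable
  have ucont: "continuous_on UNIV (u n)" for n
  proof (rule lipschitz_on_continuous_on[where L = "(\<integral>s. cmod (f s) \<partial>per_measure) / e n"], rule lipschitz_onI)
    fix x y :: complex
    have "dist (u n x) (u n y) = norm (\<integral>s. f s * of_real (ln (max (cmod (x - \<gamma> s)) (e n)))
        - f s * of_real (ln (max (cmod (y - \<gamma> s)) (e n))) \<partial>per_measure)"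
      unfolding u_def dist_norm by (subst Bochner_Integration.integral_diff) (auto intro: uint)
    also have "\<dots> \<le> (\<integral>s. cmod (f s) * (dist x y / e n) \<partial>per_measure)"
    proof (rule norm_integral_le_integral)
      fix s
      have "norm (f s * of_real (ln (max (cmod (x - \<gamma> s)) (e n))) - f s * of_real (ln (max (cmod (y - \<gamma> s)) (e n))))
        = cmod (f s) * \<bar>ln (max (cmod (x - \<gamma> s)) (e n)) - ln (max (cmod (y - \<gamma> s)) (e n))\<bar>"
        by (metis norm_mult norm_of_real of_real_diff right_diff_distrib)
      also have "\<dots> \<le> cmod (f s) * (\<bar>cmod (x - \<gamma> s) - cmod (y - \<gamma> s)\<bar> / e n)"
        by (intro mult_left_mono lip e) auto
      also have "\<dots> \<le> cmod (f s) * (dist x y / e n)"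
        using norm_triangle_ineq3[of "x - \<gamma> s" "y - \<gamma> s"] e[of n]
        by (intro mult_left_mono divide_right_mono) (auto simp: dist_norm)
      finally show "norm (f s * of_real (ln (max (cmod (x - \<gamma> s)) (e n))) - f s * of_real (ln (max (cmod (y - \<gamma> s)) (e n))))
        \<le> cmod (f s) * (dist x y / e n)" .
    qed (use uint f1 in auto)
    finally show "dist (u n x) (u n y) \<le> (\<integral>s. cmod (f s) \<partial>per_measure) / e n * dist x y"
      by (simp add: mult.commute)
  qed (use e[of n] in \<open>auto intro!: divide_nonneg_pos\<close>)
  define D where "D = 4 * ((\<integral>s. (cmod (f s))\<^sup>2 \<partial>per_measure) + B)"
  have dist_u: "dist (u n x) (pot f x) \<le> D * sqrt (sqrt (e n))" for n x
  proof -
    have "dist (u n x) (pot f x) = norm (\<integral>s. f s * of_real (ln (max (cmod (x - \<gamma> s)) (e n)))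
        - f s * of_real (ln (cmod (x - \<gamma> s))) \<partial>per_measure)"
      unfolding u_def pot_def dist_norm
      by (subst Bochner_Integration.integral_diff) (auto intro: uint pot_integrable f)
    also have "\<dots> \<le> (\<integral>s. norm (f s * of_real (ln (max (cmod (x - \<gamma> s)) (e n)))
        - f s * of_real (ln (cmod (x - \<gamma> s)))) \<partial>per_measure)"
      by (rule integral_norm_bound)
    also have "\<dots> \<le> (\<integral>s. 4 * sqrt (sqrt (e n)) * ((cmod (f s))\<^sup>2 + 1 / sqrt (cmod (x - \<gamma> s))) \<partial>per_measure)"
    proof (rule integral_mono_AE)
      show "AE s in per_measure. norm (f s * of_real (ln (max (cmod (x - \<gamma> s)) (e n))) - f s * of_real (ln (cmod (x - \<gamma> s))))
          \<le> 4 * sqrt (sqrt (e n)) * ((cmod (f s))\<^sup>2 + 1 / sqrt (cmod (x - \<gamma> s)))"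
        using AE_neq[of x]
      proof eventually_elim
        case (elim s)
        define a where "a = cmod (x - \<gamma> s)"
        have a: "a > 0" using elim by (simp add: a_def)
        \<comment> \<open>The fourth root bounds the truncation error by 4 q, that is 4 (e n)^(1/4)
          a^(-1/4). Young's inequality then leaves a^(-1/2), whose integral is bounded, times a
          factor tending to 0.\<close>
        define q where "q = sqrt (sqrt (e n / a))"
        have q: "q > 0" using a e[of n] by (simp add: q_def)
        have "ln (e n) - ln a = 4 * ln q"
          using a e[of n] by (simp add: q_def ln_sqrt ln_div)
        also have "\<dots> \<le> 4 * q" using ln_le_minus_one[OF q] by simp
        finally have mx: "max 0 (ln (e n) - ln a) \<le> 4 * q" using q by simp
        have "norm (f s * of_real (ln (max a (e n))) - f s * of_real (ln a))
          = cmod (f s) * \<bar>ln (max a (e n)) - ln a\<bar>"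
          by (metis norm_mult norm_of_real of_real_diff right_diff_distrib)
        also have "\<dots> = cmod (f s) * max 0 (ln (e n) - ln a)"
          using ln_split[OF e[of n] a] by simp
        also have "\<dots> \<le> cmod (f s) * (4 * q)" by (intro mult_left_mono mx) auto
        also have "q = sqrt (sqrt (e n)) * (1 / sqrt (sqrt a))"
          by (simp add: q_def real_sqrt_divide)
        also have "cmod (f s) * (4 * (sqrt (sqrt (e n)) * (1 / sqrt (sqrt a))))
          = 4 * sqrt (sqrt (e n)) * (cmod (f s) * (1 / sqrt (sqrt a)))" by simp
        also have "\<dots> \<le> 4 * sqrt (sqrt (e n)) * ((cmod (f s))\<^sup>2 + 1 / sqrt a)"
        proof (rule mult_left_mono)
          have "0 \<le> (cmod (f s) - 1 / sqrt (sqrt a))\<^sup>2" by simp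
          then have "2 * (cmod (f s) * (1 / sqrt (sqrt a))) \<le> (cmod (f s))\<^sup>2 + 1 / sqrt a"
            using a by (simp add: power2_diff power_divide)
          moreover have "0 \<le> cmod (f s) * (1 / sqrt (sqrt a))" using a by simp
          ultimately show "cmod (f s) * (1 / sqrt (sqrt a)) \<le> (cmod (f s))\<^sup>2 + 1 / sqrt a" by linarith
        qed (use e[of n] in auto)
        finally show ?case by (simp add: a_def)
      qed
    qed (use uint pot_integrable[OF f] f2 Bint in \<open>auto intro!: Bochner_Integration.integrable_diff\<close>)
    also have "\<dots> = 4 * sqrt (sqrt (e n)) * ((\<integral>s. (cmod (f s))\<^sup>2 \<partial>per_measure) + (\<integral>s. 1 / sqrt (cmod (x - \<gamma> s)) \<partial>per_measure))"
      by (simp only: Bochner_Integration.integral_add[OF f2 Bint] integral_mult_right_zero)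
    also have "\<dots> \<le> 4 * sqrt (sqrt (e n)) * ((\<integral>s. (cmod (f s))\<^sup>2 \<partial>per_measure) + B)"
      using Bval[of x] e[of n] by (intro mult_left_mono) auto
    finally show ?thesis by (simp add: D_def mult_ac)
  qed
  have "uniform_limit UNIV u (pot f) sequentially"
  proof (rule uniform_limitI)
    fix d :: real assume d: "d > 0"
    have "(\<lambda>n. D * sqrt (sqrt (e n))) \<longlonglongrightarrow> D * sqrt (sqrt 0)"
    proof (intro tendsto_intros)
      show "e \<longlonglongrightarrow> 0" unfolding e_def[abs_def]
        using LIMSEQ_inverse_real_of_nat by (simp add: divide_inverse add.commute)
    qed
    then have "eventually (\<lambda>n. D * sqrt (sqrt (e n)) < d) sequentially"
      using d by (intro order_tendstoD(2)) auto
    then show "\<forall>\<^sub>F n in sequentially. \<forall>x\<in>UNIV. dist (u n x) (pot f x) < d"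
      by eventually_elim (use dist_u le_less_trans in blast)
  qed
  then show ?thesis
    by (rule uniform_limit_theorem[rotated]) (use ucont in auto)
qed

end

section \<open>Parametrized curves and the circle\<close>

lemma norm_diff_le_of_vector_derivative:
  fixes f :: "real \<Rightarrow> 'a :: real_normed_vector"
  assumes "\<And>u. u \<in> closed_segment s t \<Longrightarrow> (f has_vector_derivative f' u) (at u)"
    and "\<And>u. u \<in> closed_segment s t \<Longrightarrow> norm (f' u) \<le> B"
  shows "norm (f t - f s) \<le> B * \<bar>t - s\<bar>"
proof -
  have "norm (f t - f s) \<le> B * norm (t - s)"
  proof (rule differentiable_bound[of "closed_segment s t" f "\<lambda>u x. x *\<^sub>R f' u"])
    show "(f has_derivative (\<lambda>x. x *\<^sub>R f' u)) (at u within closed_segment s t)"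
      if "u \<in> closed_segment s t" for u
      using assms(1)[OF that] has_derivative_at_withinI by (auto simp: has_vector_derivative_def)
    show "onorm (\<lambda>x. x *\<^sub>R f' u) \<le> B" if "u \<in> closed_segment s t" for u
      by (rule onorm_le) (use assms(2)[OF that] in \<open>auto simp: mult.commute[of B] intro: mult_left_mono\<close>)
  qed auto
  then show ?thesis by simp
qed

text \<open>For nearby parameters the tangent dominates the Taylor remainder, which gives the
  chord-arc bound; for the remaining pairs simplicity of the curve and compactness keep the distance
  away from 0.\<close>

lemma regular_loop_exists:
  assumes per: "\<And>s. \<gamma> (s + 2 * pi) = \<gamma> s" and C: "C_class 3 \<gamma>" and inj: "inj_on \<gamma> {0..<2 * pi}"
    and nz: "\<And>s. vector_derivative \<gamma> (at s) \<noteq> 0"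
  obtains \<gamma>' m M where "regular_loop \<gamma> \<gamma>' m M"
proof -
  obtain \<gamma>' \<gamma>'' \<gamma>3 where d1: "\<And>s. (\<gamma> has_vector_derivative \<gamma>' s) (at s)"
    and d2: "\<And>s. (\<gamma>' has_vector_derivative \<gamma>'' s) (at s)"
    and d3: "\<And>s. (\<gamma>'' has_vector_derivative \<gamma>3 s) (at s)"
    using C by (auto simp: numeral_3_eq_3)
  have c1: "continuous_on UNIV \<gamma>" and c2: "continuous_on UNIV \<gamma>'" and c3: "continuous_on UNIV \<gamma>''"
    using d1 d2 d3 by (meson continuous_at_imp_continuous_on has_vector_derivative_continuous)+
  have nz': "\<gamma>' s \<noteq> 0" for s using nz[of s] vector_derivative_at[OF d1[of s]] by simp
  have per': "\<gamma>' (s + 2 * pi) = \<gamma>' s" for s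
  proof -
    have "((\<lambda>s. s + 2 * pi) has_vector_derivative 1) (at s)"
      by (auto intro!: derivative_eq_intros simp: has_real_derivative_iff_has_vector_derivative[symmetric])
    from vector_diff_chain_at[OF this d1] have "(\<gamma> has_vector_derivative \<gamma>' (s + 2 * pi)) (at s)"
      by (simp add: o_def per)
    then show ?thesis using d1 vector_derivative_unique_at by blast
  qed
  have eq_imp: "t = s" if eq: "\<gamma> s = \<gamma> t" and le: "\<bar>t - s\<bar> \<le> pi" for s t
  proof -
    obtain k l where kl: "s + 2 * pi * of_int k \<in> {0..<2*pi}" "t + 2 * pi * of_int l \<in> {0..<2*pi}"
      using shift_into_period by blast
    have "s + 2 * pi * of_int k = t + 2 * pi * of_int l"
      by (rule inj_onD[OF inj _ kl]) (simp only: periodic_shift[where f = \<gamma>, OF per] eq)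
    then have ts: "t - s = 2 * pi * of_int (k - l)" by (simp add: algebra_simps)
    have "k - l = 0"
    proof (rule ccontr)
      assume "k - l \<noteq> 0"
      then have "1 \<le> \<bar>real_of_int (k - l)\<bar>" by linarith
      then have "2 * pi * 1 \<le> 2 * pi * \<bar>real_of_int (k - l)\<bar>" by (intro mult_left_mono) auto
      also have "\<dots> = \<bar>t - s\<bar>" unfolding ts by (simp add: abs_mult)
      finally show False using le pi_gt_zero by linarith
    qed
    then show ?thesis using ts by simp
  qed
  \<comment> \<open>Large enough to contain every pair at distance at most pi whose first member
    lies in the base period, together with the segment between them.\<close>
  define I where "I = {- 2 * pi..4 * pi}"
  have I: "compact I" "I \<noteq> {}" by (auto simp: I_def)
  have "compact (\<gamma>'' ` I)" by (intro compact_continuous_image continuous_on_subset[OF c3] I) auto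
  then obtain K0 where "\<And>u. u \<in> I \<Longrightarrow> cmod (\<gamma>'' u) \<le> K0"
    by (meson bounded_iff compact_imp_bounded imageI)
  then have K: "\<And>u. u \<in> I \<Longrightarrow> cmod (\<gamma>'' u) \<le> max K0 1" by (simp add: le_max_iff_disj)
  define K where "K = max K0 1"
  have K1: "K \<ge> 1" by (simp add: K_def)
  have tayI: "cmod (\<gamma> t - \<gamma> s - (t - s) *\<^sub>R \<gamma>' t) \<le> K * (t - s)\<^sup>2" if st: "s \<in> I" "t \<in> I" for s t
  proof -
    have seg: "closed_segment s t \<subseteq> I" using st by (auto simp: I_def closed_segment_eq_real_ivl)
    have "cmod ((\<gamma> t - t *\<^sub>R \<gamma>' t) - (\<gamma> s - s *\<^sub>R \<gamma>' t)) \<le> (K * \<bar>t - s\<bar>) * \<bar>t - s\<bar>"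
    proof (rule norm_diff_le_of_vector_derivative)
      fix u assume u: "u \<in> closed_segment s t"
      show "((\<lambda>u. \<gamma> u - u *\<^sub>R \<gamma>' t) has_vector_derivative \<gamma>' u - \<gamma>' t) (at u)"
        by (auto intro!: derivative_eq_intros d1)
      have "closed_segment u t \<subseteq> closed_segment s t" using u by (simp add: subset_closed_segment)
      then have "cmod (\<gamma>' t - \<gamma>' u) \<le> K * \<bar>t - u\<bar>"
        using seg K by (intro norm_diff_le_of_vector_derivative[of u t \<gamma>' \<gamma>'']) (auto simp: K_def d2)
      also have "\<dots> \<le> K * \<bar>t - s\<bar>"
        using u K1 by (intro mult_left_mono) (auto simp: closed_segment_eq_real_ivl split: if_splits)
      finally show "cmod (\<gamma>' u - \<gamma>' t) \<le> K * \<bar>t - s\<bar>" by (simp add: norm_minus_commute)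
    qed
    also have "(\<gamma> t - t *\<^sub>R \<gamma>' t) - (\<gamma> s - s *\<^sub>R \<gamma>' t) = \<gamma> t - \<gamma> s - (t - s) *\<^sub>R \<gamma>' t"
      by (simp add: algebra_simps)
    finally show ?thesis by (simp add: power2_eq_square mult.assoc)
  qed
  have "continuous_on I (\<lambda>u. cmod (\<gamma>' u))" by (intro continuous_intros continuous_on_subset[OF c2]) auto
  then obtain u0 where u0: "\<And>u. u \<in> I \<Longrightarrow> cmod (\<gamma>' u0) \<le> cmod (\<gamma>' u)"
    using continuous_attains_inf[OF I] by blast
  define \<mu> where "\<mu> = cmod (\<gamma>' u0)"
  have \<mu>: "\<mu> > 0" using nz' by (simp add: \<mu>_def)
  \<comment> \<open>Below \<delta> the remainder K |t - s|^2 is at most half of the linear term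
    \<mu> |t - s|.\<close>
  define \<delta> where "\<delta> = min pi (\<mu> / (2 * K))"
  have \<delta>: "\<delta> > 0" "\<delta> \<le> pi" using \<mu> K1 by (auto simp: \<delta>_def)
  define S where "S = {z \<in> {0..2*pi} \<times> I. \<delta> \<le> \<bar>snd z - fst z\<bar> \<and> \<bar>snd z - fst z\<bar> \<le> pi}"
  have "S = ({0..2*pi} \<times> I) \<inter> {z. \<delta> \<le> \<bar>snd z - fst z\<bar>} \<inter> {z. \<bar>snd z - fst z\<bar> \<le> pi}"
    by (auto simp: S_def)
  then have "compact S"
    using I by (auto intro!: compact_Int_closed compact_Times closed_Collect_le continuous_intros)
  moreover have "(0, \<delta>) \<in> S" using \<delta> by (auto simp: S_def I_def)
  moreover have "continuous_on S (\<lambda>z. cmod (\<gamma> (snd z) - \<gamma> (fst z)))"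
    by (intro continuous_intros continuous_on_compose2[OF c1]) auto
  ultimately obtain z0 where z0: "z0 \<in> S" "\<And>z. z \<in> S \<Longrightarrow> cmod (\<gamma> (snd z0) - \<gamma> (fst z0)) \<le> cmod (\<gamma> (snd z) - \<gamma> (fst z))"
    using continuous_attains_inf[of S "\<lambda>z. cmod (\<gamma> (snd z) - \<gamma> (fst z))"] by blast
  define \<nu> where "\<nu> = cmod (\<gamma> (snd z0) - \<gamma> (fst z0))"
  have \<nu>: "\<nu> > 0"
    using z0(1) eq_imp[of "fst z0" "snd z0"] \<delta> by (auto simp: \<nu>_def S_def)
  define m where "m = min (\<mu> / 2) (\<nu> / pi)"
  have m: "m > 0" using \<mu> \<nu> by (simp add: m_def)
  have lowI: "m * \<bar>t - s\<bar> \<le> cmod (\<gamma> t - \<gamma> s)" if st: "s \<in> {0..2*pi}" "\<bar>t - s\<bar> \<le> pi" for s t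
  proof -
    have tI: "t \<in> I" "s \<in> I" using st by (auto simp: I_def)
    show ?thesis
    proof (cases "\<bar>t - s\<bar> < \<delta>")
      case True
      have "\<bar>t - s\<bar> * \<mu> \<le> cmod ((t - s) *\<^sub>R \<gamma>' t)"
        using u0[OF tI(1)] by (simp add: \<mu>_def mult_left_mono)
      also have "\<dots> \<le> cmod (\<gamma> t - \<gamma> s) + cmod (\<gamma> t - \<gamma> s - (t - s) *\<^sub>R \<gamma>' t)"
        using norm_triangle_sub[of "(t - s) *\<^sub>R \<gamma>' t" "\<gamma> t - \<gamma> s"] by (simp add: norm_minus_commute)
      also have "\<dots> \<le> cmod (\<gamma> t - \<gamma> s) + K * \<bar>t - s\<bar> * \<bar>t - s\<bar>"
        using tayI[OF tI(2,1)] by (simp add: power2_eq_square mult.assoc)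
      also have "K * \<bar>t - s\<bar> * \<bar>t - s\<bar> \<le> \<mu> / 2 * \<bar>t - s\<bar>"
      proof (rule mult_right_mono)
        have "\<bar>t - s\<bar> \<le> \<mu> / (2 * K)" using True by (simp add: \<delta>_def)
        then show "K * \<bar>t - s\<bar> \<le> \<mu> / 2" using K1 by (simp add: field_simps)
      qed simp
      finally have "\<mu> / 2 * \<bar>t - s\<bar> \<le> cmod (\<gamma> t - \<gamma> s)" by (simp add: algebra_simps)
      moreover have "m \<le> \<mu> / 2" unfolding m_def by (rule min.cobounded1)
      then have "m * \<bar>t - s\<bar> \<le> \<mu> / 2 * \<bar>t - s\<bar>" by (rule mult_right_mono) simp
      ultimately show ?thesis by linarith
    next
      case False
      have "m * \<bar>t - s\<bar> \<le> \<nu> / pi * pi" using st \<nu> m by (intro mult_mono) (auto simp: m_def min.coboundedI2)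
      also have "\<dots> = \<nu>" by simp
      also have "\<dots> \<le> cmod (\<gamma> t - \<gamma> s)"
        using z0(2)[of "(s, t)"] False st tI by (auto simp: S_def \<nu>_def)
      finally show ?thesis .
    qed
  qed
  have "regular_loop \<gamma> \<gamma>' m K"
  proof
    fix s t :: real assume le: "\<bar>t - s\<bar> \<le> pi"
    obtain k where k: "s + 2 * pi * of_int k \<in> {0..<2*pi}" using shift_into_period by blast
    define s' t' where "s' = s + 2 * pi * of_int k" and "t' = t + 2 * pi * of_int k"
    have st': "s' \<in> {0..2*pi}" "s' \<in> I" "t' \<in> I" "t' - s' = t - s"
      using k le by (auto simp: s'_def t'_def I_def)
    have eqs: "\<gamma> s' = \<gamma> s" "\<gamma> t' = \<gamma> t" "\<gamma>' t' = \<gamma>' t"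
      unfolding s'_def t'_def by (rule periodic_shift[where f = \<gamma>, OF per] periodic_shift[where f = \<gamma>', OF per'])+
    show "m * \<bar>t - s\<bar> \<le> cmod (\<gamma> t - \<gamma> s)" using lowI[of s' t'] st' le eqs by simp
    show "cmod (\<gamma> t - \<gamma> s - (t - s) *\<^sub>R \<gamma>' t) \<le> K * (t - s)\<^sup>2" using tayI[of s' t'] st' eqs by simp
  qed (use per d1 c2 m in auto)
  then show ?thesis by (rule that)
qed

section \<open>Logarithmic potentials of circles\<close>

lemma has_vector_derivative_cis: "(cis has_vector_derivative \<i> * cis s) (at s)"
proof -
  have eq: "cis = (\<lambda>t. exp (\<i> * of_real t))" by (auto simp: cis_conv_exp)
  show ?thesis unfolding eq by (rule has_vector_derivative_exp_linear)
qed

lemma cis_loop: obtains m M where "regular_loop cis (\<lambda>s. \<i> * cis s) m M"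
proof -
  have "vector_derivative cis (at s) \<noteq> 0" for s
    using vector_derivative_at[OF has_vector_derivative_cis[of s]] by simp
  moreover have "cis (s + 2 * pi) = cis s" for s by (simp add: complex_eq_iff)
  moreover have "C_class 3 cis" using C_class_cis[of 3 1] by simp
  ultimately obtain \<gamma>' m M where *: "regular_loop cis \<gamma>' m M"
    using regular_loop_exists[of cis] inj_on_cis by blast
  have "\<gamma>' s = \<i> * cis s" for s
    using regular_loop.deriv[OF * ] has_vector_derivative_cis vector_derivative_unique_at by blast
  then have "\<gamma>' = (\<lambda>s. \<i> * cis s)" by auto
  with * show ?thesis using that by blast
qed

lemma exp_int_eq_cis: "exp (\<i> * of_int k * of_real s) = cis (of_int k * s)"
  by (simp add: cis_conv_exp mult.assoc)

lemma sq_integrable_cis: "sq_integrable (\<lambda>s. cis (of_int k * s))"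
  using l2_rel_exp_int[of k] by (simp add: l2_rel_def exp_int_eq_cis)

lemma integral_cis: "(\<integral>s. cis (of_int k * s) \<partial>per_measure) = (if k = 0 then 2 * pi else 0)"
  using integral_exp_int[of k] by (simp only: exp_int_eq_cis)

text \<open>Termwise integration of the power series of Ln, in which only positive frequencies
  occur; orthogonality singles out the term n = -k.\<close>

lemma integral_cis_mult_ln:
  fixes w :: complex
  assumes w: "cmod w < 1"
  shows "integrable per_measure (\<lambda>s. cis (of_int k * s) * Ln (1 - w * cis s))"
    and "(\<integral>s. cis (of_int k * s) * Ln (1 - w * cis s) \<partial>per_measure)
      = (if k < 0 then - 2 * pi * w ^ nat (- k) / of_int (- k) else 0)"
proof -
  \<comment> \<open>The term n = 0 is 0, since division by 0 gives 0.\<close>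
  define f where "f n s = cis (of_int k * s) * (- ((w * cis s) ^ n) / of_nat n)" for n :: nat and s
  have f_eq: "f n s = (- (w ^ n) / of_nat n) * cis (of_int (int n + k) * s)" for n s
  proof -
    have "(w * cis s) ^ n = w ^ n * cis (real n * s)" by (simp add: power_mult_distrib Complex.DeMoivre)
    moreover have "cis (of_int (int n + k) * s) = cis (of_int k * s) * cis (real n * s)"
      by (simp add: cis_mult algebra_simps)
    ultimately show ?thesis by (simp add: f_def)
  qed
  have f_int: "integrable per_measure (f n)" for n
    unfolding f_eq[abs_def]
    by (intro integrable_mult_right sq_integrable_imp_integrable sq_integrable_cis)
  have f_val: "(\<integral>s. f n s \<partial>per_measure) = (if int n + k = 0 then (- (w ^ n) / of_nat n) * (2 * pi) else 0)" for n
    unfolding f_eq using integral_cis[of "int n + k"] by simp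
  have f_sums: "(\<lambda>n. f n s) sums (cis (of_int k * s) * Ln (1 - w * cis s))" for s
    unfolding f_def using Ln_series'[of "- (w * cis s)"] w by (intro sums_mult) (simp add: norm_mult)
  have f_norm: "norm (f n s) \<le> cmod w ^ n" for n s
  proof (cases "n = 0")
    case False
    then have "cmod w ^ n / real n \<le> cmod w ^ n / 1" by (intro divide_left_mono) auto
    then show ?thesis by (simp add: f_eq norm_mult norm_divide norm_power)
  qed (simp add: f_eq)
  have sm: "summable (\<lambda>n. cmod w ^ n)" using w by (simp add: summable_geometric)
  have AEs: "AE s in per_measure. summable (\<lambda>n. norm (f n s))"
    by (intro AE_I2 summable_comparison_test'[OF sm]) (use f_norm in auto)
  have ints: "summable (\<lambda>n. \<integral>s. norm (f n s) \<partial>per_measure)"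
  proof (rule summable_comparison_test'[where g = "\<lambda>n. (2 * pi) * cmod w ^ n"])
    show "summable (\<lambda>n. (2 * pi) * cmod w ^ n)" using sm by (rule summable_mult)
    fix n :: nat
    have "(\<integral>s. norm (f n s) \<partial>per_measure) \<le> (\<integral>s. cmod w ^ n \<partial>per_measure)"
      by (rule integral_mono) (use f_int f_norm in auto)
    also have "\<dots> = 2 * pi * cmod w ^ n" by (simp add: measure_restrict_space)
    finally show "norm (\<integral>s. norm (f n s) \<partial>per_measure) \<le> 2 * pi * cmod w ^ n" by simp
  qed
  have eq: "(\<lambda>s. \<Sum>n. f n s) = (\<lambda>s. cis (of_int k * s) * Ln (1 - w * cis s))"
    using f_sums by (auto simp: sums_iff)
  show "integrable per_measure (\<lambda>s. cis (of_int k * s) * Ln (1 - w * cis s))"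
    using integrable_suminf[OF f_int AEs ints] unfolding eq .
  have "(\<lambda>n. \<integral>s. f n s \<partial>per_measure) sums (\<integral>s. cis (of_int k * s) * Ln (1 - w * cis s) \<partial>per_measure)"
    using sums_integral[OF f_int AEs ints] unfolding eq .
  moreover have "(\<lambda>n. \<integral>s. f n s \<partial>per_measure) sums (if k < 0 then - 2 * pi * w ^ nat (- k) / of_int (- k) else 0)"
  proof (cases "k < 0")
    case True
    have "(\<lambda>n. \<integral>s. f n s \<partial>per_measure) = (\<lambda>n. if n = nat (- k) then (- (w ^ nat (- k)) / of_int (- k)) * (2 * pi) else 0)"
      using True by (auto simp: f_val fun_eq_iff)
    then show ?thesis
      using sums_single[of "nat (- k)" "\<lambda>_. (- (w ^ nat (- k)) / of_int (- k)) * (2 * pi)"] True by (simp add: mult.commute)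
  next
    case False
    have "(\<lambda>n. \<integral>s. f n s \<partial>per_measure) = (\<lambda>n. 0)"
      using False by (auto simp: f_val fun_eq_iff)
    then show ?thesis using False by simp
  qed
  ultimately show "(\<integral>s. cis (of_int k * s) * Ln (1 - w * cis s) \<partial>per_measure)
      = (if k < 0 then - 2 * pi * w ^ nat (- k) / of_int (- k) else 0)"
    by (rule sums_unique2)
qed

text \<open>The real logarithm is the mean of Ln and its conjugate: Ln accounts for negative k, the
  conjugate for positive k.\<close>

lemma integral_cis_mult_ln_norm:
  fixes w :: complex
  assumes w: "cmod w < 1"
  shows "(\<integral>s. cis (of_int k * s) * of_real (ln (cmod (1 - w * cis s))) \<partial>per_measure)
      = (if k = 0 then 0 else if k > 0 then - pi * cnj w ^ nat k / of_int k else - pi * w ^ nat (- k) / of_int (- k))"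
proof -
  let ?L = "\<lambda>s. Ln (1 - w * cis s)"
  note J = integral_cis_mult_ln[OF w]
  have nz: "1 - w * cis s \<noteq> 0" for s
  proof
    assume "1 - w * cis s = 0"
    then have "cmod (w * cis s) = 1" by simp
    then show False using w by (simp add: norm_mult)
  qed
  have ln_eq: "complex_of_real (ln (cmod (1 - w * cis s))) = (?L s + cnj (?L s)) / 2" for s
    using nz[of s] by (simp add: complex_add_cnj)
  have cnj_eq: "cis (of_int k * s) * cnj (?L s) = cnj (cis (of_int (- k) * s) * ?L s)" for s
    by (simp add: cis_cnj)
  have "(\<integral>s. cis (of_int k * s) * of_real (ln (cmod (1 - w * cis s))) \<partial>per_measure)
      = (\<integral>s. (cis (of_int k * s) * ?L s) / 2 + cnj (cis (of_int (- k) * s) * ?L s) / 2 \<partial>per_measure)"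
    unfolding ln_eq cnj_eq[symmetric] by (simp add: algebra_simps add_divide_distrib)
  also have "\<dots> = (\<integral>s. cis (of_int k * s) * ?L s \<partial>per_measure) / 2
      + cnj (\<integral>s. cis (of_int (- k) * s) * ?L s \<partial>per_measure) / 2"
    using J(1)[of k] integrable_cnj[OF J(1)[of "- k"]]
    by (subst Bochner_Integration.integral_add)
       (auto simp del: complex_cnj_mult simp: Bochner_Integration.integral_cnj)
  also have "\<dots> = (if k = 0 then 0 else if k > 0 then - pi * cnj w ^ nat k / of_int k else - pi * w ^ nat (- k) / of_int (- k))"
    unfolding J(2) by auto
  finally show ?thesis .
qed

lemma pot_cis_outside:
  fixes x :: complex
  assumes x: "cmod x > 1"
  shows "regular_loop.pot cis (\<lambda>s. cis (of_int k * s)) x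
    = (if k = 0 then 2 * pi * ln (cmod x) else if k > 0 then - pi * cnj (1 / x) ^ nat k / of_int k
       else - pi * (1 / x) ^ nat (- k) / of_int (- k))"
proof -
  obtain m M where L: "regular_loop cis (\<lambda>s. \<i> * cis s) m M" by (rule cis_loop)
  interpret regular_loop cis "\<lambda>s. \<i> * cis s" m M by (rule L)
  have x0: "x \<noteq> 0" using x by auto
  have w: "cmod (1 / x) < 1" using x by (simp add: norm_divide divide_less_eq)
  have ln_eq: "ln (cmod (x - cis s)) = ln (cmod x) + ln (cmod (1 - 1 / x * cis s))" for s
  proof -
    have "x - cis s = x * (1 - 1 / x * cis s)" using x0 by (simp add: field_simps)
    then have "cmod (x - cis s) = cmod x * cmod (1 - 1 / x * cis s)" by (simp only: norm_mult)
    moreover have "1 - 1 / x * cis s \<noteq> 0"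
    proof
      assume "1 - 1 / x * cis s = 0"
      then have "1 / x * cis s = 1" by simp
      then have "cmod (1 / x) * cmod (cis s) = 1" by (metis norm_mult norm_one)
      then show False using w by simp
    qed
    ultimately show ?thesis using x0 by (simp add: ln_mult)
  qed
  have i1: "integrable per_measure (\<lambda>s. cis (of_int k * s) * of_real (ln (cmod x)))"
    by (intro integrable_mult_left sq_integrable_imp_integrable sq_integrable_cis)
  have i0: "integrable per_measure (\<lambda>s. cis (of_int k * s) * of_real (ln (cmod (x - cis s))))"
    by (rule pot_integrable[OF sq_integrable_cis])
  have i2: "integrable per_measure (\<lambda>s. cis (of_int k * s) * of_real (ln (cmod (1 - 1 / x * cis s))))"
    using Bochner_Integration.integrable_diff[OF i0 i1] unfolding ln_eq by (simp add: algebra_simps)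
  have "pot (\<lambda>s. cis (of_int k * s)) x
      = (\<integral>s. cis (of_int k * s) * of_real (ln (cmod x)) \<partial>per_measure)
        + (\<integral>s. cis (of_int k * s) * of_real (ln (cmod (1 - 1 / x * cis s))) \<partial>per_measure)"
    unfolding pot_def ln_eq of_real_add distrib_left by (rule Bochner_Integration.integral_add[OF i1 i2])
  then show ?thesis
    unfolding integral_cis_mult_ln_norm[OF w] using integral_cis[of k] by simp
qed

text \<open>On the circle itself the geometric majorant of the series is lost, so the value is
  obtained as a radial limit from outside, justified by \<open>continuous_pot\<close>. The
  eigenvalue 0 of the constants is the degeneracy of the unit circle.\<close>

lemma pot_cis_on_circle:
  "regular_loop.pot cis (\<lambda>s. cis (of_int k * s)) (cis t) = (if k = 0 then 0 else - pi / \<bar>of_int k\<bar> * cis (of_int k * t))"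
proof -
  obtain m M where L: "regular_loop cis (\<lambda>s. \<i> * cis s) m M" by (rule cis_loop)
  interpret regular_loop cis "\<lambda>s. \<i> * cis s" m M by (rule L)
  let ?u = "pot (\<lambda>s. cis (of_int k * s))"
  define r where "r n = 1 + 1 / real (Suc n)" for n
  have r: "r n > 1" for n by (simp add: r_def)
  have r1: "r \<longlonglongrightarrow> 1"
    unfolding r_def[abs_def] using tendsto_add[OF tendsto_const[of 1] LIMSEQ_inverse_real_of_nat]
    by (simp add: divide_inverse)
  have x: "(\<lambda>n. of_real (r n) * cis t) \<longlonglongrightarrow> of_real 1 * cis t" by (intro tendsto_intros r1)
  have lim: "(\<lambda>n. ?u (of_real (r n) * cis t)) \<longlonglongrightarrow> ?u (cis t)"
    using continuous_on_tendsto_compose[OF continuous_pot[OF sq_integrable_cis] x] by simp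
  define c where "c n = (if k = 0 then complex_of_real (2 * pi * ln (r n))
     else - pi / \<bar>of_int k\<bar> * cis (of_int k * t) * of_real ((1 / r n) ^ nat \<bar>k\<bar>))" for n
  have "?u (of_real (r n) * cis t) = c n" for n
  proof -
    have c1: "cmod (of_real (r n) * cis t) = r n" using r[of n] by (simp add: norm_mult)
    have inv: "1 / (of_real (r n) * cis t) = of_real (1 / r n) * cis (- t)"
      by (simp add: divide_inverse cis_inverse)
    have cnj_inv: "cnj (of_real (1 / r n) * cis (- t)) = of_real (1 / r n) * cis t"
      by (simp add: cis_cnj)
    consider "k = 0" | "k > 0" | "k < 0" by linarith
    then show ?thesis
    proof cases
      case 1
      then show ?thesis using pot_cis_outside[of "of_real (r n) * cis t" k] r[of n] c1 by (simp add: c_def)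
    next
      case 2
      have "?u (of_real (r n) * cis t) = - pi * (of_real (1 / r n) * cis t) ^ nat k / of_int k"
        using pot_cis_outside[of "of_real (r n) * cis t" k] r[of n] c1 2 unfolding inv cnj_inv by simp
      then show ?thesis using 2 by (simp add: c_def power_mult_distrib Complex.DeMoivre field_simps)
    next
      case 3
      have "?u (of_real (r n) * cis t) = - pi * (of_real (1 / r n) * cis (- t)) ^ nat (- k) / of_int (- k)"
        using pot_cis_outside[of "of_real (r n) * cis t" k] r[of n] c1 3 unfolding inv by simp
      then show ?thesis using 3 by (simp add: c_def power_mult_distrib Complex.DeMoivre field_simps)
    qed
  qed
  moreover have "c \<longlonglongrightarrow> (if k = 0 then complex_of_real (2 * pi * ln 1)
     else - pi / \<bar>of_int k\<bar> * cis (of_int k * t) * of_real ((1 / 1) ^ nat \<bar>k\<bar>))"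
    unfolding c_def by (cases "k = 0") (auto intro!: tendsto_eq_intros r1 simp del: of_real_mult of_real_power of_real_divide)
  ultimately have "?u (cis t) = (if k = 0 then complex_of_real (2 * pi * ln 1)
     else - pi / \<bar>of_int k\<bar> * cis (of_int k * t) * of_real ((1 / 1) ^ nat \<bar>k\<bar>))"
    using LIMSEQ_unique[OF lim] by simp
  then show ?thesis by simp
qed

text \<open>A uniformly charged circle has constant potential inside and that of a point charge at
  its center outside. This is the mean value formula for ln |z - x| over circles not enclosing z,
  and also the potential of the compensating charge.\<close>

lemma integral_ln_circle:
  assumes r: "r > 0"
  shows "(\<integral>s. complex_of_real (ln (cmod (z - (x0 + of_real r * cis s)))) \<partial>per_measure) = 2 * pi * ln (max (cmod (z - x0)) r)"
proof -
  obtain m M where L: "regular_loop cis (\<lambda>s. \<i> * cis s) m M" by (rule cis_loop)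
  interpret regular_loop cis "\<lambda>s. \<i> * cis s" m M by (rule L)
  define y where "y = (z - x0) / of_real r"
  have one: "(\<lambda>s. cis (of_int 0 * s)) = (\<lambda>s. 1)" by simp
  have y: "cmod y = cmod (z - x0) / r" using r by (simp add: y_def norm_divide)
  have pot: "pot (\<lambda>s. 1) y = 2 * pi * ln (max (cmod y) 1)"
  proof -
    consider "cmod y > 1" | "cmod y = 1" | "cmod y < 1" by linarith
    then show ?thesis
    proof cases
      case 1
      then show ?thesis using pot_cis_outside[of y 0] unfolding one by simp
    next
      case 2
      then have "y = cis (Arg2pi y)" using Arg2pi_eq[of y] by (simp add: cis_conv_exp)
      then show ?thesis using pot_cis_on_circle[of 0 "Arg2pi y"] 2 unfolding one by simp
    next
      case 3
      \<comment> \<open>Reflection in the unit circle brings the interior case to the form of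
        \<open>integral_cis_mult_ln_norm\<close>.\<close>
      have "cmod (y - cis s) = cmod (1 - cnj y * cis s)" for s
      proof -
        have "cmod (1 - cnj y * cis s) = cmod (cnj (1 - cnj y * cis s))" by (simp only: complex_mod_cnj)
        also have "\<dots> = cmod (cis (- s) * (cis s - y))" by (simp add: cis_cnj cis_mult algebra_simps)
        also have "\<dots> = cmod (y - cis s)" by (simp add: norm_mult norm_minus_commute)
        finally show ?thesis by simp
      qed
      then show ?thesis using integral_cis_mult_ln_norm[of "cnj y" 0] 3 by (simp add: pot_def)
    qed
  qed
  have "(\<integral>s. complex_of_real (ln (cmod (z - (x0 + of_real r * cis s)))) \<partial>per_measure)
      = (\<integral>s. of_real (ln r) + 1 * of_real (ln (cmod (y - cis s))) \<partial>per_measure)"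
  proof (rule integral_cong_AE)
    show "AE s in per_measure. complex_of_real (ln (cmod (z - (x0 + of_real r * cis s)))) = of_real (ln r) + 1 * of_real (ln (cmod (y - cis s)))"
      using AE_neq[of y]
    proof eventually_elim
      case (elim s)
      have "z - (x0 + of_real r * cis s) = of_real r * (y - cis s)" using r by (simp add: y_def field_simps)
      then have "cmod (z - (x0 + of_real r * cis s)) = r * cmod (y - cis s)" using r by (simp add: norm_mult)
      then show ?case using elim r by (simp add: ln_mult)
    qed
  qed (auto intro!: borel_measurable_add)
  also have "\<dots> = 2 * pi * ln r + pot (\<lambda>s. 1) y"
    using pot_integrable[OF sq_integrable_const, of 1 y]
    by (subst Bochner_Integration.integral_add) (auto simp: pot_def measure_restrict_space scaleR_conv_of_real)
  also have "\<dots> = 2 * pi * ln (max (cmod (z - x0)) r)"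
  proof -
    have "ln r + ln (max (cmod y) 1) = ln (r * max (cmod y) 1)" using r by (subst ln_mult) auto
    also have "r * max (cmod y) 1 = max (cmod (z - x0)) r" using r by (simp add: y max_def field_simps)
    finally have "2 * pi * ln r + 2 * pi * ln (max (cmod y) 1) = 2 * pi * ln (max (cmod (z - x0)) r)"
      by (simp flip: distrib_left)
    then show ?thesis unfolding pot by (metis of_real_add of_real_mult of_real_numeral)
  qed
  finally show ?thesis .
qed

section \<open>Symm's operator\<close>

lemma rep_add: "AE t in per_measure. rep_l2 (F + G) t = rep_l2 F t + rep_l2 G t"
  unfolding plus_l2_def map_fun_apply
  by (rule rep_abs_l2) (intro sq_integrable_add sq_integrable_rep)

lemma rep_cscale: "AE t in per_measure. rep_l2 (cscale c F) t = c * rep_l2 F t"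
  unfolding cscale_def map_fun_apply id_apply
  by (rule rep_abs_l2) (intro sq_integrable_cmult sq_integrable_rep)

lemma rep_diff: "AE t in per_measure. rep_l2 (F - G) t = rep_l2 F t - rep_l2 G t"
proof -
  have "F - G = F + cscale (- 1) G" by (simp add: cscale_minus_one)
  then show ?thesis using rep_add[of F "cscale (- 1) G"] rep_cscale[of "- 1" G]
    by (auto elim!: eventually_elim2)
qed

lemma cinner_AE:
  assumes "AE t in per_measure. rep_l2 F t = f t" "AE t in per_measure. rep_l2 G t = g t"
    and "f \<in> borel_measurable per_measure" "g \<in> borel_measurable per_measure"
  shows "cinner F G = (\<integral>t. f t * cnj (g t) \<partial>per_measure)"
  unfolding cinner_rep
proof (rule integral_cong_AE)
  note [measurable] = sq_integrable_measurable[OF sq_integrable_rep] assms(3,4)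
  show "(\<lambda>t. rep_l2 F t * cnj (rep_l2 G t)) \<in> borel_measurable per_measure" by measurable
  show "(\<lambda>t. f t * cnj (g t)) \<in> borel_measurable per_measure" by measurable
  show "AE t in per_measure. rep_l2 F t * cnj (rep_l2 G t) = f t * cnj (g t)"
    using assms(1,2) by eventually_elim simp
qed

lemma norm_square_AE:
  assumes "AE t in per_measure. rep_l2 F t = f t" "f \<in> borel_measurable per_measure"
  shows "(norm F)\<^sup>2 = (\<integral>t. (cmod (f t))\<^sup>2 \<partial>per_measure)"
proof -
  have "complex_of_real ((norm F)\<^sup>2) = (\<integral>t. of_real ((cmod (f t))\<^sup>2) \<partial>per_measure)"
    using cinner_AE[OF assms(1,1) assms(2,2)] unfolding cinner_self complex_norm_square .
  then have "complex_of_real ((norm F)\<^sup>2) = of_real (\<integral>t. (cmod (f t))\<^sup>2 \<partial>per_measure)"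
    by (simp only: integral_complex_of_real)
  then show ?thesis by (simp only: of_real_eq_iff)
qed

lemma per_pair_sigma_finite: "pair_sigma_finite per_measure per_measure"
  by (simp add: pair_sigma_finite_def per.sigma_finite_measure_axioms)

text \<open>Reciprocity for charges on two loops, due to the symmetry of ln |x - y|. With equal
  loops it yields self-adjointness; with a circle as second loop it expresses circle means of a
  potential through the potential of the circle.\<close>

lemma pot_fubini:
  assumes 1: "regular_loop \<gamma>1 \<gamma>1' m1 M1" and 2: "regular_loop \<gamma>2 \<gamma>2' m2 M2"
    and f: "sq_integrable f" and g: "sq_integrable g"
  shows "(\<integral>t. g t * regular_loop.pot \<gamma>1 f (\<gamma>2 t) \<partial>per_measure)
       = (\<integral>s. f s * regular_loop.pot \<gamma>2 g (\<gamma>1 s) \<partial>per_measure)"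
proof -
  interpret L1: regular_loop \<gamma>1 \<gamma>1' m1 M1 by fact
  interpret L2: regular_loop \<gamma>2 \<gamma>2' m2 M2 by fact
  interpret P: pair_sigma_finite per_measure per_measure by (rule per_pair_sigma_finite)
  note [measurable] = f[THEN sq_integrable_measurable] g[THEN sq_integrable_measurable]
  define k where "k t s = g t * (f s * of_real (ln (cmod (\<gamma>2 t - \<gamma>1 s))))" for t s
  obtain R where R: "\<And>s. cmod (\<gamma>2 s) \<le> R" using L2.bounded by blast
  obtain C where C': "C \<ge> 0" "\<forall>f x. sq_integrable f \<longrightarrow> cmod x \<le> R \<longrightarrow>
    (\<integral>s. norm (f s * of_real (ln (cmod (x - \<gamma>1 s)))) \<partial>per_measure) \<le> (\<integral>s. (cmod (f s))\<^sup>2 \<partial>per_measure) + C"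
    using L1.pot_bound[of R] by blast
  note C = C'(1) C'(2)[rule_format]
  define B where "B = (\<integral>s. (cmod (f s))\<^sup>2 \<partial>per_measure) + C"
  have int: "integrable (per_measure \<Otimes>\<^sub>M per_measure) (case_prod k)"
  proof (rule P.Fubini_integrable)
    show "case_prod k \<in> borel_measurable (per_measure \<Otimes>\<^sub>M per_measure)"
      unfolding k_def split_beta by measurable
    show "AE t in per_measure. integrable per_measure (\<lambda>s. case (t, s) of (t, s) \<Rightarrow> k t s)"
      unfolding k_def using L1.pot_integrable[OF f] by (intro AE_I2) simp
    show "integrable per_measure (\<lambda>t. \<integral>s. norm (case (t, s) of (t, s) \<Rightarrow> k t s) \<partial>per_measure)"
    proof (rule Bochner_Integration.integrable_bound[where f = "\<lambda>t. B * cmod (g t)"])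
      show "integrable per_measure (\<lambda>t. B * cmod (g t))" using sq_integrable_imp_integrable[OF g] by simp
      show "(\<lambda>t. \<integral>s. norm (case (t, s) of (t, s) \<Rightarrow> k t s) \<partial>per_measure) \<in> borel_measurable per_measure"
        unfolding k_def prod.case by measurable
      show "AE t in per_measure. norm (\<integral>s. norm (case (t, s) of (t, s) \<Rightarrow> k t s) \<partial>per_measure) \<le> norm (B * cmod (g t))"
      proof (rule AE_I2)
        fix t
        have "(\<integral>s. norm (k t s) \<partial>per_measure) = cmod (g t) * (\<integral>s. norm (f s * of_real (ln (cmod (\<gamma>2 t - \<gamma>1 s)))) \<partial>per_measure)"
          unfolding k_def norm_mult[of "g t"] by simp
        also have "\<dots> \<le> cmod (g t) * B" unfolding B_def by (intro mult_left_mono C(2) f R) auto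
        finally have "(\<integral>s. norm (k t s) \<partial>per_measure) \<le> cmod (g t) * B" .
        moreover have "(\<integral>s. norm (k t s) \<partial>per_measure) \<ge> 0" by simp
        ultimately show "norm (\<integral>s. norm (case (t, s) of (t, s) \<Rightarrow> k t s) \<partial>per_measure) \<le> norm (B * cmod (g t))"
          by (simp only: real_norm_def prod.case mult.commute)
      qed
    qed
  qed
  have "(\<integral>t. g t * L1.pot f (\<gamma>2 t) \<partial>per_measure) = (\<integral>t. (\<integral>s. k t s \<partial>per_measure) \<partial>per_measure)"
    by (simp add: L1.pot_def k_def)
  also have "\<dots> = (\<integral>s. (\<integral>t. k t s \<partial>per_measure) \<partial>per_measure)"
    by (rule P.Fubini_integral[OF int, symmetric])
  also have "\<dots> = (\<integral>s. f s * L2.pot g (\<gamma>1 s) \<partial>per_measure)"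
  proof (rule Bochner_Integration.integral_cong)
    fix s
    have "k t s = f s * (g t * of_real (ln (cmod (\<gamma>1 s - \<gamma>2 t))))" for t
      by (simp add: k_def norm_minus_commute)
    then show "(\<integral>t. k t s \<partial>per_measure) = f s * L2.pot g (\<gamma>1 s)" by (simp add: L2.pot_def)
  qed simp
  finally show ?thesis .
qed

lemma regular_loop_affine:
  assumes "regular_loop \<gamma> \<gamma>' m M" "r > 0"
  shows "regular_loop (\<lambda>s. x0 + of_real r * \<gamma> s) (\<lambda>s. of_real r * \<gamma>' s) (r * m) (r * M)"
proof -
  interpret regular_loop \<gamma> \<gamma>' m M by fact
  show ?thesis
  proof
    fix s t :: real
    show "x0 + of_real r * \<gamma> (s + 2 * pi) = x0 + of_real r * \<gamma> s" by (simp add: periodic)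
    show "((\<lambda>s. x0 + of_real r * \<gamma> s) has_vector_derivative of_real r * \<gamma>' s) (at s)"
      by (auto intro!: derivative_eq_intros deriv)
    have eq: "x0 + of_real r * \<gamma> t - (x0 + of_real r * \<gamma> s) = of_real r * (\<gamma> t - \<gamma> s)"
      by (simp add: algebra_simps)
    show "r * m * \<bar>t - s\<bar> \<le> cmod (x0 + of_real r * \<gamma> t - (x0 + of_real r * \<gamma> s))"
      if "\<bar>t - s\<bar> \<le> pi"
      unfolding eq norm_mult using lower[OF that] assms(2) by (simp add: mult.assoc)
    have eq2: "x0 + of_real r * \<gamma> t - (x0 + of_real r * \<gamma> s) - (t - s) *\<^sub>R (of_real r * \<gamma>' t)
        = of_real r * (\<gamma> t - \<gamma> s - (t - s) *\<^sub>R \<gamma>' t)"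
      unfolding scaleR_conv_of_real by (simp add: algebra_simps)
    show "cmod (x0 + of_real r * \<gamma> t - (x0 + of_real r * \<gamma> s) - (t - s) *\<^sub>R (of_real r * \<gamma>' t)) \<le> r * M * (t - s)\<^sup>2"
      if "\<bar>t - s\<bar> \<le> pi"
      unfolding eq2 norm_mult using taylor[OF that] assms(2) by (simp add: mult.assoc)
  qed (use m_pos assms(2) cont' in \<open>auto intro!: continuous_intros\<close>)
qed

context regular_loop
begin

lemma pot_cong_AE:
  assumes "AE s in per_measure. f s = g s" "sq_integrable f" "sq_integrable g"
  shows "pot f x = pot g x"
  unfolding pot_def
proof (rule integral_cong_AE)
  note [measurable] = assms(2,3)[THEN sq_integrable_measurable]
  show "(\<lambda>s. f s * of_real (ln (cmod (x - \<gamma> s)))) \<in> borel_measurable per_measure" by measurable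
  show "(\<lambda>s. g s * of_real (ln (cmod (x - \<gamma> s)))) \<in> borel_measurable per_measure" by measurable
  show "AE s in per_measure. f s * of_real (ln (cmod (x - \<gamma> s))) = g s * of_real (ln (cmod (x - \<gamma> s)))"
    using assms(1) by eventually_elim simp
qed

lemma pot_add:
  assumes "sq_integrable f" "sq_integrable g"
  shows "pot (\<lambda>s. f s + g s) x = pot f x + pot g x"
  unfolding pot_def distrib_right
  by (rule Bochner_Integration.integral_add) (intro pot_integrable assms)+

lemma pot_cmult: "pot (\<lambda>s. c * f s) x = c * pot f x"
  unfolding pot_def mult.assoc by simp

lemma pot_cnj: "pot (\<lambda>s. cnj (f s)) x = cnj (pot f x)"
proof -
  have "cnj (f s) * of_real (ln (cmod (x - \<gamma> s))) = cnj (f s * of_real (ln (cmod (x - \<gamma> s))))" for s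
    by simp
  then show ?thesis unfolding pot_def by (simp only: Bochner_Integration.integral_cnj)
qed

lemma sq_integrable_pot:
  assumes f: "sq_integrable f" and h: "continuous_on UNIV h" and hb: "\<And>t. cmod (h t) \<le> R"
  shows "sq_integrable (\<lambda>t. pot f (h t))"
proof -
  have "compact (pot f ` cball 0 R)"
    by (intro compact_continuous_image continuous_on_subset[OF continuous_pot[OF f]]) auto
  then obtain B where B: "\<And>z. z \<in> cball 0 R \<Longrightarrow> cmod (pot f z) \<le> B"
    by (meson bounded_iff compact_imp_bounded imageI)
  show ?thesis
    by (rule sq_integrable_bounded[of _ B])
       (use B hb in \<open>auto intro!: per_measurable_continuous continuous_on_compose2[OF continuous_pot[OF f] h]\<close>)
qed

lemma sq_integrable_pot_loop:
  assumes "sq_integrable f" shows "sq_integrable (\<lambda>t. pot f (\<gamma> t))"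
  using bounded sq_integrable_pot[OF assms cont] by metis

lemma symm_op_pot: "symm_op \<gamma> \<Psi> = abs_l2 (\<lambda>t. - (1 / of_real pi) * pot (rep_l2 \<Psi>) (\<gamma> t))"
  by (simp add: symm_op_def pot_def)

lemma rep_symm_op: "AE t in per_measure. rep_l2 (symm_op \<gamma> \<Psi>) t = - (1 / of_real pi) * pot (rep_l2 \<Psi>) (\<gamma> t)"
  unfolding symm_op_pot by (intro rep_abs_l2 sq_integrable_cmult sq_integrable_pot_loop sq_integrable_rep)

lemma rep_symm_op_AE:
  assumes "AE t in per_measure. rep_l2 \<Psi> t = f t" "sq_integrable f"
  shows "AE t in per_measure. rep_l2 (symm_op \<gamma> \<Psi>) t = - (1 / of_real pi) * pot f (\<gamma> t)"
  using rep_symm_op[of \<Psi>] pot_cong_AE[OF assms(1) sq_integrable_rep assms(2)] by simp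

lemma symm_op_add: "symm_op \<gamma> (F + G) = symm_op \<gamma> F + symm_op \<gamma> G"
proof (rule l2_eqI)
  have "AE t in per_measure. rep_l2 (symm_op \<gamma> (F + G)) t
      = - (1 / of_real pi) * pot (\<lambda>s. rep_l2 F s + rep_l2 G s) (\<gamma> t)"
    by (rule rep_symm_op_AE[OF rep_add]) (intro sq_integrable_add sq_integrable_rep)
  then show "AE t in per_measure. rep_l2 (symm_op \<gamma> (F + G)) t = rep_l2 (symm_op \<gamma> F + symm_op \<gamma> G) t"
    using rep_symm_op[of F] rep_symm_op[of G] rep_add[of "symm_op \<gamma> F" "symm_op \<gamma> G"]
  proof eventually_elim
    case (elim t)
    then show ?case by (simp only: pot_add[OF sq_integrable_rep sq_integrable_rep] distrib_left)
  qed
qed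

lemma symm_op_cscale: "symm_op \<gamma> (cscale c F) = cscale c (symm_op \<gamma> F)"
proof (rule l2_eqI)
  have "AE t in per_measure. rep_l2 (symm_op \<gamma> (cscale c F)) t
      = - (1 / of_real pi) * pot (\<lambda>s. c * rep_l2 F s) (\<gamma> t)"
    by (rule rep_symm_op_AE[OF rep_cscale]) (intro sq_integrable_cmult sq_integrable_rep)
  then show "AE t in per_measure. rep_l2 (symm_op \<gamma> (cscale c F)) t = rep_l2 (cscale c (symm_op \<gamma> F)) t"
    using rep_symm_op[of F] rep_cscale[of c "symm_op \<gamma> F"]
  proof eventually_elim
    case (elim t)
    then show ?case by (simp add: pot_cmult)
  qed
qed

lemma symm_op_self_adjoint: "cinner (symm_op \<gamma> F) G = cinner F (symm_op \<gamma> G)"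
proof -
  let ?f = "rep_l2 F" and ?g = "\<lambda>t. cnj (rep_l2 G t)"
  note [measurable] = sq_integrable_measurable[OF sq_integrable_rep]
    sq_integrable_measurable[OF sq_integrable_pot_loop[OF sq_integrable_rep]]
  have loop: "regular_loop \<gamma> \<gamma>' m M" by (rule regular_loop_axioms)
  have g: "sq_integrable ?g" using sq_integrable_rep[of G] by (auto simp: sq_integrable_def)
  have "cinner (symm_op \<gamma> F) G = (\<integral>t. - (1 / of_real pi) * pot ?f (\<gamma> t) * cnj (rep_l2 G t) \<partial>per_measure)"
    by (rule cinner_AE[OF rep_symm_op]) (auto intro!: borel_measurable_times)
  also have "\<dots> = (\<integral>t. - (1 / of_real pi) * (?g t * pot ?f (\<gamma> t)) \<partial>per_measure)"
    by (intro Bochner_Integration.integral_cong) auto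
  also have "\<dots> = - (1 / of_real pi) * (\<integral>t. ?g t * pot ?f (\<gamma> t) \<partial>per_measure)" by simp
  also have "(\<integral>t. ?g t * pot ?f (\<gamma> t) \<partial>per_measure) = (\<integral>s. ?f s * pot ?g (\<gamma> s) \<partial>per_measure)"
    by (rule pot_fubini[OF loop loop sq_integrable_rep g])
  also have "- (1 / of_real pi) * \<dots> = (\<integral>s. ?f s * cnj (- (1 / of_real pi) * pot (rep_l2 G) (\<gamma> s)) \<partial>per_measure)"
    unfolding pot_cnj by (simp add: mult.left_commute[of _ "inverse _"] field_simps)
  also have "\<dots> = cinner F (symm_op \<gamma> G)"
    by (rule cinner_AE[OF _ rep_symm_op, symmetric]) (auto intro!: borel_measurable_times)
  finally show ?thesis .
qed

section \<open>The derivative of the logarithmic kernel\<close>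

lemma log_deriv:
  assumes "\<gamma> s \<noteq> c"
  shows "((\<lambda>s. ln (cmod (\<gamma> s - c))) has_real_derivative inner (\<gamma> s - c) (\<gamma>' s) / (cmod (\<gamma> s - c))\<^sup>2) (at s)"
proof -
  have d: "((\<lambda>s. \<gamma> s - c) has_derivative (\<lambda>h. h *\<^sub>R \<gamma>' s)) (at s)"
    using deriv[of s] by (auto simp: has_vector_derivative_def intro!: derivative_eq_intros)
  have n: "((\<lambda>s. norm (\<gamma> s - c)) has_derivative (\<lambda>h. inner (h *\<^sub>R \<gamma>' s) (sgn (\<gamma> s - c)))) (at s)"
    using has_derivative_compose[OF d has_derivative_norm[of "\<gamma> s - c"]] assms by simp
  have "((\<lambda>s. norm (\<gamma> s - c)) has_real_derivative inner (\<gamma>' s) (sgn (\<gamma> s - c))) (at s)"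
    using n by (simp add: has_field_derivative_def mult_commute_abs)
  then have "((\<lambda>s. ln (cmod (\<gamma> s - c))) has_real_derivative
      inner (\<gamma>' s) (sgn (\<gamma> s - c)) / cmod (\<gamma> s - c)) (at s)"
    using assms by (auto intro!: derivative_eq_intros simp: divide_inverse)
  moreover have "inner (\<gamma>' s) (sgn (\<gamma> s - c)) / cmod (\<gamma> s - c) = inner (\<gamma> s - c) (\<gamma>' s) / (cmod (\<gamma> s - c))\<^sup>2"
    by (simp add: sgn_div_norm inner_commute[of "\<gamma>' s"] power2_eq_square divide_inverse)
  ultimately show ?thesis by simp
qed

text \<open>The singular part 1/(s - t) is the same for every curve and therefore cancels between
  two loops. With z = \<gamma>(s) - \<gamma>(t), the rest is the inner product of z with the Taylor
  error over |z|^2 (s - t), and the chord-arc bound reduces it to M / m.\<close>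

lemma log_deriv_bound:
  assumes "s \<noteq> t" "\<bar>s - t\<bar> \<le> pi"
  shows "\<bar>inner (\<gamma> s - \<gamma> t) (\<gamma>' s) / (cmod (\<gamma> s - \<gamma> t))\<^sup>2 - 1 / (s - t)\<bar> \<le> M / m"
proof -
  define z d where "z = \<gamma> s - \<gamma> t" and "d = s - t"
  have d: "d \<noteq> 0" using assms by (simp add: d_def)
  have zl: "m * \<bar>d\<bar> \<le> cmod z" using lower[OF assms(2)] by (simp add: z_def d_def)
  moreover have md: "m * \<bar>d\<bar> > 0" using m_pos d by simp
  ultimately have z: "cmod z > 0" by linarith
  have M0: "M \<ge> 0"
  proof -
    have "0 \<le> M * (s - t)\<^sup>2" using taylor[OF assms(2)] norm_ge_zero order_trans by blast
    then show ?thesis using d by (simp add: d_def zero_le_mult_iff)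
  qed
  have "inner z (\<gamma>' s) / (cmod z)\<^sup>2 - 1 / d = inner z (d *\<^sub>R \<gamma>' s - z) / ((cmod z)\<^sup>2 * d)"
    using z d by (simp add: inner_diff_right field_simps power2_norm_eq_inner)
  also have "\<bar>\<dots>\<bar> = \<bar>inner z (d *\<^sub>R \<gamma>' s - z)\<bar> / ((cmod z)\<^sup>2 * \<bar>d\<bar>)" by (simp add: abs_mult)
  also have "\<dots> \<le> (cmod z * (M * d\<^sup>2)) / ((cmod z)\<^sup>2 * \<bar>d\<bar>)"
  proof (rule divide_right_mono)
    have "\<bar>inner z (d *\<^sub>R \<gamma>' s - z)\<bar> \<le> cmod z * cmod (d *\<^sub>R \<gamma>' s - z)" by (rule Cauchy_Schwarz_ineq2)
    also have "\<dots> \<le> cmod z * (M * d\<^sup>2)"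
      using taylor[OF assms(2)] by (intro mult_left_mono) (auto simp: z_def d_def norm_minus_commute)
    finally show "\<bar>inner z (d *\<^sub>R \<gamma>' s - z)\<bar> \<le> cmod z * (M * d\<^sup>2)" .
  qed simp
  also have "\<dots> = M * \<bar>d\<bar> / cmod z"
    using z d by (simp add: field_simps power2_eq_square abs_mult_self_eq)
  also have "\<dots> \<le> M * \<bar>d\<bar> / (m * \<bar>d\<bar>)" using zl md M0 z by (intro divide_left_mono) auto
  also have "\<dots> = M / m" using d by simp
  finally show ?thesis by (simp add: z_def d_def)
qed

text \<open>Gives the limit at s = t of the difference of two logarithmic kernels: the factors |s -
  t| cancel and the logarithms of the speeds remain.\<close>

lemma quotient_tendsto:
  "((\<lambda>s. cmod (\<gamma> s - \<gamma> t) / \<bar>s - t\<bar>) \<longlongrightarrow> cmod (\<gamma>' t)) (at t)" "cmod (\<gamma>' t) > 0"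
proof -
  have ev: "eventually (\<lambda>s. \<bar>s - t\<bar> \<le> pi \<and> s \<noteq> t) (at t)"
    unfolding eventually_at by (intro exI[of _ pi]) (auto simp: dist_real_def)
  have lim0: "((\<lambda>s. cmod (\<gamma> s - \<gamma> t) / \<bar>s - t\<bar> - cmod (\<gamma>' s)) \<longlongrightarrow> 0) (at t)"
  proof (rule Lim_null_comparison)
    show "eventually (\<lambda>s. norm (cmod (\<gamma> s - \<gamma> t) / \<bar>s - t\<bar> - cmod (\<gamma>' s)) \<le> M * \<bar>s - t\<bar>) (at t)"
      using ev
    proof eventually_elim
      case (elim s)
      have "cmod (\<gamma> s - \<gamma> t) / \<bar>s - t\<bar> - cmod (\<gamma>' s)
          = (cmod (\<gamma> s - \<gamma> t) - cmod ((s - t) *\<^sub>R \<gamma>' s)) / \<bar>s - t\<bar>"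
        using elim by (simp add: diff_divide_distrib)
      then have "norm (cmod (\<gamma> s - \<gamma> t) / \<bar>s - t\<bar> - cmod (\<gamma>' s))
          = \<bar>cmod (\<gamma> s - \<gamma> t) - cmod ((s - t) *\<^sub>R \<gamma>' s)\<bar> / \<bar>s - t\<bar>"
        by (simp only: real_norm_def abs_divide abs_abs)
      also have "\<dots> \<le> (M * (s - t)\<^sup>2) / \<bar>s - t\<bar>"
        using taylor[of s t] elim norm_triangle_ineq3[of "\<gamma> s - \<gamma> t" "(s - t) *\<^sub>R \<gamma>' s"]
        by (intro divide_right_mono) auto
      also have "\<dots> = M * \<bar>s - t\<bar>" using elim by (simp add: field_simps power2_eq_square abs_mult_self_eq)
      finally show ?case .
    qed
    have "((\<lambda>s. M * \<bar>s - t\<bar>) \<longlongrightarrow> M * \<bar>t - t\<bar>) (at t)" by (intro tendsto_intros)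
    then show "((\<lambda>s. M * \<bar>s - t\<bar>) \<longlongrightarrow> 0) (at t)" by simp
  qed
  have "((\<lambda>s. cmod (\<gamma>' s)) \<longlongrightarrow> cmod (\<gamma>' t)) (at t)"
    using cont' by (intro tendsto_norm) (auto simp: continuous_on_def)
  from tendsto_add[OF lim0 this]
  show lim: "((\<lambda>s. cmod (\<gamma> s - \<gamma> t) / \<bar>s - t\<bar>) \<longlongrightarrow> cmod (\<gamma>' t)) (at t)" by simp
  have "m \<le> cmod (\<gamma>' t)"
  proof (rule tendsto_lowerbound[OF lim])
    show "eventually (\<lambda>s. m \<le> cmod (\<gamma> s - \<gamma> t) / \<bar>s - t\<bar>) (at t)"
      using ev by eventually_elim (use lower in \<open>simp add: field_simps\<close>)
  qed simp
  then show "cmod (\<gamma>' t) > 0" using m_pos by linarith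
qed

end

text \<open>The logarithmic singularities of two loops with the same parameter interval cancel, so the
  difference of the kernels is Lipschitz and its Fourier coefficients gain one order of decay.\<close>

lemma fourier_log_difference:
  assumes 1: "regular_loop \<gamma>1 \<gamma>1' m1 M1" and 2: "regular_loop \<gamma>2 \<gamma>2' m2 M2"
    and t: "0 < t" "t < 2 * pi" and S: "finite S"
  shows "(\<Sum>j\<in>S. (of_int j)\<^sup>2 * (cmod (\<integral>s. cis (of_int j * s) *
      of_real (ln (cmod (\<gamma>1 t - \<gamma>1 s)) - ln (cmod (\<gamma>2 t - \<gamma>2 s))) \<partial>per_measure))\<^sup>2)
    \<le> (2 * pi)\<^sup>2 * (M1 / m1 + M2 / m2)\<^sup>2"
proof -
  interpret L1: regular_loop \<gamma>1 \<gamma>1' m1 M1 by fact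
  interpret L2: regular_loop \<gamma>2 \<gamma>2' m2 M2 by fact
  define F where "F s = ln (cmod (\<gamma>1 s - \<gamma>1 t)) - ln (cmod (\<gamma>2 s - \<gamma>2 t))" for s
  define l where "l \<gamma> \<gamma>' s = inner (\<gamma> s - \<gamma> t) (\<gamma>' s) / (cmod (\<gamma> s - \<gamma> t))\<^sup>2" for \<gamma> \<gamma>' :: "real \<Rightarrow> complex" and s
  define F' where "F' s = l \<gamma>1 \<gamma>1' s - l \<gamma>2 \<gamma>2' s" for s
  \<comment> \<open>F with its removable singularity filled in. At s = t the function F itself takes
    the value ln 0 - ln 0 = 0, which need not be the limit.\<close>
  define G where "G s = (if s = t then ln (cmod (\<gamma>1' t)) - ln (cmod (\<gamma>2' t)) else F s)" for s
  define B where "B = M1 / m1 + M2 / m2"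
  have neq: "\<gamma>1 s \<noteq> \<gamma>1 t" "\<gamma>2 s \<noteq> \<gamma>2 t" if "s \<in> {0..2*pi}" "s \<noteq> t" for s
  proof -
    have gen: "\<gamma> s \<noteq> \<gamma> t" if "inj_on \<gamma> {0..<2*pi}" "\<gamma> (0 + 2 * pi) = \<gamma> 0" for \<gamma> :: "real \<Rightarrow> complex"
    proof
      assume eq: "\<gamma> s = \<gamma> t"
      show False
      proof (cases "s = 2 * pi")
        case True
        then have "\<gamma> 0 = \<gamma> t" using eq that(2) by simp
        then have "0 = t" using t by (intro inj_onD[OF that(1)]) auto
        then show False using t by simp
      next
        case False
        then have "s = t" using t \<open>s \<in> {0..2*pi}\<close> eq by (intro inj_onD[OF that(1)]) auto
        then show False using \<open>s \<noteq> t\<close> by simp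
      qed
    qed
    show "\<gamma>1 s \<noteq> \<gamma>1 t" "\<gamma>2 s \<noteq> \<gamma>2 t"
      by (intro gen L1.inj L1.periodic L2.inj L2.periodic)+
  qed
  have F'_bound: "\<bar>F' s\<bar> \<le> B" if s: "0 < s" "s < 2 * pi" for s
  proof (cases "s = t")
    case True
    \<comment> \<open>At s = t both quotients in F' are 0 / 0 = 0, so only the sign of the constants
      matters; any instance of \<open>log_deriv_bound\<close> shows it.\<close>
    have "0 \<le> M1 / m1" "0 \<le> M2 / m2"
      using L1.log_deriv_bound[of 0 1] L2.log_deriv_bound[of 0 1] pi_gt3 by fastforce+
    then show ?thesis using True by (simp add: F'_def l_def B_def)
  next
    case False
    obtain c where c: "c \<in> {0, 2 * pi, - 2 * pi}" "\<bar>s - t + c\<bar> \<le> pi" "\<And>s. \<gamma>1 (s + c) = \<gamma>1 s"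
      using s t by (elim L1.shift_cases[of s t, rotated 4]) auto
    have c2: "\<gamma>2 (s + c) = \<gamma>2 s" for s
      using c(1) L2.periodic[of s] L2.periodic'[of s] by auto
    \<comment> \<open>The shift is moved from s to t, so that only values of the curves, and not of
      their derivatives, have to be periodic.\<close>
    have tc: "\<gamma>1 (t - c) = \<gamma>1 t" "\<gamma>2 (t - c) = \<gamma>2 t"
      using c(3)[of "t - c"] c2[of "t - c"] by auto
    have ne: "s \<noteq> t - c" "\<bar>s - (t - c)\<bar> \<le> pi" using c(1,2) s t False by (auto simp: algebra_simps)
    have "\<bar>l \<gamma>1 \<gamma>1' s - 1 / (s - (t - c))\<bar> \<le> M1 / m1" "\<bar>l \<gamma>2 \<gamma>2' s - 1 / (s - (t - c))\<bar> \<le> M2 / m2"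
      using L1.log_deriv_bound[OF ne] L2.log_deriv_bound[OF ne] by (simp_all add: l_def tc)
    then show ?thesis unfolding F'_def B_def by linarith
  qed
  have Fderiv: "(F has_real_derivative F' s) (at s)" if "s \<in> {0..2*pi}" "s \<noteq> t" for s
    unfolding F_def F'_def l_def
    by (intro derivative_intros L1.log_deriv L2.log_deriv neq that)
  have Gderiv: "(G has_real_derivative F' s) (at s)" if "s \<in> {0<..<2*pi} - {t}" for s
  proof (rule has_field_derivative_transform_within_open[OF Fderiv])
    show "open (- {t})" by auto
  qed (use that in \<open>auto simp: G_def\<close>)
  have Gcont: "continuous_on {0..2*pi} G"
  proof (rule continuous_at_imp_continuous_on, rule ballI)
    fix s :: real assume s: "s \<in> {0..2*pi}"
    show "isCont G s"
    proof (cases "s = t")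
      case False
      have "isCont F s" by (rule DERIV_isCont[OF Fderiv[OF s False]])
      moreover have "eventually (\<lambda>x. F x = G x) (nhds s)"
        using False by (intro eventually_nhds_in_open[of "- {t}", THEN eventually_mono]) (auto simp: G_def)
      ultimately show ?thesis using isCont_cong by blast
    next
      case True
      have q: "((\<lambda>s. ln (cmod (\<gamma>1 s - \<gamma>1 t) / \<bar>s - t\<bar>) - ln (cmod (\<gamma>2 s - \<gamma>2 t) / \<bar>s - t\<bar>))
          \<longlongrightarrow> ln (cmod (\<gamma>1' t)) - ln (cmod (\<gamma>2' t))) (at t)"
        by (intro tendsto_intros L1.quotient_tendsto L2.quotient_tendsto)
           (use L1.quotient_tendsto(2)[of t] L2.quotient_tendsto(2)[of t] in auto)
      have "eventually (\<lambda>s. s \<in> {0<..<2*pi} \<and> s \<noteq> t) (at t)"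
        using t eventually_at_in_open[of "{0<..<2*pi}" t] by auto
      then have "eventually (\<lambda>s. ln (cmod (\<gamma>1 s - \<gamma>1 t) / \<bar>s - t\<bar>) - ln (cmod (\<gamma>2 s - \<gamma>2 t) / \<bar>s - t\<bar>) = G s) (at t)"
      proof eventually_elim
        case (elim s)
        then show ?case using neq[of s] by (simp add: G_def F_def ln_div)
      qed
      with q have "(G \<longlongrightarrow> ln (cmod (\<gamma>1' t)) - ln (cmod (\<gamma>2' t))) (at t)"
        by (rule Lim_transform_eventually)
      then show ?thesis unfolding True isCont_def by (simp add: G_def)
    qed
  qed
  note [measurable] = borel_measurable_continuous_onI[OF L1.cont'] borel_measurable_continuous_onI[OF L2.cont']
  have F'm: "F' \<in> borel_measurable per_measure"
    unfolding F'_def l_def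
    by (intro per_measurable_borel) measurable
  then have F'sq: "sq_integrable (\<lambda>s. of_real (F' s))"
    by (intro sq_integrable_bounded[of _ B]) (use F'_bound in auto)
  define h where "h = abs_l2 (\<lambda>s. of_real (F' s))"
  have rep_h: "AE s in per_measure. rep_l2 h s = of_real (F' s)"
    unfolding h_def by (rule rep_abs_l2[OF F'sq])
  have coef_h: "2 * pi * coef h (- j) = (\<integral>s. cis (of_int j * s) * of_real (F' s) \<partial>per_measure)" for j
  proof -
    have "2 * pi * coef h (- j) = (\<integral>s. of_real (F' s) * cnj (exp (\<i> * of_int (- j) * of_real s)) \<partial>per_measure)"
      unfolding cinner_trig_right[symmetric]
      by (rule cinner_AE[OF rep_h rep_trig])
         (use F'm in \<open>auto intro!: per_measurable_continuous continuous_intros\<close>)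
    also have "\<dots> = (\<integral>s. cis (of_int j * s) * of_real (F' s) \<partial>per_measure)"
      unfolding exp_int_eq_cis by (intro Bochner_Integration.integral_cong) (auto simp: cis_cnj)
    finally show ?thesis .
  qed
  have cism: "(\<lambda>s. cis (of_int j * s)) \<in> borel_measurable per_measure" for j
    by (rule sq_integrable_measurable[OF sq_integrable_cis])
  have cF'int: "integrable per_measure (\<lambda>s. cis (of_int j * s) * of_real (F' s))" for j
    by (rule per_integrable_bounded[of _ B])
       (use F'm cism F'_bound in \<open>auto simp: norm_mult intro!: borel_measurable_times\<close>)
  have cFint: "integrable per_measure (\<lambda>s. cis (of_int j * s) * of_real (F s))" for j
    unfolding F_def of_real_diff right_diff_distrib
    using L1.pot_integrable[OF sq_integrable_cis, of j "\<gamma>1 t"] L2.pot_integrable[OF sq_integrable_cis, of j "\<gamma>2 t"]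
    by (intro Bochner_Integration.integrable_diff) (simp_all add: norm_minus_commute)
  \<comment> \<open>Integration by parts with the exceptional point t; the boundary terms cancel
    because G and the exponential take equal values at 0 and 2 pi.\<close>
  have ibp: "\<i> * of_int j * (\<integral>s. cis (of_int j * s) * of_real (F s) \<partial>per_measure)
      = - (\<integral>s. cis (of_int j * s) * of_real (F' s) \<partial>per_measure)" for j
  proof -
    have d: "((\<lambda>s. cis (of_int j * s) * of_real (G s)) has_vector_derivative
        \<i> * of_int j * (cis (of_int j * s) * of_real (F s)) + cis (of_int j * s) * of_real (F' s)) (at s)"
      if "s \<in> {0<..<2*pi} - {t}" for s
    proof -
      have "((\<lambda>s. exp ((\<i> * of_int j) * of_real s) * of_real (G s)) has_vector_derivative
          exp ((\<i> * of_int j) * of_real s) * of_real (F' s) + (\<i> * of_int j) * exp ((\<i> * of_int j) * of_real s) * of_real (G s)) (at s)"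
        by (intro has_vector_derivative_mult has_vector_derivative_exp_linear has_vector_derivative_of_real
            Gderiv[OF that])
      then show ?thesis using that unfolding exp_int_eq_cis by (simp add: G_def algebra_simps)
    qed
    have "((\<lambda>s. \<i> * of_int j * (cis (of_int j * s) * of_real (F s)) + cis (of_int j * s) * of_real (F' s))
        has_integral cis (of_int j * (2 * pi)) * of_real (G (2 * pi)) - cis (of_int j * 0) * of_real (G 0)) {0..2*pi}"
      by (rule fundamental_theorem_of_calculus_interior_strong[of "{t}", OF _ _ d])
         (auto intro!: continuous_intros Gcont)
    moreover have "G (2 * pi) = G 0"
      using t L1.periodic[of 0] L2.periodic[of 0] by (simp add: G_def F_def)
    moreover have "cis (of_int j * (2 * pi)) = 1"
      using exp_integer_2pi[of "of_int j"] by (simp add: cis_conv_exp mult_ac)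
    ultimately have "integral {0..2*pi} (\<lambda>s. \<i> * of_int j * (cis (of_int j * s) * of_real (F s)) + cis (of_int j * s) * of_real (F' s)) = 0"
      by (simp add: integral_unique)
    moreover have "(\<integral>s. \<i> * of_int j * (cis (of_int j * s) * of_real (F s)) + cis (of_int j * s) * of_real (F' s) \<partial>per_measure)
      = \<i> * of_int j * (\<integral>s. cis (of_int j * s) * of_real (F s) \<partial>per_measure) + (\<integral>s. cis (of_int j * s) * of_real (F' s) \<partial>per_measure)"
      using cFint[of j] cF'int[of j] by (subst Bochner_Integration.integral_add) auto
    ultimately show ?thesis
      using per_integral_eq_integral[OF Bochner_Integration.integrable_add[OF integrable_mult_right[OF cFint[of j], of "\<i> * of_int j"] cF'int[of j]]]
      by (simp add: eq_neg_iff_add_eq_0)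
  qed
  have term_eq: "(of_int j)\<^sup>2 * (cmod (\<integral>s. cis (of_int j * s) *
      of_real (ln (cmod (\<gamma>1 t - \<gamma>1 s)) - ln (cmod (\<gamma>2 t - \<gamma>2 s))) \<partial>per_measure))\<^sup>2
      = (2 * pi)\<^sup>2 * (cmod (coef h (- j)))\<^sup>2" for j
  proof -
    have "cmod (\<i> * of_int j * (\<integral>s. cis (of_int j * s) * of_real (F s) \<partial>per_measure)) = cmod (2 * pi * coef h (- j))"
      unfolding ibp coef_h by simp
    then have "(\<bar>of_int j\<bar> * cmod (\<integral>s. cis (of_int j * s) * of_real (F s) \<partial>per_measure))\<^sup>2 = (2 * pi * cmod (coef h (- j)))\<^sup>2"
      by (simp add: norm_mult)
    then show ?thesis by (simp add: power_mult_distrib F_def norm_minus_commute)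
  qed
  \<comment> \<open>Bessel's inequality for the bounded function F'. The index set is reflected
    because integrating against exp(ijs) produces the coefficient with index -j.\<close>
  have "(\<Sum>j\<in>S. (2 * pi)\<^sup>2 * (cmod (coef h (- j)))\<^sup>2) = (2 * pi)\<^sup>2 * (\<Sum>j\<in>uminus ` S. (cmod (coef h j))\<^sup>2)"
    by (simp add: sum.reindex sum_distrib_left)
  also have "\<dots> \<le> 2 * pi * (norm h)\<^sup>2"
    using mult_left_mono[OF bessel[of "uminus ` S" h], of "2 * pi"] S by (simp add: power2_eq_square mult.assoc)
  also have "(norm h)\<^sup>2 = (\<integral>s. (cmod (of_real (F' s)))\<^sup>2 \<partial>per_measure)"
    by (rule norm_square_AE[OF rep_h]) (use F'm in auto)
  also have "\<dots> \<le> (\<integral>s. B\<^sup>2 \<partial>per_measure)"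
    by (rule integral_mono)
       (use F'sq F'_bound abs_le_square_iff[of "F' _" B] in \<open>force simp: sq_integrable_def\<close>)+
  also have "2 * pi * \<dots> = (2 * pi)\<^sup>2 * B\<^sup>2"
    by (simp add: measure_restrict_space power2_eq_square)
  finally show ?thesis unfolding term_eq B_def by simp
qed


text \<open>The reciprocals are the eigenvalues of Symm's operator on the circle of radius
  exp(-1/2), the maximum accounting for the constants. Square sums of coefficients with this weight
  are equivalent to the squared H^1 norm.\<close>

definition weight :: "int \<Rightarrow> real" where "weight j = max 1 \<bar>of_int j\<bar>"

lemma weight_ge_1: "weight j \<ge> 1"
  by (simp add: weight_def)

lemma weight_pos: "weight j > 0"
  using weight_ge_1[of j] by linarith

text \<open>The sum over j is bounded at each fixed t and integrated afterwards, as for the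
  Hilbert-Schmidt norm of a kernel. The comparison curve may be the unit circle: changing the radius
  adds a constant to the kernel, which the modes j \<noteq> 0 do not see.\<close>

lemma (in regular_loop) symm_op_trig_smoothing:
  obtains B where "\<And>n. (\<Sum>j\<in>{- int n..int n}. (weight j)\<^sup>2 *
      (norm (symm_op \<gamma> (trig j) - cscale (of_real (1 / weight j)) (trig j)))\<^sup>2) \<le> B"
proof -
  obtain m2 M2 where C: "regular_loop cis (\<lambda>s. \<i> * cis s) m2 M2" by (rule cis_loop)
  interpret C: regular_loop cis "\<lambda>s. \<i> * cis s" m2 M2 by (rule C)
  obtain R where R: "\<And>s. cmod (\<gamma> s) \<le> R" using bounded by blast
  obtain C0 where C0': "C0 \<ge> 0" "\<forall>f x. sq_integrable f \<longrightarrow> cmod x \<le> R \<longrightarrow>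
    (\<integral>s. norm (f s * of_real (ln (cmod (x - \<gamma> s)))) \<partial>per_measure) \<le> (\<integral>s. (cmod (f s))\<^sup>2 \<partial>per_measure) + C0"
    using pot_bound[of R] by blast
  note C0 = C0'(1) C0'(2)[rule_format]
  define u where "u j t = - (1 / of_real pi) * pot (\<lambda>s. cis (of_int j * s)) (\<gamma> t)
      - of_real (1 / weight j) * cis (of_int j * t)" for j t
  have rep_u: "AE t in per_measure. rep_l2 (symm_op \<gamma> (trig j) - cscale (of_real (1 / weight j)) (trig j)) t = u j t" for j
  proof -
    have "AE t in per_measure. rep_l2 (symm_op \<gamma> (trig j)) t = - (1 / of_real pi) * pot (\<lambda>s. cis (of_int j * s)) (\<gamma> t)"
      by (rule rep_symm_op_AE[OF _ sq_integrable_cis]) (use rep_trig[of j] in \<open>simp only: exp_int_eq_cis\<close>)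
    with rep_diff[of "symm_op \<gamma> (trig j)" "cscale (of_real (1 / weight j)) (trig j)"]
      rep_cscale[of "of_real (1 / weight j)" "trig j"] rep_trig[of j]
    show ?thesis by eventually_elim (simp add: u_def exp_int_eq_cis)
  qed
  have u_sq: "sq_integrable (u j)" for j
    unfolding u_def[abs_def] diff_conv_add_uminus mult_minus_left[symmetric] of_real_minus[symmetric]
    by (intro sq_integrable_add sq_integrable_cmult sq_integrable_pot_loop sq_integrable_cis)
  have u_int: "integrable per_measure (\<lambda>t. (cmod (u j t))\<^sup>2)" for j
    using u_sq[of j] by (simp add: sq_integrable_def)
  have norm_u: "(norm (symm_op \<gamma> (trig j) - cscale (of_real (1 / weight j)) (trig j)))\<^sup>2 = (\<integral>t. (cmod (u j t))\<^sup>2 \<partial>per_measure)" for j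
    by (rule norm_square_AE[OF rep_u sq_integrable_measurable[OF u_sq]])
  \<comment> \<open>On the unit circle the constants have eigenvalue 0 rather than 1, so the mode j
    = 0 is bounded separately.\<close>
  define D where "D = 1 / pi * (2 * pi + C0) + 1"
  have u0: "cmod (u 0 t) \<le> D" for t
  proof -
    have "cmod (pot (\<lambda>s. 1) (\<gamma> t)) \<le> (\<integral>s. norm (1 * complex_of_real (ln (cmod (\<gamma> t - \<gamma> s)))) \<partial>per_measure)"
      unfolding pot_def by (rule integral_norm_bound)
    also have "\<dots> \<le> 2 * pi + C0"
      using C0(2)[OF sq_integrable_const[of 1] R[of t]] by (simp add: measure_restrict_space)
    finally have *: "cmod (pot (\<lambda>s. 1) (\<gamma> t)) \<le> 2 * pi + C0" .
    have "cmod (u 0 t) \<le> cmod (- (1 / of_real pi) * pot (\<lambda>s. 1) (\<gamma> t)) + cmod 1"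
      using norm_triangle_ineq4[of "- (1 / of_real pi) * pot (\<lambda>s. 1) (\<gamma> t)" 1] by (simp add: u_def weight_def)
    also have "\<dots> = 1 / pi * cmod (pot (\<lambda>s. 1) (\<gamma> t)) + 1" by (simp add: norm_mult norm_divide)
    also have "\<dots> \<le> D" unfolding D_def using * by (intro add_mono mult_left_mono) auto
    finally show ?thesis .
  qed
  have u_nz: "(weight j)\<^sup>2 * (cmod (u j t))\<^sup>2 = (1 / pi)\<^sup>2 * ((of_int j)\<^sup>2 * (cmod (\<integral>s. cis (of_int j * s) *
      of_real (ln (cmod (\<gamma> t - \<gamma> s)) - ln (cmod (cis t - cis s))) \<partial>per_measure))\<^sup>2)" if j: "j \<noteq> 0" for j t
  proof -
    have w: "weight j = \<bar>of_int j\<bar>" using j by (auto simp: weight_def)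
    have "(\<integral>s. cis (of_int j * s) * of_real (ln (cmod (\<gamma> t - \<gamma> s)) - ln (cmod (cis t - cis s))) \<partial>per_measure)
        = pot (\<lambda>s. cis (of_int j * s)) (\<gamma> t) - C.pot (\<lambda>s. cis (of_int j * s)) (cis t)"
      unfolding pot_def C.pot_def of_real_diff right_diff_distrib
      by (intro Bochner_Integration.integral_diff pot_integrable C.pot_integrable sq_integrable_cis)
    also have "\<dots> = - of_real pi * u j t"
      unfolding pot_cis_on_circle using j by (simp add: u_def w field_simps)
    finally have "cmod (\<integral>s. cis (of_int j * s) * of_real (ln (cmod (\<gamma> t - \<gamma> s)) - ln (cmod (cis t - cis s))) \<partial>per_measure)
      = pi * cmod (u j t)" by (simp add: norm_mult)
    then show ?thesis by (simp add: w power_mult_distrib power_divide)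
  qed
  define B where "B = D\<^sup>2 + (1 / pi)\<^sup>2 * ((2 * pi)\<^sup>2 * (M / m + M2 / m2)\<^sup>2)"
  have sum_bound: "(\<Sum>j\<in>{- int n..int n}. (weight j)\<^sup>2 * (cmod (u j t))\<^sup>2) \<le> B" if t: "0 < t" "t < 2 * pi" for n t
  proof -
    have split: "{- int n..int n} = insert 0 ({- int n..int n} - {0})" by auto
    have "(\<Sum>j\<in>{- int n..int n}. (weight j)\<^sup>2 * (cmod (u j t))\<^sup>2)
      = (weight 0)\<^sup>2 * (cmod (u 0 t))\<^sup>2 + (\<Sum>j\<in>{- int n..int n} - {0}. (weight j)\<^sup>2 * (cmod (u j t))\<^sup>2)"
      by (subst split, subst sum.insert) auto
    also have "(\<Sum>j\<in>{- int n..int n} - {0}. (weight j)\<^sup>2 * (cmod (u j t))\<^sup>2)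
      = (1 / pi)\<^sup>2 * (\<Sum>j\<in>{- int n..int n} - {0}. ((of_int j)\<^sup>2 * (cmod (\<integral>s. cis (of_int j * s) *
      of_real (ln (cmod (\<gamma> t - \<gamma> s)) - ln (cmod (cis t - cis s))) \<partial>per_measure))\<^sup>2))"
      unfolding sum_distrib_left by (intro sum.cong refl u_nz) auto
    also have "\<dots> \<le> (1 / pi)\<^sup>2 * ((2 * pi)\<^sup>2 * (M / m + M2 / m2)\<^sup>2)"
      by (intro mult_left_mono fourier_log_difference[OF regular_loop_axioms C t]) auto
    also have "(weight 0)\<^sup>2 * (cmod (u 0 t))\<^sup>2 \<le> D\<^sup>2"
      using u0[of t] by (simp add: weight_def power_mono)
    finally show ?thesis unfolding B_def by simp
  qed
  have "(\<Sum>j\<in>{- int n..int n}. (weight j)\<^sup>2 *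
      (norm (symm_op \<gamma> (trig j) - cscale (of_real (1 / weight j)) (trig j)))\<^sup>2) \<le> 2 * pi * B" for n
  proof -
    have "(\<Sum>j\<in>{- int n..int n}. (weight j)\<^sup>2 *
      (norm (symm_op \<gamma> (trig j) - cscale (of_real (1 / weight j)) (trig j)))\<^sup>2)
      = (\<integral>t. (\<Sum>j\<in>{- int n..int n}. (weight j)\<^sup>2 * (cmod (u j t))\<^sup>2) \<partial>per_measure)"
      unfolding norm_u using u_int by (subst Bochner_Integration.integral_sum) auto
    also have "\<dots> \<le> (\<integral>t. B \<partial>per_measure)"
      by (rule integral_mono) (use u_int sum_bound in auto)
    also have "\<dots> = 2 * pi * B" by (simp add: measure_restrict_space)
    finally show ?thesis .
  qed
  then show ?thesis by (rule that)
qed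

section \<open>Injectivity\<close>

lemma continuous_AE_zero:
  fixes h :: "real \<Rightarrow> complex"
  assumes h: "continuous_on UNIV h" and ae: "AE t in per_measure. h t = 0"
    and t: "t \<in> {0..2 * pi}"
  shows "h t = 0"
proof -
  define U where "U = {t. h t \<noteq> 0} \<inter> {0<..<2 * pi}"
  have "open U"
    unfolding U_def by (intro open_Int open_Collect_neq h continuous_on_const) auto
  have "AE t in lborel. t \<notin> U"
    using ae unfolding U_def by (subst (asm) AE_restrict_space_iff) (auto elim!: eventually_mono)
  then have "emeasure lborel U = 0"
    using \<open>open U\<close> by (subst (asm) AE_iff_measurable[of U]) auto
  then have "U \<in> null_sets lborel" using \<open>open U\<close> by auto
  then have "negligible U" by (simp add: negligible_iff_null_sets null_sets_completionI)
  then have "U = {}" using open_not_negligible[OF \<open>open U\<close>] by blast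
  then have z: "h s = 0" if "s \<in> {0<..<2 * pi}" for s using that by (auto simp: U_def)
  have cl: "closure {0<..<2 * pi} = {0..2 * pi}" by (rule closure_greaterThanLessThan) simp
  have "t \<in> closure {0<..<2 * pi}" using t cl by simp
  then show ?thesis
    using continuous_constant_on_closure[OF continuous_on_subset[OF h subset_UNIV] z] by blast
qed

text \<open>The argument uses circle means alone. Adding e |y|^2 makes the mean over a circle
  strictly exceed the value at its center, so the maximum over the closure cannot be attained
  inside.\<close>

lemma maximum_principle:
  fixes v :: "complex \<Rightarrow> real"
  assumes \<Omega>: "open \<Omega>" "bounded \<Omega>" and v: "continuous_on UNIV v"
    and bdry: "\<And>x. x \<in> frontier \<Omega> \<Longrightarrow> v x \<le> 0"
    and mean: "\<And>x r. 0 < r \<Longrightarrow> cball x r \<subseteq> \<Omega> \<Longrightarrow>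
      (\<integral>s. v (x + of_real r * cis s) \<partial>per_measure) = 2 * pi * v x"
    and x: "x \<in> \<Omega>"
  shows "v x \<le> 0"
proof (rule ccontr)
  assume "\<not> v x \<le> 0"
  then have vx: "v x > 0" by simp
  obtain R where R: "\<And>y. y \<in> closure \<Omega> \<Longrightarrow> cmod y \<le> R"
    using \<Omega>(2) bounded_closure by (meson bounded_iff)
  \<comment> \<open>Chosen so that e R^2 < v x: the perturbation cannot lift the boundary values to
    the level of v x. The added 1 covers R = 0.\<close>
  define e where "e = v x / (2 * (R\<^sup>2 + 1))"
  have e: "e > 0" using vx by (auto simp: e_def intro!: divide_pos_pos add_nonneg_pos)
  have eR: "e * R\<^sup>2 < v x"
  proof -
    have "e * R\<^sup>2 \<le> e * (R\<^sup>2 + 1)" using e by (intro mult_left_mono) auto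
    also have "\<dots> = v x / 2"
    proof -
      have "R\<^sup>2 + 1 \<noteq> 0" by (metis add_nonneg_pos less_numeral_extra(1,3) zero_le_power2)
      then show ?thesis by (simp add: e_def field_simps)
    qed
    also have "\<dots> < v x" using vx by simp
    finally show ?thesis .
  qed
  define w where "w y = v y + e * (cmod y)\<^sup>2" for y
  have wc: "continuous_on UNIV w" unfolding w_def by (intro continuous_intros v)
  have "compact (closure \<Omega>)" using \<Omega>(2) by simp
  moreover have "closure \<Omega> \<noteq> {}" using x by auto
  ultimately obtain p where p: "p \<in> closure \<Omega>" "\<And>y. y \<in> closure \<Omega> \<Longrightarrow> w y \<le> w p"
    using continuous_attains_sup[of "closure \<Omega>" w] continuous_on_subset[OF wc] by blast
  have "v x \<le> w x" using e by (simp add: w_def)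
  also have "w x \<le> w p" using p(2) x closure_subset by blast
  finally have wp: "v x \<le> w p" .
  have "p \<in> \<Omega>"
  proof (rule ccontr)
    assume "p \<notin> \<Omega>"
    then have "p \<in> frontier \<Omega>" using p(1) \<Omega>(1) by (simp add: frontier_def interior_open)
    then have "w p \<le> e * (cmod p)\<^sup>2" using bdry by (simp add: w_def)
    also have "\<dots> \<le> e * R\<^sup>2" using R[OF p(1)] e by (intro mult_left_mono power_mono) auto
    finally show False using eR wp by simp
  qed
  then obtain r where r: "r > 0" "cball p r \<subseteq> \<Omega>" using \<Omega>(1) open_contains_cball by blast
  define c where "c s = p + of_real r * cis s" for s
  have c: "c s \<in> closure \<Omega>" for s
  proof -
    have "c s \<in> cball p r" using r(1) by (simp add: c_def dist_norm norm_mult)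
    then show ?thesis using r(2) closure_subset by blast
  qed
  have cc: "continuous_on UNIV c" unfolding c_def by (intro continuous_intros)
  have bnd: "integrable per_measure (\<lambda>s. g (c s))" if g: "continuous_on UNIV g" for g :: "complex \<Rightarrow> real"
  proof -
    have "compact (g ` closure \<Omega>)"
      using \<Omega>(2) by (intro compact_continuous_image continuous_on_subset[OF g]) auto
    then obtain B where "\<And>y. y \<in> closure \<Omega> \<Longrightarrow> norm (g y) \<le> B"
      by (meson bounded_iff compact_imp_bounded imageI)
    then show ?thesis
      by (intro per_integrable_bounded[of _ B] per_measurable_continuous continuous_on_compose2[OF g cc])
         (use c in auto)
  qed
  have sq: "(cmod (c s))\<^sup>2 = ((cmod p)\<^sup>2 + r\<^sup>2) + 2 * r * Re (cnj p * cis s)" for s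
  proof -
    have "cmod (of_real r * cis s) = r" using r(1) by (simp add: norm_mult)
    then show ?thesis
      using power2_norm_eq_inner[of "p + of_real r * cis s"] power2_norm_eq_inner[of p] power2_norm_eq_inner[of "of_real r * cis s"]
      by (simp add: c_def inner_add_left inner_add_right inner_commute power2_eq_square) (simp add: inner_complex_def algebra_simps)
  qed
  have cis1: "integrable per_measure cis" "(\<integral>s. cis s \<partial>per_measure) = 0"
    using sq_integrable_imp_integrable[OF sq_integrable_cis[of 1]] integral_cis[of 1] by simp_all
  have "(\<integral>s. Re (cnj p * cis s) \<partial>per_measure) = Re (\<integral>s. cnj p * cis s \<partial>per_measure)"
    using cis1 by (intro integral_Re) auto
  then have "(\<integral>s. Re (cnj p * cis s) \<partial>per_measure) = 0" using cis1 by simp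
  then have isq: "(\<integral>s. (cmod (c s))\<^sup>2 \<partial>per_measure) = 2 * pi * ((cmod p)\<^sup>2 + r\<^sup>2)"
    unfolding sq using cis1 integrable_Re[OF integrable_mult_right[OF cis1(1), of "cnj p"]]
    by (subst Bochner_Integration.integral_add) (auto simp: measure_restrict_space)
  have ci: "continuous_on UNIV (\<lambda>z :: complex. e * (cmod z)\<^sup>2)" by (intro continuous_intros)
  have "2 * pi * v p + e * (2 * pi * ((cmod p)\<^sup>2 + r\<^sup>2)) = (\<integral>s. w (c s) \<partial>per_measure)"
    unfolding w_def
    by (subst Bochner_Integration.integral_add[OF bnd[OF v] bnd[OF ci]])
       (use mean[OF r] isq in \<open>simp add: c_def\<close>)
  also have "\<dots> \<le> (\<integral>s. w p \<partial>per_measure)"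
    by (rule integral_mono) (use bnd[OF wc] p(2) c in auto)
  also have "\<dots> = 2 * pi * (v p + e * (cmod p)\<^sup>2)" by (simp add: measure_restrict_space w_def)
  finally have "e * (2 * pi * r\<^sup>2) \<le> 0" by (simp add: algebra_simps)
  moreover have "e * (2 * pi * r\<^sup>2) > 0" using e r(1) by simp
  ultimately show False by simp
qed

lemma circle_loop:
  assumes "r > 0"
  obtains m M where "regular_loop (\<lambda>s. z + of_real r * cis s) (\<lambda>s. of_real r * (\<i> * cis s)) m M"
proof -
  obtain m M where "regular_loop cis (\<lambda>s. \<i> * cis s) m M" by (rule cis_loop)
  from regular_loop_affine[OF this assms] show ?thesis by (rule that)
qed

text \<open>The pairs (b, s) form two copies of the parameter interval. A density on the curve and
  one on the auxiliary circle become a single density on this space.\<close>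

lemma
  fixes h :: "bool \<times> real \<Rightarrow> 'b :: {banach, second_countable_topology}"
  assumes h: "\<And>b. integrable per_measure (\<lambda>s. h (b, s))"
  shows integrable_two_copies: "integrable (count_space UNIV \<Otimes>\<^sub>M per_measure) h"
    and integral_two_copies: "(\<integral>z. h z \<partial>(count_space UNIV \<Otimes>\<^sub>M per_measure)) = (\<integral>s. h (True, s) \<partial>per_measure) + (\<integral>s. h (False, s) \<partial>per_measure)"
proof -
  interpret C: sigma_finite_measure "count_space (UNIV :: bool set)"
    by (rule sigma_finite_measure_count_space_finite) simp
  interpret P: pair_sigma_finite "count_space (UNIV :: bool set)" per_measure ..
  have m: "h \<in> borel_measurable (count_space UNIV \<Otimes>\<^sub>M per_measure)"
    by (rule measurable_pair_measure_countable1) (use h in auto)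
  show *: "integrable (count_space UNIV \<Otimes>\<^sub>M per_measure) h"
    by (rule P.Fubini_integrable[OF m]) (use h in \<open>auto intro!: integrable_count_space\<close>)
  show "(\<integral>z. h z \<partial>(count_space UNIV \<Otimes>\<^sub>M per_measure)) = (\<integral>s. h (True, s) \<partial>per_measure) + (\<integral>s. h (False, s) \<partial>per_measure)"
    using P.integral_fst'[OF *] by (simp add: lebesgue_integral_count_space_finite UNIV_bool add.commute)
qed

context regular_loop
begin

text \<open>Discs contained in \<Omega> avoid the curve, so \<open>pot_fubini\<close> and
  \<open>integral_ln_circle\<close> give the mean value property inside, and the maximum principle
  applies.\<close>

lemma pot_zero_inside:
  assumes \<Omega>: "open \<Omega>" "bounded \<Omega>" and fr: "\<gamma> ` {0..2 * pi} = frontier \<Omega>"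
    and f: "sq_integrable f" and z: "\<And>t. t \<in> {0..2 * pi} \<Longrightarrow> pot f (\<gamma> t) = 0" and x: "x \<in> \<Omega>"
  shows "pot f x = 0"
proof -
  have mean: "(\<integral>s. pot f (x + of_real r * cis s) \<partial>per_measure) = 2 * pi * pot f x"
    and mean_int: "integrable per_measure (\<lambda>s. pot f (x + of_real r * cis s))"
    if r: "0 < r" and sub: "cball x r \<subseteq> \<Omega>" for x r
  proof -
    obtain m' M' where c: "regular_loop (\<lambda>s. x + of_real r * cis s) (\<lambda>s. of_real r * (\<i> * cis s)) m' M'"
      using circle_loop[OF r] by blast
    interpret c: regular_loop "\<lambda>s. x + of_real r * cis s" "\<lambda>s. of_real r * (\<i> * cis s)" m' M' by (rule c)
    obtain R where "\<And>s. cmod (x + of_real r * cis s) \<le> R" using c.bounded by blast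
    then show "integrable per_measure (\<lambda>s. pot f (x + of_real r * cis s))"
      by (intro sq_integrable_imp_integrable sq_integrable_pot[OF f c.cont])
    have "(\<integral>s. pot f (x + of_real r * cis s) \<partial>per_measure) = (\<integral>s. 1 * pot f (x + of_real r * cis s) \<partial>per_measure)"
      by simp
    also have "\<dots> = (\<integral>s. f s * c.pot (\<lambda>s. 1) (\<gamma> s) \<partial>per_measure)"
      by (rule pot_fubini[OF regular_loop_axioms c f sq_integrable_const])
    also have "\<dots> = (\<integral>s. 2 * pi * (f s * of_real (ln (cmod (x - \<gamma> s)))) \<partial>per_measure)"
    proof (rule Bochner_Integration.integral_cong[OF refl])
      fix s assume "s \<in> space per_measure"
      then have "\<gamma> s \<in> frontier \<Omega>" using fr by auto
      then have "\<gamma> s \<notin> cball x r" using sub \<Omega>(1) by (auto simp: frontier_def interior_open)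
      then have "max (cmod (\<gamma> s - x)) r = cmod (x - \<gamma> s)"
        by (simp add: dist_norm norm_minus_commute max_def)
      then show "f s * c.pot (\<lambda>s. 1) (\<gamma> s) = 2 * pi * (f s * of_real (ln (cmod (x - \<gamma> s))))"
        using integral_ln_circle[OF r, of "\<gamma> s" x] by (simp add: c.pot_def)
    qed
    also have "\<dots> = 2 * pi * pot f x" by (simp add: pot_def)
    finally show "(\<integral>s. pot f (x + of_real r * cis s) \<partial>per_measure) = 2 * pi * pot f x" .
  qed
  \<comment> \<open>The potential is complex-valued, so the principle is applied to all rotated real
    parts; c = \<open>cnj (pot f x)\<close> then gives |pot f x|^2 \<le> 0.\<close>
  have "Re (c * pot f x) \<le> 0" for c
  proof (rule maximum_principle[OF \<Omega> _ _ _ x])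
    show "continuous_on UNIV (\<lambda>x. Re (c * pot f x))"
      by (intro continuous_intros continuous_pot[OF f])
    show "Re (c * pot f y) \<le> 0" if "y \<in> frontier \<Omega>" for y
      using that z unfolding fr[symmetric] by auto
    show "(\<integral>s. Re (c * pot f (y + of_real r * cis s)) \<partial>per_measure) = 2 * pi * Re (c * pot f y)"
      if r: "0 < r" "cball y r \<subseteq> \<Omega>" for y r
    proof -
      have "(\<integral>s. Re (c * pot f (y + of_real r * cis s)) \<partial>per_measure) = Re (\<integral>s. c * pot f (y + of_real r * cis s) \<partial>per_measure)"
        using mean_int[OF r] by (intro integral_Re) auto
      also have "\<dots> = Re (c * (2 * pi * pot f y))" using mean[OF r] by simp
      finally show ?thesis by (simp add: algebra_simps)
    qed
  qed
  from this[of "cnj (pot f x)"] have "(cmod (pot f x))\<^sup>2 \<le> 0"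
    by (metis Re_complex_of_real complex_norm_square mult.commute)
  then show ?thesis by simp
qed

text \<open>If the density \<open>F\<close> with total mass \<open>\<mu>\<close> is annihilated by the operator, then the neutral charge
  consisting of \<open>F\<close> on the curve and of \<open>-\<mu>\<close> spread uniformly over the unit circle around \<open>z\<^sub>0\<close> has zero
  logarithmic energy. The hypothesis on \<open>z\<^sub>0\<close> says that this circle misses the curve.\<close>

lemma symm_op_injective:
  assumes \<Omega>: "open \<Omega>" "bounded \<Omega>" and fr: "\<gamma> ` {0..2 * pi} = frontier \<Omega>"
    and z0: "z0 \<in> \<Omega>" "\<And>x. x \<in> frontier \<Omega> \<Longrightarrow> cmod (x - z0) \<noteq> 1"
    and K0: "symm_op \<gamma> F = 0"
  shows "F = 0"
proof -
  define f where "f = rep_l2 F"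
  have f: "sq_integrable f" unfolding f_def by (rule sq_integrable_rep)
  have fint: "integrable per_measure f" by (rule sq_integrable_imp_integrable[OF f])
  note [measurable] = f[THEN sq_integrable_measurable]
  have zero: "AE t in per_measure. rep_l2 (0 :: l2) t = 0"
    unfolding zero_l2_def by (rule rep_abs_l2[OF sq_integrable_const])
  have pot0: "pot f (\<gamma> t) = 0" if "t \<in> {0..2 * pi}" for t
  proof (rule continuous_AE_zero[OF _ _ that])
    show "continuous_on UNIV (\<lambda>t. pot f (\<gamma> t))"
      by (rule continuous_on_compose2[OF continuous_pot[OF f] cont]) auto
    show "AE t in per_measure. pot f (\<gamma> t) = 0"
      using rep_symm_op[of F] zero unfolding K0 f_def[symmetric] by eventually_elim simp
  qed
  \<comment> \<open>Up to the factor 2 pi, the pairing of f with the potential of the uniformly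
    charged unit circle. Both cross terms of the energy are governed by A.\<close>
  define A where "A = (\<integral>s. f s * of_real (ln (max (cmod (\<gamma> s - z0)) 1)) \<partial>per_measure)"
  have fr': "\<gamma> s \<in> frontier \<Omega>" if "s \<in> {0..2 * pi}" for s using fr that by auto
  have A0: "A = 0"
  proof -
    \<comment> \<open>By connectedness the curve lies on one side of the unit circle. Inside it, the
      potential of the circle is 0 on the curve; outside it, A is the potential of f at z0.\<close>
    have "connected ((\<lambda>s. cmod (\<gamma> s - z0)) ` {0..2*pi})"
      by (intro connected_continuous_image continuous_intros continuous_on_subset[OF cont]) auto
    moreover have "1 \<notin> (\<lambda>s. cmod (\<gamma> s - z0)) ` {0..2*pi}" using z0(2) fr' by fastforce
    ultimately have "\<not> (cmod (\<gamma> s - z0) \<le> 1 \<and> 1 \<le> cmod (\<gamma> t - z0))"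
      if "s \<in> {0..2*pi}" "t \<in> {0..2*pi}" for s t
      using connectedD_interval that by blast
    then have "(\<forall>s\<in>{0..2*pi}. cmod (\<gamma> s - z0) < 1) \<or> (\<forall>s\<in>{0..2*pi}. cmod (\<gamma> s - z0) > 1)"
      by (meson not_le)
    then show ?thesis
    proof
      assume *: "\<forall>s\<in>{0..2*pi}. cmod (\<gamma> s - z0) < 1"
      have "max (cmod (\<gamma> s - z0)) 1 = 1" if "0 < s" "s < 2 * pi" for s
        using bspec[OF *, of s] that by simp
      then have "A = (\<integral>s. 0 \<partial>per_measure)"
        unfolding A_def by (intro Bochner_Integration.integral_cong) auto
      then show ?thesis by simp
    next
      assume *: "\<forall>s\<in>{0..2*pi}. cmod (\<gamma> s - z0) > 1"
      have "max (cmod (\<gamma> s - z0)) 1 = cmod (z0 - \<gamma> s)" if "0 < s" "s < 2 * pi" for s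
        using bspec[OF *, of s] that by (simp add: norm_minus_commute)
      then have "A = pot f z0"
        unfolding A_def pot_def by (intro Bochner_Integration.integral_cong) auto
      then show ?thesis using pot_zero_inside[OF \<Omega> fr f pot0 z0(1)] by simp
    qed
  qed
  define c where "c s = z0 + of_real 1 * cis s" for s
  define c' where "c' s = of_real 1 * (\<i> * cis s)" for s
  obtain m' M' where cl: "regular_loop c c' m' M'"
    using circle_loop[of 1 z0] unfolding c_def[abs_def] c'_def[abs_def] by auto
  interpret c: regular_loop c c' m' M' by (rule cl)
  have cpot: "c.pot (\<lambda>s. q) z = q * (2 * pi * ln (max (cmod (z - z0)) 1))" for z q
    using integral_ln_circle[of 1 z z0] c.pot_cmult[of q "\<lambda>s. 1" z] by (simp add: c.pot_def c_def)
  have cdist: "cmod (c s - z0) = 1" for s by (simp add: c_def)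
  define \<mu> where "\<mu> = (\<integral>s. f s \<partial>per_measure)"
  \<comment> \<open>The constant density on the circle with total mass -\<mu>.\<close>
  define q where "q = - \<mu> / (2 * pi)"
  define N where "N = count_space (UNIV :: bool set) \<Otimes>\<^sub>M per_measure"
  define \<phi> where "\<phi> x = (if fst x then f (snd x) else q)" for x :: "bool \<times> real"
  define p where "p x = (if fst x then \<gamma> (snd x) else c (snd x))" for x :: "bool \<times> real"
  interpret C: sigma_finite_measure "count_space (UNIV :: bool set)"
    by (rule sigma_finite_measure_count_space_finite) simp
  interpret P: pair_sigma_finite "count_space (UNIV :: bool set)" per_measure ..
  interpret N: sigma_finite_measure N unfolding N_def ..
  have Nint: "integrable N h"
    and Nval: "(\<integral>z. h z \<partial>N) = (\<integral>s. h (True, s) \<partial>per_measure) + (\<integral>s. h (False, s) \<partial>per_measure)"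
    if "\<And>b. integrable per_measure (\<lambda>s. h (b, s))" for h :: "bool \<times> real \<Rightarrow> complex"
    unfolding N_def by (rule integrable_two_copies[OF that], rule integral_two_copies[OF that])
  have NvalR: "(\<integral>z. h z \<partial>N) = (\<integral>s. h (True, s) \<partial>per_measure) + (\<integral>s. h (False, s) \<partial>per_measure)"
    if "\<And>b. integrable per_measure (\<lambda>s. h (b, s))" for h :: "bool \<times> real \<Rightarrow> real"
    unfolding N_def by (rule integral_two_copies[OF that])
  have \<phi>i: "integrable per_measure (\<lambda>s. \<phi> (b, s))" for b using fint by (cases b) (auto simp: \<phi>_def)
  have pm [measurable]: "p \<in> borel_measurable N"
    unfolding N_def
  proof (rule measurable_pair_measure_countable1)
    show "(\<lambda>y. p (b, y)) \<in> borel_measurable per_measure" for b by (cases b) (simp_all add: p_def)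
  qed auto
  obtain R1 where R1: "\<And>s. cmod (\<gamma> s) \<le> R1" using bounded by blast
  obtain R2 where R2: "\<And>s. cmod (c s) \<le> R2" using c.bounded by blast
  define R where "R = max R1 R2"
  have pR: "cmod (p x) \<le> R" for x
    using R1[of "snd x"] R2[of "snd x"] by (auto simp: p_def R_def le_max_iff_disj)
  have li: "integrable per_measure (\<lambda>s. \<phi> (b, s) * of_real (ln (cmod (z - p (b, s)))))" for b z
    using pot_integrable[OF f, of z] c.pot_integrable[OF sq_integrable_const[of q], of z]
    by (cases b) (auto simp: \<phi>_def p_def)
  obtain C1 where C1': "C1 \<ge> 0" "\<forall>f x. sq_integrable f \<longrightarrow> cmod x \<le> R \<longrightarrow>
    (\<integral>s. norm (f s * of_real (ln (cmod (x - \<gamma> s)))) \<partial>per_measure) \<le> (\<integral>s. (cmod (f s))\<^sup>2 \<partial>per_measure) + C1"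
    using pot_bound[of R] by blast
  note C1 = C1'(2)[rule_format]
  obtain C2 where C2': "C2 \<ge> 0" "\<forall>f x. sq_integrable f \<longrightarrow> cmod x \<le> R \<longrightarrow>
    (\<integral>s. norm (f s * of_real (ln (cmod (x - c s)))) \<partial>per_measure) \<le> (\<integral>s. (cmod (f s))\<^sup>2 \<partial>per_measure) + C2"
    using c.pot_bound[of R] by blast
  note C2 = C2'(2)[rule_format]
  have orth: "(\<integral>x. \<phi> x * of_real (G (p x)) \<partial>N) = 0" if G: "continuous_on UNIV G" for G :: "complex \<Rightarrow> real"
  proof (rule N.log_energy_zero_imp_orthogonal[OF _ pm pR _ _ _ _ _ G])
    show "integrable N \<phi>" by (rule Nint[OF \<phi>i])
    show "AE y in N. p x \<noteq> p y" for x
    proof -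
      have "AE b in count_space UNIV. AE s in per_measure. p x \<noteq> p (b, s)"
      proof (rule AE_I2)
        show "AE s in per_measure. p x \<noteq> p (b, s)" for b
          using AE_neq[of "p x"] c.AE_neq[of "p x"] by (cases b) (auto simp: p_def)
      qed
      moreover have "{y \<in> space N. p x \<noteq> p y} \<in> sets N" by measurable
      ultimately show ?thesis unfolding N_def by (intro P.AE_pair_measure)
    qed
    show "integrable N (\<lambda>y. \<phi> y * of_real (ln (cmod (p x - p y))))" for x
      by (rule Nint[OF li])
    show "(\<integral>y. norm (\<phi> y * of_real (ln (cmod (p x - p y)))) \<partial>N)
      \<le> ((\<integral>s. (cmod (f s))\<^sup>2 \<partial>per_measure) + C1) + ((\<integral>s. (cmod q)\<^sup>2 \<partial>per_measure) + C2)" for x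
    proof -
      have "(\<integral>y. norm (\<phi> y * of_real (ln (cmod (p x - p y)))) \<partial>N)
        = (\<integral>s. norm (f s * of_real (ln (cmod (p x - \<gamma> s)))) \<partial>per_measure) + (\<integral>s. norm (q * of_real (ln (cmod (p x - c s)))) \<partial>per_measure)"
        by (subst NvalR) (use li[THEN integrable_norm] in \<open>auto simp: \<phi>_def p_def\<close>)
      also have "\<dots> \<le> ((\<integral>s. (cmod (f s))\<^sup>2 \<partial>per_measure) + C1) + ((\<integral>s. (cmod q)\<^sup>2 \<partial>per_measure) + C2)"
        by (intro add_mono C1 C2 f sq_integrable_const pR)
      finally show ?thesis .
    qed
    show "(\<integral>x. \<phi> x \<partial>N) = 0"
      by (subst Nval[OF \<phi>i]) (simp add: \<phi>_def \<mu>_def[symmetric] q_def measure_restrict_space scaleR_conv_of_real)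
    have U: "(\<integral>y. \<phi> y * of_real (ln (cmod (z - p y))) \<partial>N) = pot f z + c.pot (\<lambda>s. q) z" for z
      by (subst Nval[OF li]) (simp add: \<phi>_def p_def pot_def c.pot_def)
    have cnjf: "sq_integrable (\<lambda>t. cnj (f t))" using f by (auto simp: sq_integrable_def)
    have i1: "integrable per_measure (\<lambda>t. cnj (f t) * (pot f (\<gamma> t) + c.pot (\<lambda>s. q) (\<gamma> t)))"
      using integrable_mult_cnj[OF sq_integrable_add[OF sq_integrable_pot[OF f cont R1] c.sq_integrable_pot[OF sq_integrable_const[of q] cont R1]] f]
      by (simp add: mult.commute)
    have i2: "integrable per_measure (\<lambda>t. cnj q * (pot f (c t) + c.pot (\<lambda>s. q) (c t)))"
      using sq_integrable_imp_integrable[OF sq_integrable_add[OF sq_integrable_pot[OF f c.cont R2] c.sq_integrable_pot[OF sq_integrable_const[of q] c.cont R2]]]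
      by simp
    have "(\<integral>x. cnj (\<phi> x) * (\<integral>y. \<phi> y * of_real (ln (cmod (p x - p y))) \<partial>N) \<partial>N)
      = (\<integral>t. cnj (f t) * (pot f (\<gamma> t) + c.pot (\<lambda>s. q) (\<gamma> t)) \<partial>per_measure)
        + (\<integral>t. cnj q * (pot f (c t) + c.pot (\<lambda>s. q) (c t)) \<partial>per_measure)"
      unfolding U
    proof (subst Nval)
      show "integrable per_measure (\<lambda>s. cnj (\<phi> (b, s)) * (pot f (p (b, s)) + c.pot (\<lambda>s. q) (p (b, s))))" for b
        using i1 i2 by (cases b) (simp_all add: \<phi>_def p_def)
    qed (simp add: \<phi>_def p_def)
    \<comment> \<open>The self-energy of f vanishes because its potential is 0 on the curve, that of
      the circle because ln 1 = 0; the cross terms remain.\<close>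
    also have "(\<integral>t. cnj (f t) * (pot f (\<gamma> t) + c.pot (\<lambda>s. q) (\<gamma> t)) \<partial>per_measure)
        = (\<integral>t. (q * (2 * pi)) * cnj (f t * of_real (ln (max (cmod (\<gamma> t - z0)) 1))) \<partial>per_measure)"
      by (intro Bochner_Integration.integral_cong) (auto simp: pot0 cpot)
    also have "\<dots> = (q * (2 * pi)) * cnj A"
      unfolding A_def Bochner_Integration.integral_cnj[symmetric] by simp
    also have "(\<integral>t. cnj q * (pot f (c t) + c.pot (\<lambda>s. q) (c t)) \<partial>per_measure) = cnj q * (\<integral>t. 1 * pot f (c t) \<partial>per_measure)"
      by (simp add: cpot cdist)
    also have "(\<integral>t. 1 * pot f (c t) \<partial>per_measure) = (\<integral>s. f s * c.pot (\<lambda>s. 1) (\<gamma> s) \<partial>per_measure)"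
      by (rule pot_fubini[OF regular_loop_axioms cl f sq_integrable_const])
    also have "\<dots> = 2 * pi * A"
      unfolding A_def cpot by (simp add: mult.left_commute[of _ "2 * _"] mult.left_commute[of _ "complex_of_real pi"] mult.left_commute[of _ 2])
    finally show "(\<integral>x. cnj (\<phi> x) * (\<integral>y. \<phi> y * of_real (ln (cmod (p x - p y))) \<partial>N) \<partial>N) = 0"
      using A0 by simp
  qed
  have "AE t in per_measure. f t = 0"
  proof (rule per_AE_zero_of_injective[OF fint cont inj])
    show "\<gamma> (2 * pi) = \<gamma> 0" using periodic[of 0] by simp
    \<comment> \<open>Test sets on the curve miss the unit circle, so the second copy contributes
      nothing and f is seen alone.\<close>
    fix S assume S: "closed S" "S \<subseteq> \<gamma> ` {0..2*pi}" "S \<noteq> {}"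
    have i: "integrable per_measure (\<lambda>s. \<phi> (b, s) * indicator S (p (b, s)))" for b
    proof (rule Bochner_Integration.integrable_bound[OF \<phi>i[of b]])
      have [measurable]: "S \<in> sets borel" using S(1) by simp
      show "(\<lambda>s. \<phi> (b, s) * indicator S (p (b, s))) \<in> borel_measurable per_measure"
        by (cases b) (simp_all add: \<phi>_def p_def)
    qed (auto simp: indicator_def)
    have "0 = (\<integral>x. \<phi> x * indicator S (p x) \<partial>N)"
      using orthogonal_continuous_imp_closed[OF Nint[OF \<phi>i] pm orth S(1,3)] by simp
    also have "\<dots> = (\<integral>s. f s * indicator S (\<gamma> s) \<partial>per_measure) + (\<integral>s. q * indicator S (c s) \<partial>per_measure)"
      by (subst Nval[OF i]) (simp add: \<phi>_def p_def)
    also have "(\<lambda>s. q * indicator S (c s)) = (\<lambda>s. 0)"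
    proof
      fix s
      have "c s \<notin> S" using S(2) fr z0(2)[of "c s"] cdist[of s] by auto
      then show "q * indicator S (c s) = 0" by simp
    qed
    finally show "(\<integral>t. f t * indicator S (\<gamma> t) \<partial>per_measure) = 0" by simp
  qed
  then show ?thesis
    unfolding f_def using zero by (intro l2_eqI) (auto elim!: eventually_elim2)
qed

end

section \<open>Projection methods for smoothing perturbations of a diagonal operator\<close>

lemma norm_le_of_coef:
  assumes "\<And>n. (\<Sum>k\<in>{- int n..int n}. (cmod (coef f k))\<^sup>2) \<le> c"
  shows "(norm f)\<^sup>2 \<le> 2 * pi * c"
proof (rule LIMSEQ_le_const2)
  show "(\<lambda>n. (norm (trig_sum {- int n..int n} (coef f)))\<^sup>2) \<longlonglongrightarrow> (norm f)\<^sup>2"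
    by (intro tendsto_intros trig_sum_coef_tendsto)
  show "\<exists>N. \<forall>n\<ge>N. (norm (trig_sum {- int n..int n} (coef f)))\<^sup>2 \<le> 2 * pi * c"
    using assms by (simp add: norm_trig_sum)
qed

text \<open>Compactness of the Hilbert cube: a diagonal subsequence converges in every coefficient,
  and the square-summable envelope r makes the tails uniformly small, which upgrades this to norm
  convergence.\<close>

lemma compact_coef_box:
  fixes f :: "nat \<Rightarrow> l2" and r :: "int \<Rightarrow> real"
  assumes f: "\<And>i j. cmod (coef (f i) j) \<le> r j"
    and r: "\<And>n. (\<Sum>j\<in>{- int n..int n}. (r j)\<^sup>2) \<le> B"
  obtains \<sigma> g where "strict_mono \<sigma>" "(\<lambda>i. f (\<sigma> i)) \<longlonglongrightarrow> g"
proof -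
  have ex: "\<exists>\<sigma> y. strict_mono \<sigma> \<and> (\<forall>j. (\<lambda>i. coef (f (\<sigma> i)) j) \<longlonglongrightarrow> y j)"
  proof -
    define P where "P n s \<longleftrightarrow> convergent (\<lambda>i. coef (f (s i)) (from_nat n))" for n :: nat and s :: "nat \<Rightarrow> nat"
    interpret subseqs P
    proof
      fix n :: nat and s :: "nat \<Rightarrow> nat" assume "strict_mono s"
      have "bounded (range (\<lambda>i. coef (f (s i)) (from_nat n)))"
        using f by (auto simp: bounded_iff)
      then obtain l r' where "strict_mono r'" "((\<lambda>i. coef (f (s i)) (from_nat n)) \<circ> r') \<longlonglongrightarrow> l"
        using bounded_imp_convergent_subsequence by blast
      then show "\<exists>r'. strict_mono r' \<and> P n (s \<circ> r')"
        by (auto simp: P_def convergent_def o_def)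
    qed
    have "convergent (\<lambda>i. coef (f (diagseq i)) j)" for j
    proof -
      have "P (to_nat j) (diagseq \<circ> ((+) (Suc (to_nat j))))"
      proof (rule diagseq_holds)
        fix n and s r' :: "nat \<Rightarrow> nat" assume "strict_mono r'" "P n s"
        then show "P n (s \<circ> r')"
          using convergent_subseq_convergent[of "\<lambda>i. coef (f (s i)) (from_nat n)" r']
          by (auto simp: P_def o_def)
      qed
      then have "convergent (\<lambda>i. coef (f (diagseq (i + Suc (to_nat j)))) j)"
        by (simp add: P_def o_def add.commute)
      then show ?thesis using convergent_ignore_initial_segment[of "\<lambda>i. coef (f (diagseq i)) j"] by blast
    qed
    then have "\<exists>y. \<forall>j. (\<lambda>i. coef (f (diagseq i)) j) \<longlonglongrightarrow> y j"
      unfolding convergent_def by (intro choice) auto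
    then show ?thesis using subseq_diagseq by blast
  qed
  then obtain \<sigma> y where \<sigma>: "strict_mono \<sigma>" and y: "\<And>j. (\<lambda>i. coef (f (\<sigma> i)) j) \<longlonglongrightarrow> y j" by blast
  have yr: "cmod (y j) \<le> r j" for j
    by (rule LIMSEQ_le_const2[OF tendsto_norm[OF y]]) (use f in auto)
  have "(\<Sum>j\<in>{- int n..int n}. (cmod (y j))\<^sup>2) \<le> B" for n
    by (rule order_trans[OF sum_mono r]) (use yr in \<open>auto intro: power_mono\<close>)
  then obtain g where g: "coef g = y" by (rule riesz_fischer)
  have gap: "cmod (coef (f i - g) j) \<le> 2 * r j" for i j
    using norm_triangle_ineq4[of "coef (f i) j" "y j"] f[of i j] yr[of j] by (simp add: coef_diff g)
  let ?s = "\<lambda>n. \<Sum>j\<in>{- int n..int n}. (r j)\<^sup>2"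
  have "incseq ?s" by (intro monoI sum_mono2) auto
  then have "convergent ?s"
    by (rule Bseq_mono_convergent[rotated, unfolded incseq_def[symmetric]])
       (use r in \<open>auto simp: incseq_def abs_of_nonneg[OF sum_nonneg] intro!: BseqI'[of _ B]\<close>)
  then have C: "Cauchy ?s" by (rule convergent_Cauchy)
  have "(\<lambda>i. f (\<sigma> i)) \<longlonglongrightarrow> g"
  proof (rule LIMSEQ_I)
    fix e :: real assume e: "e > 0"
    \<comment> \<open>The head contributes d and the tail 4 d, since the coefficients of f - g are
      at most 2 r; 2 pi times 5 d is e^2 / 2.\<close>
    define d where "d = e\<^sup>2 / (20 * pi)"
    have d: "d > 0" using e by (simp add: d_def)
    obtain J where J: "\<And>m n. m \<ge> J \<Longrightarrow> n \<ge> J \<Longrightarrow> dist (?s m) (?s n) < d"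
      using metric_CauchyD[OF C d] by blast
    have tail: "(\<Sum>j\<in>{- int n..int n} - {- int J..int J}. (r j)\<^sup>2) \<le> d" for n
    proof (cases "n \<ge> J")
      case True
      then have "(\<Sum>j\<in>{- int n..int n} - {- int J..int J}. (r j)\<^sup>2) = ?s n - ?s J"
        by (intro sum_diff) auto
      also have "\<dots> \<le> d" using J[of n J] True by (simp add: dist_real_def)
      finally show ?thesis .
    next
      case False
      then have "{- int n..int n} - {- int J..int J} = {}" by auto
      then show ?thesis using d by (simp only: sum.empty)
    qed
    have "(\<lambda>i. \<Sum>j\<in>{- int J..int J}. (cmod (coef (f (\<sigma> i) - g) j))\<^sup>2) \<longlonglongrightarrow> (\<Sum>j\<in>{- int J..int J}. (cmod (y j - y j))\<^sup>2)"
      unfolding coef_diff g by (intro tendsto_intros y)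
    then have "eventually (\<lambda>i. (\<Sum>j\<in>{- int J..int J}. (cmod (coef (f (\<sigma> i) - g) j))\<^sup>2) < d) sequentially"
      using d by (intro order_tendstoD(2)) auto
    then obtain N where N: "\<And>i. i \<ge> N \<Longrightarrow> (\<Sum>j\<in>{- int J..int J}. (cmod (coef (f (\<sigma> i) - g) j))\<^sup>2) < d"
      by (auto simp: eventually_sequentially)
    have "norm (f (\<sigma> i) - g) < e" if i: "i \<ge> N" for i
    proof -
      have "(\<Sum>j\<in>{- int n..int n}. (cmod (coef (f (\<sigma> i) - g) j))\<^sup>2) \<le> d + 4 * d" for n
      proof -
        have "(\<Sum>j\<in>{- int n..int n}. (cmod (coef (f (\<sigma> i) - g) j))\<^sup>2)
          \<le> (\<Sum>j\<in>{- int J..int J} \<union> ({- int n..int n} - {- int J..int J}). (cmod (coef (f (\<sigma> i) - g) j))\<^sup>2)"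
          by (intro sum_mono2) auto
        also have "\<dots> = (\<Sum>j\<in>{- int J..int J}. (cmod (coef (f (\<sigma> i) - g) j))\<^sup>2)
          + (\<Sum>j\<in>{- int n..int n} - {- int J..int J}. (cmod (coef (f (\<sigma> i) - g) j))\<^sup>2)"
          by (intro sum.union_disjoint) auto
        also have "(\<Sum>j\<in>{- int n..int n} - {- int J..int J}. (cmod (coef (f (\<sigma> i) - g) j))\<^sup>2)
          \<le> (\<Sum>j\<in>{- int n..int n} - {- int J..int J}. 4 * (r j)\<^sup>2)"
        proof (rule sum_mono)
          fix j
          have "(cmod (coef (f (\<sigma> i) - g) j))\<^sup>2 \<le> (2 * r j)\<^sup>2" using gap by (intro power_mono) auto
          then show "(cmod (coef (f (\<sigma> i) - g) j))\<^sup>2 \<le> 4 * (r j)\<^sup>2" by (simp add: power_mult_distrib)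
        qed
        also have "\<dots> \<le> 4 * d" using tail[of n] by (simp add: sum_distrib_left[symmetric])
        finally show ?thesis using N[OF i] by linarith
      qed
      then have "(norm (f (\<sigma> i) - g))\<^sup>2 \<le> 2 * pi * (d + 4 * d)" by (rule norm_le_of_coef)
      also have "\<dots> = e\<^sup>2 / 2" by (simp add: d_def)
      also have "\<dots> < e\<^sup>2" using e by simp
      finally show ?thesis using e by (simp add: power2_less_imp_less)
    qed
    then show "\<exists>N. \<forall>i\<ge>N. norm (f (\<sigma> i) - g) < e" by blast
  qed
  with \<sigma> show ?thesis by (rule that)
qed

section \<open>Orthogonal projections and the Moore-Penrose inverse\<close>

lemma trig_polys_iff: "f \<in> trig_polys n \<longleftrightarrow> (\<forall>k. k \<notin> {- int n..int n} \<longrightarrow> coef f k = 0)"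
proof
  assume "f \<in> trig_polys n"
  then have "f \<in> l2.span (trig ` {- int n..int n})" by (simp add: trig_polys_def)
  then show "\<forall>k. k \<notin> {- int n..int n} \<longrightarrow> coef f k = 0"
    by (induction rule: l2.span_induct_alt) (auto simp: coef_add coef_cscale coef_trig)
next
  assume *: "\<forall>k. k \<notin> {- int n..int n} \<longrightarrow> coef f k = 0"
  have "f = trig_sum {- int n..int n} (coef f)"
    by (rule l2_eq_coefI) (use * in \<open>auto simp: coef_trig_sum\<close>)
  also have "\<dots> \<in> trig_polys n"
    unfolding trig_polys_def trig_sum_def
    by (intro l2.span_sum l2.span_scale l2.span_base) auto
  finally show "f \<in> trig_polys n" .
qed

lemma subspace_trig_polys: "l2.subspace (trig_polys n)"
  unfolding trig_polys_def by (rule l2.subspace_span)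

lemma trig_in_trig_polys: "\<bar>k\<bar> \<le> int n \<Longrightarrow> trig k \<in> trig_polys n"
  by (auto simp: trig_polys_iff coef_trig)

lemma orth_proj_eqI:
  assumes V: "l2.subspace V" and p: "p \<in> V" "\<And>v. v \<in> V \<Longrightarrow> cinner (f - p) v = 0"
  shows "orth_proj V f = p"
  unfolding orth_proj_def
proof (rule the_equality)
  fix p' assume p': "p' \<in> V \<and> (\<forall>v\<in>V. cinner (f - p') v = 0)"
  have "p - p' \<in> V" using l2.subspace_diff[OF V] p(1) p' by blast
  then have "cinner (f - p') (p - p') = 0" "cinner (f - p) (p - p') = 0" using p(2) p' by blast+
  then have "cinner ((f - p') - (f - p)) (p - p') = 0"
    by (simp only: cinner_diff_left[of "f - p'" "f - p"] diff_0_right)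
  then have "cinner (p - p') (p - p') = 0" by simp
  then show "p' = p" by (simp add: cinner_self)
qed (use p in auto)

lemma orth_proj_idem: "l2.subspace V \<Longrightarrow> p \<in> V \<Longrightarrow> orth_proj V p = p"
  by (rule orth_proj_eqI) auto

text \<open>One Gram-Schmidt step per vector: b is replaced by its component u orthogonal to the
  span so far. If b already lies in that span, then u = 0 and the coefficient c = 0 / 0 = 0 does no
  harm.\<close>

lemma span_projection:
  assumes "finite S"
  shows "\<exists>p\<in>l2.span S. \<forall>v\<in>l2.span S. cinner (f - p) v = 0"
  using assms
proof (induction S arbitrary: f rule: finite_induct)
  case (insert b S)
  obtain p where p: "p \<in> l2.span S" "\<forall>v\<in>l2.span S. cinner (f - p) v = 0" using insert.IH by blast
  obtain b0 where b0: "b0 \<in> l2.span S" "\<forall>v\<in>l2.span S. cinner (b - b0) v = 0" using insert.IH by blast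
  define u where "u = b - b0"
  define c where "c = cinner (f - p) u / cinner u u"
  have sub: "l2.span S \<subseteq> l2.span (insert b S)" by (rule l2.span_mono) auto
  have u: "u \<in> l2.span (insert b S)"
    unfolding u_def by (intro l2.span_diff l2.span_base subsetD[OF sub b0(1)]) auto
  have uS: "cinner u v = 0" if "v \<in> l2.span S" for v using b0(2) that by (simp add: u_def)
  have "cinner (f - (p + cscale c u)) v = 0" if v_in: "v \<in> l2.span (insert b S)" for v
  proof -
    obtain k where k: "v - cscale k b \<in> l2.span S" using v_in l2.span_breakdown_eq by blast
    define s where "s = (v - cscale k b) + cscale k b0"
    have s: "s \<in> l2.span S" unfolding s_def by (intro l2.span_add l2.span_scale k b0(1))
    have v: "v = s + cscale k u" by (simp add: s_def u_def l2.scale_right_diff_distrib)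
    have "cinner (f - (p + cscale c u)) u = 0"
    proof (cases "u = 0")
      case False
      then have "cinner u u \<noteq> 0" by (simp add: cinner_self)
      then show ?thesis by (simp add: diff_diff_add[symmetric] cinner_diff_left cinner_cscale_left c_def)
    qed simp
    moreover have "cinner (f - (p + cscale c u)) s = 0"
      using p(2) s uS[OF s] by (simp add: diff_diff_add[symmetric] cinner_diff_left[of "f - p"] cinner_cscale_left)
    ultimately show ?thesis by (simp add: v cinner_add_right cinner_cscale_right)
  qed
  moreover have "p + cscale c u \<in> l2.span (insert b S)"
    using p(1) u sub by (intro l2.span_add l2.span_scale) auto
  ultimately show ?case by blast
qed auto

lemma
  assumes "finite S"
  shows orth_proj_span: "orth_proj (l2.span S) f \<in> l2.span S"
    and orth_proj_span_orthogonal: "v \<in> l2.span S \<Longrightarrow> cinner (f - orth_proj (l2.span S) f) v = 0"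
proof -
  obtain p where p: "p \<in> l2.span S" "\<And>v. v \<in> l2.span S \<Longrightarrow> cinner (f - p) v = 0"
    using span_projection[OF assms] by blast
  have "orth_proj (l2.span S) f = p" by (rule orth_proj_eqI[OF l2.subspace_span p])
  with p show "orth_proj (l2.span S) f \<in> l2.span S"
    "v \<in> l2.span S \<Longrightarrow> cinner (f - orth_proj (l2.span S) f) v = 0" by simp_all
qed

lemma orth_proj_trig_polys: "orth_proj (trig_polys n) f = trig_sum {- int n..int n} (coef f)"
proof (rule orth_proj_eqI[OF subspace_trig_polys])
  show "trig_sum {- int n..int n} (coef f) \<in> trig_polys n" by (simp add: trig_polys_iff coef_trig_sum)
  fix v assume "v \<in> trig_polys n"
  then have "v = trig_sum {- int n..int n} (coef v)"
    by (intro l2_eq_coefI) (auto simp: trig_polys_iff coef_trig_sum)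
  then have "cinner (f - trig_sum {- int n..int n} (coef f)) v
      = cinner (f - trig_sum {- int n..int n} (coef f)) (trig_sum {- int n..int n} (coef v))" by simp
  also have "\<dots> = 0" by (simp add: cinner_trig_sum_right coef_diff coef_trig_sum)
  finally show "cinner (f - trig_sum {- int n..int n} (coef f)) v = 0" .
qed

abbreviation fourier_proj :: "nat \<Rightarrow> l2 \<Rightarrow> l2" where
  "fourier_proj n \<equiv> orth_proj (trig_polys n)"

lemma fourier_proj_in: "fourier_proj n f \<in> trig_polys n"
  by (simp add: orth_proj_trig_polys trig_polys_iff coef_trig_sum)

lemma coef_fourier_proj: "coef (fourier_proj n f) k = (if k \<in> {- int n..int n} then coef f k else 0)"
  by (simp add: orth_proj_trig_polys coef_trig_sum)

lemma fourier_proj_id: "f \<in> trig_polys n \<Longrightarrow> fourier_proj n f = f"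
  by (rule orth_proj_idem[OF subspace_trig_polys])

lemma norm_fourier_proj: "(norm (fourier_proj n f))\<^sup>2 = 2 * pi * (\<Sum>k\<in>{- int n..int n}. (cmod (coef f k))\<^sup>2)"
  by (simp add: orth_proj_trig_polys norm_trig_sum)

lemma norm_fourier_proj_le: "norm (fourier_proj n f) \<le> norm f"
  by (rule power2_le_imp_le) (use bessel[of "{- int n..int n}" f] in \<open>simp_all add: norm_fourier_proj\<close>)

lemma fourier_proj_diff: "fourier_proj n f - fourier_proj n g = fourier_proj n (f - g)"
  by (rule l2_eq_coefI) (simp add: coef_diff coef_fourier_proj)

lemma fourier_proj_tendsto: "(\<lambda>n. fourier_proj n f) \<longlonglongrightarrow> f"
  unfolding orth_proj_trig_polys by (rule trig_sum_coef_tendsto)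

lemma cinner_fourier_proj_left: "v \<in> trig_polys n \<Longrightarrow> cinner (fourier_proj n f) v = cinner f v"
  using orth_proj_span_orthogonal[of "trig ` {- int n..int n}" v f]
  by (simp add: trig_polys_def cinner_diff_left)

lemma cinner_fourier_proj_right: "v \<in> trig_polys n \<Longrightarrow> cinner v (fourier_proj n f) = cinner v f"
  using cinner_fourier_proj_left[of v n f] by (metis cinner_commute)

text \<open>For an operator injective on X the kernel condition is void, and a right-hand side in
  the range is its own projection. The discrete problems are of this kind, the Bubnov-Galerkin
  problem for large n.\<close>

lemma moore_penrose_eqI:
  assumes X: "l2.subspace X" and A0: "A 0 = 0" and inj: "inj_on A X" and x: "x \<in> X"
    and AX: "l2.subspace (A ` X)" and y: "A x = y"
  shows "moore_penrose X A y = x"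
proof -
  have py: "orth_proj (A ` X) y = y" using orth_proj_idem[OF AX] x y by blast
  have X0: "0 \<in> X" by (rule l2.subspace_0[OF X])
  show ?thesis
    unfolding moore_penrose_def py
  proof (rule the_equality)
    show "x \<in> X \<and> (\<forall>z\<in>X. A z = 0 \<longrightarrow> cinner x z = 0) \<and> A x = y"
    proof (intro conjI ballI impI x y)
      fix z assume "z \<in> X" "A z = 0"
      then have "z = 0" using inj_onD[OF inj, of z 0] A0 X0 by simp
      then show "cinner x z = 0" by simp
    qed
    show "x' = x" if "x' \<in> X \<and> (\<forall>z\<in>X. A z = 0 \<longrightarrow> cinner x' z = 0) \<and> A x' = y" for x'
      using that inj_onD[OF inj, of x' x] x y by auto
  qed
qed

text \<open>The last assumption says that \<open>K\<close> differs from the diagonal operator with symbol \<open>1 / weight j\<close> by an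
  operator that is Hilbert--Schmidt from \<open>L\<^sup>2\<close> into \<open>H\<^sup>1\<close>.\<close>

locale smoothing_op =
  fixes K :: "l2 \<Rightarrow> l2" and B :: real
  assumes K_add: "K (f + g) = K f + K g"
    and K_cscale: "K (cscale c f) = cscale c (K f)"
    and K_self_adjoint: "cinner (K f) g = cinner f (K g)"
    and K_inj: "K f = 0 \<Longrightarrow> f = 0"
    and smoothing: "(\<Sum>j\<in>{- int n..int n}. (weight j)\<^sup>2 *
      (norm (K (trig j) - cscale (of_real (1 / weight j)) (trig j)))\<^sup>2) \<le> B"
begin

lemma K_zero [simp]: "K 0 = 0"
  using K_cscale[of 0 0] by simp

lemma K_diff: "K (f - g) = K f - K g"
proof -
  have "K (f + cscale (- 1) g) = K f + cscale (- 1) (K g)" by (simp only: K_add K_cscale)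
  then show ?thesis by (simp add: cscale_minus_one)
qed

lemma K_eq_iff: "K f = K g \<longleftrightarrow> f = g"
  using K_inj[of "f - g"] by (auto simp: K_diff)

lemma linear_K: "Vector_Spaces.linear cscale cscale K"
  by unfold_locales (simp_all add: K_add K_cscale)

lemma K_image_span: "K ` l2.span S = l2.span (K ` S)"
proof -
  interpret k: Vector_Spaces.linear cscale cscale K by (rule linear_K)
  show ?thesis by (simp add: k.span_image)
qed

lemma subspace_K_image: "l2.subspace (K ` trig_polys n)"
  unfolding trig_polys_def K_image_span by (rule l2.subspace_span)

lemma adjoint_op_K: "adjoint_op K = K"
  unfolding adjoint_op_def
proof (rule the_equality)
  fix A assume *: "\<forall>f g. cinner (K f) g = cinner f (A g)"
  have "A g = K g" for g
  proof -
    have "cinner (A g - K g) (A g - K g) = 0"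
      using * by (simp add: cinner_diff_right K_self_adjoint[symmetric])
    then show ?thesis by (simp add: cinner_self)
  qed
  then show "A = K" by auto
qed (simp add: K_self_adjoint)

definition U :: "int \<Rightarrow> l2" where
  "U j = K (trig j) - cscale (of_real (1 / weight j)) (trig j)"

text \<open>By self-adjointness, the weighted Fourier coefficients of K minus its diagonal part,
  applied to w (\<open>weight_coef_K\<close>).\<close>

definition D :: "l2 \<Rightarrow> int \<Rightarrow> complex" where
  "D w j = of_real (weight j) * cinner w (U j) / (2 * pi)"

text \<open>The Cauchy-Schwarz bound for \<open>D\<close> on unit vectors. Its square-summability
  places the images of all unit vectors in one Hilbert cube.\<close>

definition r :: "int \<Rightarrow> real" where
  "r j = weight j * norm (U j) / (2 * pi)"

lemma weight_coef_K: "of_real (weight j) * coef (K w) j = coef w j + D w j"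
proof -
  have "2 * pi * coef (K w) j = cinner w (K (trig j))"
    using cinner_trig_right[of "K w" j] K_self_adjoint[of w "trig j"] by simp
  also have "K (trig j) = U j + cscale (of_real (1 / weight j)) (trig j)" by (simp add: U_def)
  also have "cinner w \<dots> = cinner w (U j) + of_real (1 / weight j) * (2 * pi * coef w j)"
    by (simp add: cinner_add_right cinner_cscale_right cinner_trig_right)
  finally show ?thesis using weight_pos[of j] by (simp add: D_def field_simps)
qed

lemma D_le: "cmod (D w j) \<le> r j * norm w"
proof -
  have "cmod (D w j) = weight j * cmod (cinner w (U j)) / (2 * pi)"
    using weight_pos[of j] by (simp add: D_def norm_mult norm_divide)
  also have "\<dots> \<le> weight j * (norm w * norm (U j)) / (2 * pi)"
    using weight_pos[of j] by (intro divide_right_mono mult_left_mono norm_cinner_le) auto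
  finally show ?thesis by (simp add: r_def mult_ac)
qed

lemma r_sum: "(\<Sum>j\<in>{- int n..int n}. (r j)\<^sup>2) \<le> B / (2 * pi)\<^sup>2"
proof -
  have "(\<Sum>j\<in>{- int n..int n}. (r j)\<^sup>2) = (\<Sum>j\<in>{- int n..int n}. (weight j)\<^sup>2 * (norm (U j))\<^sup>2) / (2 * pi)\<^sup>2"
    by (simp add: r_def power_divide power_mult_distrib sum_divide_distrib)
  also have "\<dots> \<le> B / (2 * pi)\<^sup>2" using smoothing[of n] by (intro divide_right_mono) (auto simp: U_def)
  finally show ?thesis .
qed

lemma B_nonneg: "B \<ge> 0"
  using smoothing[of 0] by (meson order_trans sum_nonneg mult_nonneg_nonneg zero_le_power2)

text \<open>Bessel's inequality contributes 2 / (2 pi), and \<open>r_sum\<close> the second term;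
  the factors 2 come from (a + b)^2 \<le> 2 a^2 + 2 b^2.\<close>

definition H :: real where "H = 1 / pi + 2 * (B / (2 * pi)\<^sup>2)"

lemma H_pos: "H > 0"
  using B_nonneg by (auto simp: H_def intro!: add_pos_nonneg)

lemma H1_bound: "(\<Sum>j\<in>{- int n..int n}. (weight j)\<^sup>2 * (cmod (coef (K w) j))\<^sup>2) \<le> H * (norm w)\<^sup>2"
proof -
  have "(\<Sum>j\<in>{- int n..int n}. (weight j)\<^sup>2 * (cmod (coef (K w) j))\<^sup>2)
      \<le> (\<Sum>j\<in>{- int n..int n}. 2 * (cmod (coef w j))\<^sup>2 + 2 * (r j)\<^sup>2 * (norm w)\<^sup>2)"
  proof (rule sum_mono)
    fix j
    have "(weight j)\<^sup>2 * (cmod (coef (K w) j))\<^sup>2 = (cmod (coef w j + D w j))\<^sup>2"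
      unfolding weight_coef_K[symmetric] by (simp add: norm_mult power_mult_distrib)
    also have "\<dots> \<le> (cmod (coef w j) + cmod (D w j))\<^sup>2" by (intro power_mono norm_triangle_ineq) auto
    also have "\<dots> \<le> 2 * (cmod (coef w j))\<^sup>2 + 2 * (cmod (D w j))\<^sup>2"
      using zero_le_power2[of "cmod (coef w j) - cmod (D w j)"] by (simp add: power2_sum power2_diff)
    also have "(cmod (D w j))\<^sup>2 \<le> (r j * norm w)\<^sup>2" by (intro power_mono D_le) auto
    finally show "(weight j)\<^sup>2 * (cmod (coef (K w) j))\<^sup>2 \<le> 2 * (cmod (coef w j))\<^sup>2 + 2 * (r j)\<^sup>2 * (norm w)\<^sup>2"
      by (simp add: power_mult_distrib)
  qed
  also have "\<dots> = 2 * (\<Sum>j\<in>{- int n..int n}. (cmod (coef w j))\<^sup>2) + 2 * (\<Sum>j\<in>{- int n..int n}. (r j)\<^sup>2) * (norm w)\<^sup>2"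
    by (simp add: sum.distrib sum_distrib_left sum_distrib_right)
  also have "\<dots> \<le> 2 * ((norm w)\<^sup>2 / (2 * pi)) + 2 * (B / (2 * pi)\<^sup>2) * (norm w)\<^sup>2"
    using bessel[of "{- int n..int n}" w] r_sum[of n]
    by (intro add_mono mult_left_mono mult_right_mono) (auto simp: field_simps)
  also have "\<dots> = H * (norm w)\<^sup>2" by (simp add: H_def algebra_simps)
  finally show ?thesis .
qed

text \<open>Stability of the Bubnov--Galerkin scheme. A violating sequence of unit vectors would converge,
  by compactness of \<open>D\<close>, to a unit vector in the kernel of \<open>K\<close>.\<close>

lemma stability:
  obtains C N where "C > 0" "\<And>n w. n \<ge> N \<Longrightarrow> w \<in> trig_polys n \<Longrightarrow>
    (norm w)\<^sup>2 \<le> C * (\<Sum>j\<in>{- int n..int n}. (weight j)\<^sup>2 * (cmod (coef (K w) j))\<^sup>2)"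
proof -
  let ?S = "\<lambda>n w. \<Sum>j\<in>{- int n..int n}. (weight j)\<^sup>2 * (cmod (coef (K w) j))\<^sup>2"
  have "\<exists>C>0. \<exists>N. \<forall>n\<ge>N. \<forall>w\<in>trig_polys n. (norm w)\<^sup>2 \<le> C * ?S n w"
  proof (rule ccontr)
    assume "\<not> ?thesis"
    then have neg: "\<not> (\<exists>N. \<forall>n\<ge>N. \<forall>w\<in>trig_polys n. (norm w)\<^sup>2 \<le> C * ?S n w)" if "C > 0" for C
      using that by blast
    define bad where "bad i n w \<longleftrightarrow> n \<ge> i \<and> w \<in> trig_polys n \<and> \<not> (norm w)\<^sup>2 \<le> real (Suc i) * ?S n w" for i n w
    have "\<exists>n w. bad i n w" for i
      using neg[of "real (Suc i)"] unfolding bad_def by force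
    then obtain n w where "\<And>i. bad i (n i) (w i)" by metis
    then have nw: "\<And>i. n i \<ge> i" "\<And>i. w i \<in> trig_polys (n i)"
      "\<And>i. \<not> (norm (w i))\<^sup>2 \<le> real (Suc i) * ?S (n i) (w i)"
      unfolding bad_def by blast+
    have w0: "w i \<noteq> 0" for i
    proof
      assume "w i = 0"
      then have "?S (n i) (w i) = 0" by simp
      then show False using nw(3)[of i] \<open>w i = 0\<close> by simp
    qed
    define v where "v i = cscale (of_real (1 / norm (w i))) (w i)" for i
    have v1: "norm (v i) = 1" for i using w0[of i] by (simp add: v_def norm_cscale norm_divide)
    have vT: "v i \<in> trig_polys (n i)" for i
      unfolding v_def by (intro l2.subspace_scale subspace_trig_polys nw)
    have vS: "?S (n i) (v i) < 1 / real (Suc i)" for i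
    proof -
      have "?S (n i) (v i) = ?S (n i) (w i) / (norm (w i))\<^sup>2"
        by (simp add: v_def K_cscale coef_cscale norm_mult norm_divide power_mult_distrib power_divide sum_divide_distrib)
      also have "\<dots> < 1 / real (Suc i)"
        using nw(3)[of i] w0[of i] by (simp add: field_simps)
      finally show ?thesis .
    qed
    \<comment> \<open>E i is to be the function with coefficients D (v i). All of these lie in the
      box given by r, so a subsequence converges.\<close>
    have "\<exists>E. \<forall>j. coef E j = D (v i) j" for i
    proof -
      have "(\<Sum>j\<in>{- int m..int m}. (cmod (D (v i) j))\<^sup>2) \<le> B / (2 * pi)\<^sup>2" for m
        by (rule order_trans[OF sum_mono r_sum]) (use D_le[of "v i"] v1 in \<open>auto intro!: power_mono\<close>)
      then obtain E where "coef E = D (v i)" by (rule riesz_fischer)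
      then show ?thesis by (intro exI[of _ E]) simp
    qed
    then obtain E where E: "\<And>i j. coef (E i) j = D (v i) j" by metis
    have Er: "cmod (coef (E i) j) \<le> r j" for i j using D_le[of "v i" j] v1 by (simp add: E)
    obtain \<sigma> y where \<sigma>: "strict_mono \<sigma>" "(\<lambda>i. E (\<sigma> i)) \<longlonglongrightarrow> y"
      by (rule compact_coef_box[OF Er r_sum])
    have n\<sigma>: "filterlim (\<lambda>i. n (\<sigma> i)) sequentially sequentially"
    proof (rule filterlim_at_top_mono[OF filterlim_subseq[OF \<sigma>(1)]])
      show "eventually (\<lambda>i. \<sigma> i \<le> n (\<sigma> i)) sequentially" using nw(1) by simp
    qed
    have PE: "(\<lambda>i. fourier_proj (n (\<sigma> i)) (E (\<sigma> i))) \<longlonglongrightarrow> y"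
    proof -
      have "(\<lambda>i. fourier_proj (n (\<sigma> i)) (E (\<sigma> i) - y)) \<longlonglongrightarrow> 0"
      proof (rule Lim_null_comparison)
        show "eventually (\<lambda>i. norm (fourier_proj (n (\<sigma> i)) (E (\<sigma> i) - y)) \<le> norm (E (\<sigma> i) - y)) sequentially"
          by (simp add: norm_fourier_proj_le)
        show "(\<lambda>i. norm (E (\<sigma> i) - y)) \<longlonglongrightarrow> 0" using \<sigma>(2) by (simp add: LIM_zero tendsto_norm_zero)
      qed
      moreover have "(\<lambda>i. fourier_proj (n (\<sigma> i)) y) \<longlonglongrightarrow> y"
        by (rule filterlim_compose[OF fourier_proj_tendsto n\<sigma>])
      ultimately have "(\<lambda>i. fourier_proj (n (\<sigma> i)) (E (\<sigma> i) - y) + fourier_proj (n (\<sigma> i)) y) \<longlonglongrightarrow> 0 + y"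
        by (rule tendsto_add)
      then show ?thesis unfolding fourier_proj_diff[symmetric] by simp
    qed
    \<comment> \<open>v + P_n E equals P_n (v + E), and the coefficients of v + E are the weighted
      coefficients of K v, small by the choice of v. Hence v tends to -y along the
      subsequence.\<close>
    have vE: "(norm (v i + fourier_proj (n i) (E i)))\<^sup>2 \<le> 2 * pi / real (Suc i)" for i
    proof -
      have "v i + fourier_proj (n i) (E i) = fourier_proj (n i) (v i + E i)"
        using vT[of i] by (intro l2_eq_coefI) (auto simp: coef_add coef_fourier_proj trig_polys_iff)
      then have "(norm (v i + fourier_proj (n i) (E i)))\<^sup>2 = 2 * pi * (\<Sum>j\<in>{- int (n i)..int (n i)}. (cmod (coef (v i + E i) j))\<^sup>2)"
        by (simp add: norm_fourier_proj)
      also have "(\<Sum>j\<in>{- int (n i)..int (n i)}. (cmod (coef (v i + E i) j))\<^sup>2) = ?S (n i) (v i)"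
        by (intro sum.cong refl) (simp add: coef_add E weight_coef_K[symmetric] norm_mult power_mult_distrib)
      also have "2 * pi * \<dots> \<le> 2 * pi * (1 / real (Suc i))"
        using vS[of i] by (intro mult_left_mono) auto
      finally show ?thesis by simp
    qed
    have "(\<lambda>i. v (\<sigma> i) + fourier_proj (n (\<sigma> i)) (E (\<sigma> i))) \<longlonglongrightarrow> 0"
    proof -
      have "(\<lambda>i. 2 * pi * inverse (real (Suc i))) \<longlonglongrightarrow> 2 * pi * 0"
        by (intro tendsto_mult tendsto_const LIMSEQ_inverse_real_of_nat)
      then have lim: "(\<lambda>i. sqrt (2 * pi / real (Suc i))) \<longlonglongrightarrow> 0"
        using tendsto_real_sqrt[of "\<lambda>i. 2 * pi * inverse (real (Suc i))" "2 * pi * 0"] by (simp add: divide_inverse)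
      have nb: "norm (v i + fourier_proj (n i) (E i)) \<le> sqrt (2 * pi / real (Suc i))" for i
        by (rule real_le_rsqrt[OF vE])
      have "(\<lambda>i. v i + fourier_proj (n i) (E i)) \<longlonglongrightarrow> 0"
        by (rule Lim_null_comparison[OF always_eventually[OF allI[OF nb]] lim])
      from LIMSEQ_subseq_LIMSEQ[OF this \<sigma>(1)] show ?thesis by (simp add: o_def)
    qed
    from tendsto_diff[OF this PE] have v_lim: "(\<lambda>i. v (\<sigma> i)) \<longlonglongrightarrow> - y" by simp
    have "norm (- y) = 1"
      by (rule LIMSEQ_unique[OF tendsto_norm[OF v_lim]]) (simp add: v1)
    \<comment> \<open>Self-adjointness expresses a fixed coefficient of K v through v, so it
      converges to that of K (-y). Once n exceeds |j| it is also among the coefficients already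
      known to be small.\<close>
    moreover have "K (- y) = 0"
    proof (rule trig_total)
      fix j
      have "(\<lambda>i. cinner (v (\<sigma> i)) (K (trig j)) / (2 * pi)) \<longlonglongrightarrow> cinner (- y) (K (trig j)) / (2 * pi)"
        by (intro tendsto_divide tendsto_cinner_left v_lim tendsto_const) auto
      then have l1: "(\<lambda>i. coef (K (v (\<sigma> i))) j) \<longlonglongrightarrow> coef (K (- y)) j"
        by (simp add: coef_def K_self_adjoint)
      have "(\<lambda>i. coef (K (v (\<sigma> i))) j) \<longlonglongrightarrow> 0"
      proof (rule Lim_null_comparison)
        have "(\<lambda>i. sqrt (inverse (real (Suc i)))) \<longlonglongrightarrow> sqrt 0"
          by (intro tendsto_real_sqrt LIMSEQ_inverse_real_of_nat)
        from LIMSEQ_subseq_LIMSEQ[OF this \<sigma>(1)]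
        show "(\<lambda>i. sqrt (inverse (real (Suc (\<sigma> i))))) \<longlonglongrightarrow> 0" by (simp add: o_def)
        have "eventually (\<lambda>i. n (\<sigma> i) \<ge> nat \<bar>j\<bar>) sequentially"
          using n\<sigma> by (simp add: filterlim_at_top)
        then show "eventually (\<lambda>i. norm (coef (K (v (\<sigma> i))) j) \<le> sqrt (inverse (real (Suc (\<sigma> i))))) sequentially"
        proof eventually_elim
          case (elim i)
          have "1 * (cmod (coef (K (v (\<sigma> i))) j))\<^sup>2 \<le> (weight j)\<^sup>2 * (cmod (coef (K (v (\<sigma> i))) j))\<^sup>2"
            using weight_ge_1[of j] by (intro mult_right_mono) auto
          also have "\<dots> \<le> ?S (n (\<sigma> i)) (v (\<sigma> i))"
            by (rule member_le_sum) (use elim in auto)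
          also have "\<dots> \<le> inverse (real (Suc (\<sigma> i)))" using vS[of "\<sigma> i"] by (simp add: divide_inverse)
          finally show ?case by (intro real_le_rsqrt) simp
        qed
      qed
      with l1 show "coef (K (- y)) j = 0" by (rule LIMSEQ_unique)
    qed
    ultimately show False using K_inj[of "- y"] by simp
  qed
  then show ?thesis using that by blast
qed

text \<open>A symmetric injective map of a finite-dimensional space is onto: if v is the component
  of y orthogonal to the range, testing v against L (L v) gives |L v|^2 = 0.\<close>

lemma surjective_on_trig_polys:
  assumes L: "\<And>p. p \<in> trig_polys n \<Longrightarrow> L p \<in> trig_polys n"
    and lin: "Vector_Spaces.linear cscale cscale L"
    and sym: "\<And>p v. p \<in> trig_polys n \<Longrightarrow> v \<in> trig_polys n \<Longrightarrow> cinner (L p) v = cinner p (L v)"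
    and inj: "\<And>v. v \<in> trig_polys n \<Longrightarrow> L v = 0 \<Longrightarrow> v = 0"
  shows "L ` trig_polys n = trig_polys n"
proof
  interpret l: Vector_Spaces.linear cscale cscale L by (rule lin)
  show "L ` trig_polys n \<subseteq> trig_polys n" using L by auto
  have img: "L ` trig_polys n = l2.span (L ` trig ` {- int n..int n})"
    unfolding trig_polys_def by (simp add: l.span_image)
  show "trig_polys n \<subseteq> L ` trig_polys n"
  proof
    fix y assume y: "y \<in> trig_polys n"
    obtain p where p: "p \<in> L ` trig_polys n" "\<And>v. v \<in> L ` trig_polys n \<Longrightarrow> cinner (y - p) v = 0"
      using span_projection[of "L ` trig ` {- int n..int n}" y] unfolding img by auto
    define v where "v = y - p"
    have v: "v \<in> trig_polys n"
      unfolding v_def using p(1) L y by (intro l2.subspace_diff[OF subspace_trig_polys]) auto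
    have "cinner v (L (L v)) = 0" using p(2)[of "L (L v)"] v L by (simp add: v_def)
    then have "cinner (L v) (L v) = 0" using sym[OF v L[OF v]] by simp
    then have "v = 0" using inj[OF v] by (simp add: cinner_self)
    then show "y \<in> L ` trig_polys n" using p(1) by (simp add: v_def)
  qed
qed

section \<open>The three discrete problems\<close>

lemma linear_fourier_proj: "Vector_Spaces.linear cscale cscale (fourier_proj n)"
proof unfold_locales
  show "fourier_proj n (f + g) = fourier_proj n f + fourier_proj n g" for f g
    by (rule l2_eq_coefI) (simp add: coef_add coef_fourier_proj)
  show "fourier_proj n (cscale c f) = cscale c (fourier_proj n f)" for c f
    by (rule l2_eq_coefI) (simp add: coef_cscale coef_fourier_proj)
qed

lemma fourier_proj_zero [simp]: "fourier_proj n 0 = 0"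
  by (rule l2_eq_coefI) (simp add: coef_fourier_proj)

text \<open>On T_n the discrete operator is K itself, since both projections act as the identity
  there.\<close>

lemma proj_solution_LS:
  obtains x where "x \<in> trig_polys n" "proj_solution LS K n g = x" "K x = orth_proj (K ` trig_polys n) g"
proof -
  let ?Y = "K ` trig_polys n"
  have Y: "?Y = l2.span (K ` trig ` {- int n..int n})" unfolding trig_polys_def by (rule K_image_span)
  have "orth_proj ?Y g \<in> ?Y" unfolding Y by (rule orth_proj_span) auto
  then obtain x where x: "x \<in> trig_polys n" "K x = orth_proj ?Y g" by (metis imageE)
  have A: "discrete_op LS K n z = K z" if "z \<in> trig_polys n" for z
    using that by (simp add: discrete_op_def fourier_proj_id orth_proj_idem[OF subspace_K_image])
  have "proj_solution LS K n g = x"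
    unfolding proj_solution_def
  proof (rule moore_penrose_eqI)
    show "l2.subspace (trial_space LS K n)" by (simp add: subspace_trig_polys)
    have zero: "0 \<in> trig_polys n" by (rule l2.subspace_0[OF subspace_trig_polys])
    show "discrete_op LS K n 0 = 0" using A[OF zero] by simp
    show "inj_on (discrete_op LS K n) (trial_space LS K n)"
      by (rule inj_onI) (simp add: A K_eq_iff)
    show "x \<in> trial_space LS K n" using x by simp
    have "discrete_op LS K n ` trial_space LS K n = ?Y" by (auto simp: A image_iff)
    then show "l2.subspace (discrete_op LS K n ` trial_space LS K n)" by (simp add: subspace_K_image)
    show "discrete_op LS K n x = orth_proj (test_space LS K n) g" using A[OF x(1)] x(2) by simp
  qed
  with x that show ?thesis by blast
qed

text \<open>P_n K K is positive definite on T_n, with quadratic form |K v|^2, so injectivity of K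
  suffices for every n.\<close>

lemma DLS_surjective: "(\<lambda>p. fourier_proj n (K (K p))) ` trig_polys n = trig_polys n"
proof (rule surjective_on_trig_polys)
  interpret l: Vector_Spaces.linear cscale cscale K by (rule linear_K)
  interpret P: Vector_Spaces.linear cscale cscale "fourier_proj n" by (rule linear_fourier_proj)
  show "Vector_Spaces.linear cscale cscale (\<lambda>p. fourier_proj n (K (K p)))"
    by unfold_locales (simp_all add: l.add l.scale P.add P.scale)
  show "cinner (fourier_proj n (K (K p))) v = cinner p (fourier_proj n (K (K v)))"
    if "p \<in> trig_polys n" "v \<in> trig_polys n" for p v
    using that by (simp add: cinner_fourier_proj_left cinner_fourier_proj_right K_self_adjoint)
  show "v = 0" if v: "v \<in> trig_polys n" "fourier_proj n (K (K v)) = 0" for v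
  proof -
    have "cinner (K v) (K v) = cinner (fourier_proj n (K (K v))) v"
      using v(1) by (simp add: cinner_fourier_proj_left K_self_adjoint)
    then show ?thesis using v(2) by (simp add: cinner_self K_inj)
  qed
qed (rule fourier_proj_in)

lemma proj_solution_DLS:
  obtains p where "p \<in> trig_polys n" "proj_solution DLS K n g = K p" "fourier_proj n (K (K p)) = fourier_proj n g"
proof -
  have "fourier_proj n g \<in> (\<lambda>p. fourier_proj n (K (K p))) ` trig_polys n"
    unfolding DLS_surjective by (rule fourier_proj_in)
  then obtain p where p: "p \<in> trig_polys n" "fourier_proj n (K (K p)) = fourier_proj n g" by auto
  have A: "discrete_op DLS K n z = fourier_proj n (K z)" if "z \<in> K ` trig_polys n" for z
    using that by (simp add: discrete_op_def adjoint_op_K orth_proj_idem[OF subspace_K_image])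
  have zero: "0 \<in> K ` trig_polys n" by (rule l2.subspace_0[OF subspace_K_image])
  have "proj_solution DLS K n g = K p"
    unfolding proj_solution_def
  proof (rule moore_penrose_eqI)
    show "l2.subspace (trial_space DLS K n)" by (simp add: adjoint_op_K subspace_K_image)
    show "discrete_op DLS K n 0 = 0" using A[OF zero] by simp
    show "inj_on (discrete_op DLS K n) (trial_space DLS K n)"
    proof (rule inj_onI)
      fix a b assume "a \<in> trial_space DLS K n" "b \<in> trial_space DLS K n"
        and eq: "discrete_op DLS K n a = discrete_op DLS K n b"
      then obtain a' b' where ab: "a = K a'" "b = K b'" "a' \<in> trig_polys n" "b' \<in> trig_polys n"
        by (auto simp: adjoint_op_K)
      define v where "v = a' - b'"
      have v: "v \<in> trig_polys n" unfolding v_def by (intro l2.subspace_diff[OF subspace_trig_polys] ab)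
      have "fourier_proj n (K a) = fourier_proj n (K b)" using eq A ab by auto
      then have "fourier_proj n (K (K v)) = 0"
        unfolding v_def ab K_diff fourier_proj_diff[symmetric] by simp
      moreover have "cinner (K v) (K v) = cinner (fourier_proj n (K (K v))) v"
        using v by (simp add: cinner_fourier_proj_left K_self_adjoint)
      ultimately have "K v = 0" by (simp add: cinner_self)
      then show "a = b" by (simp add: ab v_def K_diff)
    qed
    show "K p \<in> trial_space DLS K n" using p by (simp add: adjoint_op_K)
    have "discrete_op DLS K n ` trial_space DLS K n = (\<lambda>p. fourier_proj n (K (K p))) ` trig_polys n"
      unfolding trial_space.simps adjoint_op_K image_image by (rule image_cong[OF refl]) (simp add: A)
    then show "l2.subspace (discrete_op DLS K n ` trial_space DLS K n)"
      unfolding DLS_surjective by (simp add: subspace_trig_polys)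
    show "discrete_op DLS K n (K p) = orth_proj (test_space DLS K n) g" using A[of "K p"] p by simp
  qed
  with p that show ?thesis by blast
qed

text \<open>Here the quadratic form has no sign, so injectivity of P_n K on T_n is an assumption;
  the stability estimate provides it for large n.\<close>

lemma BG_surjective:
  assumes inj: "\<And>v. v \<in> trig_polys n \<Longrightarrow> fourier_proj n (K v) = 0 \<Longrightarrow> v = 0"
  shows "(\<lambda>p. fourier_proj n (K p)) ` trig_polys n = trig_polys n"
proof (rule surjective_on_trig_polys)
  interpret l: Vector_Spaces.linear cscale cscale K by (rule linear_K)
  interpret P: Vector_Spaces.linear cscale cscale "fourier_proj n" by (rule linear_fourier_proj)
  show "Vector_Spaces.linear cscale cscale (\<lambda>p. fourier_proj n (K p))"
    by unfold_locales (simp_all add: l.add l.scale P.add P.scale)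
  show "cinner (fourier_proj n (K p)) v = cinner p (fourier_proj n (K v))"
    if "p \<in> trig_polys n" "v \<in> trig_polys n" for p v
    using that by (simp add: cinner_fourier_proj_left cinner_fourier_proj_right K_self_adjoint)
qed (use fourier_proj_in inj in auto)

lemma proj_solution_BG:
  assumes inj: "\<And>v. v \<in> trig_polys n \<Longrightarrow> fourier_proj n (K v) = 0 \<Longrightarrow> v = 0"
  obtains x where "x \<in> trig_polys n" "proj_solution BG K n g = x" "fourier_proj n (K x) = fourier_proj n g"
proof -
  have surj: "(\<lambda>p. fourier_proj n (K p)) ` trig_polys n = trig_polys n"
    by (rule BG_surjective) (rule inj)
  have "fourier_proj n g \<in> (\<lambda>p. fourier_proj n (K p)) ` trig_polys n"
    unfolding surj by (rule fourier_proj_in)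
  then obtain x where x: "x \<in> trig_polys n" "fourier_proj n (K x) = fourier_proj n g" by auto
  have A: "discrete_op BG K n z = fourier_proj n (K z)" if "z \<in> trig_polys n" for z
    using that by (simp add: discrete_op_def fourier_proj_id)
  have zero: "0 \<in> trig_polys n" by (rule l2.subspace_0[OF subspace_trig_polys])
  have "proj_solution BG K n g = x"
    unfolding proj_solution_def
  proof (rule moore_penrose_eqI)
    show "l2.subspace (trial_space BG K n)" by (simp add: subspace_trig_polys)
    show "discrete_op BG K n 0 = 0" using A[OF zero] by simp
    show "inj_on (discrete_op BG K n) (trial_space BG K n)"
    proof (rule inj_onI)
      fix a b assume ab: "a \<in> trial_space BG K n" "b \<in> trial_space BG K n"
        and eq: "discrete_op BG K n a = discrete_op BG K n b"
      have "a - b \<in> trig_polys n" using ab by (intro l2.subspace_diff[OF subspace_trig_polys]) auto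
      moreover have "fourier_proj n (K (a - b)) = 0"
        using eq ab by (simp add: A K_diff fourier_proj_diff[symmetric])
      ultimately show "a = b" using inj by fastforce
    qed
    show "x \<in> trial_space BG K n" using x by simp
    have "discrete_op BG K n ` trial_space BG K n = (\<lambda>p. fourier_proj n (K p)) ` trig_polys n"
      unfolding trial_space.simps by (rule image_cong[OF refl]) (simp add: A)
    then show "l2.subspace (discrete_op BG K n ` trial_space BG K n)"
      unfolding surj by (simp add: subspace_trig_polys)
    show "discrete_op BG K n x = orth_proj (test_space BG K n) g" using A[OF x(1)] x(2) by simp
  qed
  with x that show ?thesis by blast
qed

end

section \<open>Divergence\<close>

context smoothing_op
begin

lemma sobolev_1_weight:
  assumes "g \<notin> sobolev 1"
  obtains J where "(\<Sum>k\<in>{- int J..int J}. (weight k)\<^sup>2 * (cmod (coef g k))\<^sup>2) > c"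
proof -
  have "\<exists>n. \<not> (\<Sum>k\<in>{- int n..int n}. (1 + (real_of_int k)\<^sup>2) powr 1 * (cmod (coef g k))\<^sup>2) \<le> 2 * c"
    using assms unfolding sobolev_iff by blast
  then obtain n where n: "2 * c < (\<Sum>k\<in>{- int n..int n}. (1 + (real_of_int k)\<^sup>2) powr 1 * (cmod (coef g k))\<^sup>2)"
    by (auto simp: not_le)
  also have "\<dots> \<le> (\<Sum>k\<in>{- int n..int n}. 2 * (weight k)\<^sup>2 * (cmod (coef g k))\<^sup>2)"
  proof (intro sum_mono mult_right_mono)
    fix k :: int
    have "1 \<le> (weight k)\<^sup>2" using weight_ge_1[of k] by (simp add: one_le_power)
    moreover have "(real_of_int k)\<^sup>2 \<le> (weight k)\<^sup>2"
      by (subst abs_le_square_iff[symmetric]) (simp add: weight_def)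
    ultimately show "(1 + (real_of_int k)\<^sup>2) powr 1 \<le> 2 * (weight k)\<^sup>2"
      by (simp add: add_nonneg_nonneg)
  qed simp
  finally have "c < (\<Sum>k\<in>{- int n..int n}. (weight k)\<^sup>2 * (cmod (coef g k))\<^sup>2)"
    by (simp add: sum_distrib_left[symmetric] mult.assoc)
  then show ?thesis by (rule that)
qed

text \<open>For any level Z some finite H^1 partial sum of g exceeds H Z^2. Finitely many
  coefficients are involved, so the same holds for K (x n) eventually, and \<open>H1_bound\<close>
  pushes the norm of x n above Z.\<close>

lemma eventually_large:
  assumes g: "g \<notin> sobolev 1"
    and lim: "\<And>j. (\<lambda>n. coef (K (x n)) j) \<longlonglongrightarrow> coef g j"
  shows "filterlim (\<lambda>n. norm (x n)) at_top sequentially"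
  unfolding filterlim_at_top
proof
  fix Z :: real
  obtain J where J: "(\<Sum>k\<in>{- int J..int J}. (weight k)\<^sup>2 * (cmod (coef g k))\<^sup>2) > H * Z\<^sup>2"
    using sobolev_1_weight[OF g] by blast
  have "(\<lambda>n. \<Sum>k\<in>{- int J..int J}. (weight k)\<^sup>2 * (cmod (coef (K (x n)) k))\<^sup>2)
      \<longlonglongrightarrow> (\<Sum>k\<in>{- int J..int J}. (weight k)\<^sup>2 * (cmod (coef g k))\<^sup>2)"
    by (intro tendsto_intros lim)
  from order_tendstoD(1)[OF this J]
  show "eventually (\<lambda>n. Z \<le> norm (x n)) sequentially"
  proof eventually_elim
    case (elim n)
    then have "H * Z\<^sup>2 < H * (norm (x n))\<^sup>2" using H1_bound[where n = J and w = "x n"] by linarith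
    then have "Z\<^sup>2 < (norm (x n))\<^sup>2" using H_pos by simp
    then have "\<bar>Z\<bar> < \<bar>norm (x n)\<bar>" by (metis power2_abs power_less_imp_less_base abs_ge_zero)
    then show ?case by simp
  qed
qed

text \<open>On T_n the weights are at most n; replacing them by n costs exactly the factor that
  becomes the first order rate.\<close>

lemma inverse_inequality:
  obtains C N where "C > 0" "N \<ge> 1" "\<And>n w. n \<ge> N \<Longrightarrow> w \<in> trig_polys n \<Longrightarrow> norm w \<le> C * real n * norm (fourier_proj n (K w))"
    "\<And>n w. n \<ge> N \<Longrightarrow> w \<in> trig_polys n \<Longrightarrow>
    (norm w)\<^sup>2 \<le> C * (\<Sum>j\<in>{- int n..int n}. (weight j)\<^sup>2 * (cmod (coef (K w) j))\<^sup>2)"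
proof -
  obtain C N where C: "C > 0" and st: "\<And>n w. n \<ge> N \<Longrightarrow> w \<in> trig_polys n \<Longrightarrow>
    (norm w)\<^sup>2 \<le> C * (\<Sum>j\<in>{- int n..int n}. (weight j)\<^sup>2 * (cmod (coef (K w) j))\<^sup>2)"
    using stability by blast
  \<comment> \<open>D \<ge> 1 gives D \<le> D^2, so no root of the constant appears after squaring.
    Likewise N is raised to at least 1, which keeps \<open>weight 0\<close> = 1 below n.\<close>
  define D where "D = max C 1"
  have D: "D \<ge> C" "D \<ge> 1" by (auto simp: D_def)
  have st': "(norm w)\<^sup>2 \<le> D * (\<Sum>j\<in>{- int n..int n}. (weight j)\<^sup>2 * (cmod (coef (K w) j))\<^sup>2)"
    if "n \<ge> max N 1" "w \<in> trig_polys n" for n w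
  proof -
    have "(norm w)\<^sup>2 \<le> C * (\<Sum>j\<in>{- int n..int n}. (weight j)\<^sup>2 * (cmod (coef (K w) j))\<^sup>2)"
      using st[of n w] that by simp
    also have "\<dots> \<le> D * (\<Sum>j\<in>{- int n..int n}. (weight j)\<^sup>2 * (cmod (coef (K w) j))\<^sup>2)"
      using D by (intro mult_right_mono sum_nonneg) auto
    finally show ?thesis .
  qed
  have "norm w \<le> D * real n * norm (fourier_proj n (K w))" if n: "n \<ge> max N 1" and w: "w \<in> trig_polys n" for n w
  proof (rule power2_le_imp_le)
    have "(norm w)\<^sup>2 \<le> D * (\<Sum>j\<in>{- int n..int n}. (weight j)\<^sup>2 * (cmod (coef (K w) j))\<^sup>2)" by (rule st'[OF n w])
    also have "\<dots> \<le> D * (\<Sum>j\<in>{- int n..int n}. (real n)\<^sup>2 * (cmod (coef (K w) j))\<^sup>2)"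
      using n D by (intro mult_left_mono sum_mono mult_right_mono power_mono) (auto simp: weight_def)
    also have "\<dots> = D * (real n)\<^sup>2 * (\<Sum>j\<in>{- int n..int n}. (cmod (coef (K w) j))\<^sup>2)"
      by (simp add: sum_distrib_left mult.assoc)
    also have "\<dots> \<le> D * (real n)\<^sup>2 * (norm (fourier_proj n (K w)))\<^sup>2"
    proof (rule mult_left_mono)
      let ?s = "\<Sum>j\<in>{- int n..int n}. (cmod (coef (K w) j))\<^sup>2"
      have "1 * ?s \<le> (2 * pi) * ?s" using pi_gt3 by (intro mult_right_mono sum_nonneg) auto
      then show "?s \<le> (norm (fourier_proj n (K w)))\<^sup>2" by (simp add: norm_fourier_proj)
    qed (use D in auto)
    also have "\<dots> \<le> D\<^sup>2 * (real n)\<^sup>2 * (norm (fourier_proj n (K w)))\<^sup>2"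
      using D by (intro mult_right_mono) (auto simp: power2_eq_square)
    finally show "(norm w)\<^sup>2 \<le> (D * real n * norm (fourier_proj n (K w)))\<^sup>2" by (simp add: power_mult_distrib)
  qed (use D in auto)
  then show ?thesis using that[of D "max N 1"] st' D by auto
qed

text \<open>A duality argument: the residual d is orthogonal to K(T_n), so its product with exp(ijt)
  sees only the error of approximating exp(ijt) from that space. The Galerkin choice of w, P_n K w =
  \<open>trig j\<close>, leaves an error h with frequencies above n only, whose L^2 norm is at most
  1/n times an H^1 norm. The stability bound for w contributes the factor
  \<open>weight j\<close>.\<close>

lemma LS_residual_coef:
  assumes C: "C > 0" and n: "n \<ge> 1" "\<bar>j\<bar> \<le> int n"
    and st: "\<And>w. w \<in> trig_polys n \<Longrightarrow>
    (norm w)\<^sup>2 \<le> C * (\<Sum>j\<in>{- int n..int n}. (weight j)\<^sup>2 * (cmod (coef (K w) j))\<^sup>2)"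
  defines "Y \<equiv> K ` trig_polys n"
  shows "cmod (coef (g - orth_proj Y g) j) \<le> norm g * sqrt (2 * pi * H * C) * weight j / real n"
proof -
  have inj: "v = 0" if v: "v \<in> trig_polys n" "fourier_proj n (K v) = 0" for v
  proof -
    have "coef (K v) j = 0" if "j \<in> {- int n..int n}" for j
      using coef_fourier_proj[of n "K v" j] v(2) that by simp
    then have "(norm v)\<^sup>2 \<le> 0" using st[OF v(1)] by simp
    then show ?thesis by simp
  qed
  have "trig j \<in> (\<lambda>p. fourier_proj n (K p)) ` trig_polys n"
    by (subst BG_surjective[of n]) (use inj n in \<open>auto intro: trig_in_trig_polys\<close>)
  then obtain w where w: "w \<in> trig_polys n" "fourier_proj n (K w) = trig j" by auto
  have cw: "coef (K w) k = (if k = j then 1 else 0)" if "k \<in> {- int n..int n}" for k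
    using coef_fourier_proj[of n "K w" k] that by (cases "k = j") (auto simp: w(2) coef_trig)
  have "(\<Sum>k\<in>{- int n..int n}. (weight k)\<^sup>2 * (cmod (coef (K w) k))\<^sup>2)
      = (\<Sum>k\<in>{- int n..int n}. if k = j then (weight k)\<^sup>2 else 0)"
    by (intro sum.cong refl) (simp add: cw)
  also have "\<dots> = (weight j)\<^sup>2" using n(2) by (simp add: abs_le_iff)
  finally have nw: "(norm w)\<^sup>2 \<le> C * (weight j)\<^sup>2" using st[OF w(1)] by simp
  define h where "h = trig j - K w"
  have ch: "coef h k = (if k \<in> {- int n..int n} then 0 else - coef (K w) k)" for k
    using cw n by (auto simp: h_def coef_diff coef_trig)
  have "(norm h)\<^sup>2 \<le> 2 * pi * (H * (norm w)\<^sup>2 / (real n)\<^sup>2)"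
  proof (rule norm_le_of_coef)
    fix N
    have "(real n)\<^sup>2 * (\<Sum>k\<in>{- int N..int N}. (cmod (coef h k))\<^sup>2)
        \<le> (\<Sum>k\<in>{- int N..int N}. (weight k)\<^sup>2 * (cmod (coef (K w) k))\<^sup>2)"
      unfolding sum_distrib_left
    proof (rule sum_mono)
      fix k
      show "(real n)\<^sup>2 * (cmod (coef h k))\<^sup>2 \<le> (weight k)\<^sup>2 * (cmod (coef (K w) k))\<^sup>2"
      proof (cases "k \<in> {- int n..int n}")
        case False
        then have "real n \<le> weight k" by (auto simp: weight_def)
        then show ?thesis using False by (simp add: ch mult_right_mono)
      qed (simp add: ch)
    qed
    also have "\<dots> \<le> H * (norm w)\<^sup>2" by (rule H1_bound)
    finally show "(\<Sum>k\<in>{- int N..int N}. (cmod (coef h k))\<^sup>2) \<le> H * (norm w)\<^sup>2 / (real n)\<^sup>2"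
      using n by (simp add: field_simps)
  qed
  also have "\<dots> \<le> 2 * pi * (H * (C * (weight j)\<^sup>2) / (real n)\<^sup>2)"
    using nw H_pos by (intro mult_left_mono divide_right_mono) auto
  also have "\<dots> = (sqrt (2 * pi * H * C) * weight j / real n)\<^sup>2"
    using H_pos C by (simp add: power_mult_distrib power_divide)
  finally have nh: "norm h \<le> sqrt (2 * pi * H * C) * weight j / real n"
  proof (rule power2_le_imp_le)
    have "0 \<le> weight j" using weight_pos[of j] by simp
    then show "0 \<le> sqrt (2 * pi * H * C) * weight j / real n" using H_pos C by simp
  qed
  define d where "d = g - orth_proj Y g"
  have Y: "Y = l2.span (K ` trig ` {- int n..int n})"
    unfolding Y_def trig_polys_def by (rule K_image_span)
  have orth: "cinner d v = 0" if "v \<in> Y" for v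
    using orth_proj_span_orthogonal[of "K ` trig ` {- int n..int n}" v g] that unfolding Y d_def by auto
  have pin: "orth_proj Y g \<in> Y" unfolding Y by (rule orth_proj_span) auto
  have "norm d \<le> norm g"
  proof (rule power2_le_imp_le)
    have "(norm (d + orth_proj Y g))\<^sup>2 = (norm d)\<^sup>2 + (norm (orth_proj Y g))\<^sup>2"
      by (rule norm_pythagoras[OF orth[OF pin]])
    then show "(norm d)\<^sup>2 \<le> (norm g)\<^sup>2" by (simp add: d_def)
  qed simp
  have "cinner d (trig j) = cinner d h + cinner d (K w)"
    by (simp add: h_def cinner_diff_right)
  also have "cinner d (K w) = 0" using w(1) by (intro orth) (simp add: Y_def)
  finally have "cmod (2 * pi * coef d j) = cmod (cinner d h)" by (simp add: cinner_trig_right)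
  also have "\<dots> \<le> norm d * norm h" by (rule norm_cinner_le)
  also have "\<dots> \<le> norm g * (sqrt (2 * pi * H * C) * weight j / real n)"
    by (intro mult_mono nh \<open>norm d \<le> norm g\<close>) auto
  finally have *: "2 * pi * cmod (coef d j) \<le> norm g * (sqrt (2 * pi * H * C) * weight j / real n)"
    by (simp add: norm_mult)
  have "1 * cmod (coef d j) \<le> 2 * pi * cmod (coef d j)" using pi_gt3 by (intro mult_right_mono) auto
  then show ?thesis using * by (simp add: d_def mult.assoc)
qed

lemma norm_orth_proj_K_le: "norm (orth_proj (K ` trig_polys n) g) \<le> norm g"
proof -
  let ?Y = "K ` trig_polys n"
  have Y: "?Y = l2.span (K ` trig ` {- int n..int n})"
    unfolding trig_polys_def by (rule K_image_span)
  have pin: "orth_proj ?Y g \<in> ?Y" unfolding Y by (rule orth_proj_span) auto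
  have "cinner (g - orth_proj ?Y g) (orth_proj ?Y g) = 0"
    using orth_proj_span_orthogonal[of "K ` trig ` {- int n..int n}" "orth_proj ?Y g" g] pin unfolding Y by auto
  from norm_pythagoras[OF this] have "(norm (orth_proj ?Y g))\<^sup>2 \<le> (norm g)\<^sup>2" by simp
  then show ?thesis by (rule power2_le_imp_le) simp
qed

theorem divergence:
  assumes g: "g \<notin> sobolev 1"
  shows "filterlim (\<lambda>n. norm (proj_solution \<tau> K n g)) at_top sequentially"
    and "(\<lambda>n. norm (proj_solution \<tau> K n g)) \<in> O(\<lambda>n. real n)"
proof -
  obtain C N where C: "C > 0" "N \<ge> 1"
    and inv: "\<And>n w. n \<ge> N \<Longrightarrow> w \<in> trig_polys n \<Longrightarrow> norm w \<le> C * real n * norm (fourier_proj n (K w))"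
    and st: "\<And>n w. n \<ge> N \<Longrightarrow> w \<in> trig_polys n \<Longrightarrow>
    (norm w)\<^sup>2 \<le> C * (\<Sum>j\<in>{- int n..int n}. (weight j)\<^sup>2 * (cmod (coef (K w) j))\<^sup>2)"
    using inverse_inequality by blast
  have BGinj: "v = 0" if "n \<ge> N" "v \<in> trig_polys n" "fourier_proj n (K v) = 0" for n v
    using inv[OF that(1,2)] that(3) by simp
  let ?x = "\<lambda>n. proj_solution \<tau> K n g"
  have bound: "norm (?x n) \<le> C * norm g * real n" if n: "n \<ge> N" for n
  proof (cases \<tau>)
    case LS
    obtain x where x: "x \<in> trig_polys n" "proj_solution LS K n g = x" "K x = orth_proj (K ` trig_polys n) g"
      by (rule proj_solution_LS)
    have "norm x \<le> C * real n * norm (fourier_proj n (K x))" by (rule inv[OF n x(1)])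
    also have "\<dots> \<le> C * real n * norm g"
    proof (rule mult_left_mono)
      show "norm (fourier_proj n (K x)) \<le> norm g"
        using norm_fourier_proj_le[of n "K x"] norm_orth_proj_K_le[of n g] x(3) by simp
    qed (use C in auto)
    finally show ?thesis using x(2) LS by (simp add: mult_ac)
  next
    case DLS
    obtain p where p: "p \<in> trig_polys n" "proj_solution DLS K n g = K p" "fourier_proj n (K (K p)) = fourier_proj n g"
      by (rule proj_solution_DLS)
    \<comment> \<open>The solution K p need not lie in T_n, so the inverse inequality is applied to
      p: |K p|^2 = |(g, p)| \<le> |g| |p| \<le> C n |g| |K p|.\<close>
    have "cinner (K p) (K p) = cinner (fourier_proj n (K (K p))) p"
      using p(1) by (simp add: cinner_fourier_proj_left K_self_adjoint)
    also have "\<dots> = cinner g p" using p by (simp add: cinner_fourier_proj_left)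
    finally have "(norm (K p))\<^sup>2 = cmod (cinner g p)"
      by (metis abs_of_nonneg cinner_self norm_of_real zero_le_power2)
    also have "\<dots> \<le> norm g * norm p" by (rule norm_cinner_le)
    also have "\<dots> \<le> norm g * (C * real n * norm (K p))"
    proof (rule mult_left_mono)
      have "norm p \<le> C * real n * norm (fourier_proj n (K p))" by (rule inv[OF n p(1)])
      also have "\<dots> \<le> C * real n * norm (K p)" using C by (intro mult_left_mono norm_fourier_proj_le) auto
      finally show "norm p \<le> C * real n * norm (K p)" .
    qed simp
    finally have "norm (K p) * norm (K p) \<le> C * norm g * real n * norm (K p)"
      by (simp add: power2_eq_square mult_ac)
    then have "norm (K p) \<le> C * norm g * real n"
      using C by (cases "norm (K p) = 0") (auto simp: mult_le_cancel_right)
    then show ?thesis using p(2) DLS by simp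
  next
    case BG
    obtain x where x: "x \<in> trig_polys n" "proj_solution BG K n g = x" "fourier_proj n (K x) = fourier_proj n g"
      using proj_solution_BG[of n g] BGinj[OF n] by blast
    have "norm x \<le> C * real n * norm (fourier_proj n (K x))" by (rule inv[OF n x(1)])
    also have "\<dots> \<le> C * real n * norm g"
      using C norm_fourier_proj_le[of n g] x(3) by (intro mult_left_mono) auto
    finally show ?thesis using x(2) BG by (simp add: mult_ac)
  qed
  show "(\<lambda>n. norm (proj_solution \<tau> K n g)) \<in> O(\<lambda>n. real n)"
    by (rule bigoI[of _ "C * norm g"])
       (use bound in \<open>auto simp: eventually_sequentially intro!: exI[of _ N]\<close>)
  \<comment> \<open>Dual least squares and Bubnov-Galerkin reproduce the coefficients with |j| \<le>
    n exactly; for least squares the residual bound of order 1/n takes the place of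
    equality.\<close>
  have lim: "(\<lambda>n. coef (K (?x n)) j) \<longlonglongrightarrow> coef g j" for j
  proof -
    have exact: "coef (K y) j = coef g j"
      if "n \<ge> nat \<bar>j\<bar>" "fourier_proj n (K y) = fourier_proj n g" for n y
      using coef_fourier_proj[of n "K y" j] coef_fourier_proj[of n g j] that by (auto split: if_splits)
    show ?thesis
    proof (cases \<tau>)
      case LS
      define c where "c = norm g * sqrt (2 * pi * H * C) * weight j"
      have "(\<lambda>n. coef g j - coef (K (?x n)) j) \<longlonglongrightarrow> 0"
      proof (rule Lim_null_comparison)
        show "eventually (\<lambda>n. norm (coef g j - coef (K (?x n)) j) \<le> c / real n) sequentially"
          using eventually_ge_at_top[of "max N (nat \<bar>j\<bar>)"]
        proof eventually_elim
          case (elim n)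
          obtain x where x: "x \<in> trig_polys n" "proj_solution LS K n g = x" "K x = orth_proj (K ` trig_polys n) g"
            by (rule proj_solution_LS)
          have "cmod (coef (g - orth_proj (K ` trig_polys n) g) j) \<le> c / real n"
            unfolding c_def by (rule LS_residual_coef[OF C(1)]) (use elim C st in auto)
          then show ?case using x LS by (simp add: coef_diff)
        qed
        show "(\<lambda>n. c / real n) \<longlonglongrightarrow> 0" by (rule lim_const_over_n)
      qed
      from tendsto_diff[OF tendsto_const[of "coef g j"] this] show ?thesis by simp
    next
      case DLS
      have "coef (K (?x n)) j = coef g j" if "n \<ge> nat \<bar>j\<bar>" for n
      proof -
        obtain p where "proj_solution DLS K n g = K p" "fourier_proj n (K (K p)) = fourier_proj n g"
          using proj_solution_DLS by metis
        then show ?thesis using exact[OF that] DLS by simp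
      qed
      then show ?thesis by (intro tendsto_eventually eventually_sequentiallyI[of "nat \<bar>j\<bar>"])
    next
      case BG
      have "coef (K (?x n)) j = coef g j" if "n \<ge> max N (nat \<bar>j\<bar>)" for n
      proof -
        have "N \<le> n" "nat \<bar>j\<bar> \<le> n" using that by auto
        obtain x where "proj_solution BG K n g = x" "fourier_proj n (K x) = fourier_proj n g"
          using proj_solution_BG[of n g] BGinj[OF \<open>N \<le> n\<close>] by blast
        then show ?thesis using exact[OF \<open>nat \<bar>j\<bar> \<le> n\<close>] BG by simp
      qed
      then show ?thesis by (intro tendsto_eventually eventually_sequentiallyI[of "max N (nat \<bar>j\<bar>)"])
    qed
  qed
  show "filterlim (\<lambda>n. norm (proj_solution \<tau> K n g)) at_top sequentially"
    by (rule eventually_large[OF g lim])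
qed

end

section \<open>Application to Symm's operator and optimality on the circle\<close>

lemma symm_op_smoothing_op:
  assumes \<Omega>: "open \<Omega>" "bounded \<Omega>" and \<gamma>: "parametrized_boundary \<Omega> \<gamma>"
    and z0: "z0 \<in> \<Omega>" "\<And>x. x \<in> frontier \<Omega> \<Longrightarrow> cmod (x - z0) \<noteq> 1"
  obtains B where "smoothing_op (symm_op \<gamma>) B"
proof -
  have pb: "\<And>s. \<gamma> (s + 2 * pi) = \<gamma> s" "C_class 3 \<gamma>" "inj_on \<gamma> {0..<2 * pi}"
    "\<And>s. vector_derivative \<gamma> (at s) \<noteq> 0" "\<gamma> ` {0..2 * pi} = frontier \<Omega>"
    using \<gamma> unfolding parametrized_boundary_def by blast+
  obtain \<gamma>' m M where "regular_loop \<gamma> \<gamma>' m M"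
    by (rule regular_loop_exists[OF pb(1-4)])
  then interpret regular_loop \<gamma> \<gamma>' m M .
  obtain B where B: "\<And>n. (\<Sum>j\<in>{- int n..int n}. (weight j)\<^sup>2 *
      (norm (symm_op \<gamma> (trig j) - cscale (of_real (1 / weight j)) (trig j)))\<^sup>2) \<le> B"
    by (rule symm_op_trig_smoothing) blast
  have "smoothing_op (symm_op \<gamma>) B"
  proof
    show "symm_op \<gamma> f = 0 \<Longrightarrow> f = 0" for f
      by (rule symm_op_injective[OF \<Omega> pb(5) z0(1)]) (use z0(2) in auto)
  qed (rule symm_op_add symm_op_cscale symm_op_self_adjoint B)+
  then show ?thesis by (rule that)
qed

lemma circle_param_eq: "circle_param = (\<lambda>s. 0 + of_real (exp (- 1 / 2)) * cis s)"
  by (auto simp: circle_param_def cis.ctr)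

text \<open>Compared with the unit circle the kernel gains the constant ln exp(-1/2) = -1/2. It acts
  on the constants only and adds (1/pi) (1/2) (2 pi) = 1 to their eigenvalue 0.\<close>

lemma symm_op_circle_trig: "symm_op circle_param (trig j) = cscale (of_real (1 / weight j)) (trig j)"
proof -
  let ?\<rho> = "exp (- 1 / 2) :: real"
  obtain m0 M0 where C: "regular_loop cis (\<lambda>s. \<i> * cis s) m0 M0" by (rule cis_loop)
  interpret C: regular_loop cis "\<lambda>s. \<i> * cis s" m0 M0 by (rule C)
  obtain m M where "regular_loop circle_param (\<lambda>s. of_real ?\<rho> * (\<i> * cis s)) m M"
    unfolding circle_param_eq using circle_loop[of ?\<rho> 0] by auto
  then interpret regular_loop circle_param "\<lambda>s. of_real ?\<rho> * (\<i> * cis s)" m M .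
  let ?e = "\<lambda>s. cis (of_int j * s)"
  have pot_eq: "- (1 / of_real pi) * pot ?e (circle_param t) = of_real (1 / weight j) * ?e t" for t
  proof -
    have i: "integrable per_measure ?e" by (rule sq_integrable_imp_integrable[OF sq_integrable_cis])
    have "pot ?e (circle_param t) = (\<integral>s. of_real (- 1 / 2) * ?e s + ?e s * of_real (ln (cmod (cis t - cis s))) \<partial>per_measure)"
      unfolding pot_def
    proof (rule integral_cong_AE)
      show "AE s in per_measure. ?e s * of_real (ln (cmod (circle_param t - circle_param s)))
          = of_real (- 1 / 2) * ?e s + ?e s * of_real (ln (cmod (cis t - cis s)))"
        using C.AE_neq[of "cis t"]
      proof eventually_elim
        case (elim s)
        have "circle_param t - circle_param s = of_real ?\<rho> * (cis t - cis s)"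
          by (simp add: circle_param_eq algebra_simps)
        then have eq: "ln (cmod (circle_param t - circle_param s)) = - 1 / 2 + ln (cmod (cis t - cis s))"
          using elim by (simp add: norm_mult ln_mult del: of_real_exp)
        show ?case unfolding eq of_real_add by (simp add: algebra_simps)
      qed
      show "(\<lambda>s. ?e s * of_real (ln (cmod (circle_param t - circle_param s)))) \<in> borel_measurable per_measure"
        using pot_integrable[OF sq_integrable_cis, of j "circle_param t"] by auto
      show "(\<lambda>s. of_real (- 1 / 2) * ?e s + ?e s * of_real (ln (cmod (cis t - cis s)))) \<in> borel_measurable per_measure"
        using C.pot_integrable[OF sq_integrable_cis, of j "cis t"] i by (intro borel_measurable_add) auto
    qed
    also have "\<dots> = of_real (- 1 / 2) * (\<integral>s. ?e s \<partial>per_measure) + C.pot ?e (cis t)"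
      using C.pot_integrable[OF sq_integrable_cis, of j "cis t"] i unfolding C.pot_def
      by (subst Bochner_Integration.integral_add) auto
    finally have "pot ?e (circle_param t) = of_real (- 1 / 2) * of_real (if j = 0 then 2 * pi else 0) + C.pot ?e (cis t)"
      unfolding integral_cis .
    moreover have "weight j = \<bar>of_int j\<bar>" if "j \<noteq> 0" using that by (auto simp: weight_def)
    ultimately show ?thesis unfolding pot_cis_on_circle by (auto simp: weight_def)
  qed
  show ?thesis
  proof (rule l2_eqI)
    have "AE t in per_measure. rep_l2 (symm_op circle_param (trig j)) t = - (1 / of_real pi) * pot ?e (circle_param t)"
      by (rule rep_symm_op_AE[OF _ sq_integrable_cis]) (use rep_trig[of j] in \<open>simp only: exp_int_eq_cis\<close>)
    then show "AE t in per_measure. rep_l2 (symm_op circle_param (trig j)) t = rep_l2 (cscale (of_real (1 / weight j)) (trig j)) t"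
      using rep_cscale[of "of_real (1 / weight j)" "trig j"] rep_trig[of j]
      by eventually_elim (simp only: pot_eq exp_int_eq_cis)
  qed
qed

text \<open>The general result supplies injectivity, with z0 = 0 because the radius is below 1;
  since the operator is diagonal, the bound can be replaced by 0.\<close>

lemma circle_smoothing_op: "smoothing_op (symm_op circle_param) 0"
proof -
  have "exp (- 1 / 2) < (1 :: real)" by simp
  then obtain B where "smoothing_op (symm_op circle_param) B"
    using symm_op_smoothing_op[OF open_ball bounded_ball parametrized_boundary_circle, of 0] by fastforce
  then interpret smoothing_op "symm_op circle_param" B .
  show ?thesis
    by unfold_locales (simp_all add: K_add K_cscale K_self_adjoint K_inj symm_op_circle_trig)
qed

text \<open>A diagonal operator maps T_n onto itself, so in all three methods the low coefficients
  of g are divided by the eigenvalues. The bound is Bessel's inequality with the factor 2 pi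
  dropped.\<close>

lemma proj_solution_circle:
  "norm (proj_solution \<tau> (symm_op circle_param) n g) \<ge>
     sqrt (\<Sum>k\<in>{- int n..int n}. (weight k)\<^sup>2 * (cmod (coef g k))\<^sup>2)"
proof -
  interpret smoothing_op "symm_op circle_param" 0 by (rule circle_smoothing_op)
  let ?K = "symm_op circle_param"
  have cK: "coef (?K w) j = coef w j / of_real (weight j)" for w j
  proof -
    have "D w j = 0" by (simp add: D_def U_def symm_op_circle_trig)
    then show ?thesis using weight_coef_K[of j w] weight_pos[of j] by (simp add: field_simps)
  qed
  have KT: "?K w \<in> trig_polys n" if "w \<in> trig_polys n" for w
    using that by (simp add: trig_polys_iff cK)
  have "fourier_proj n (?K (proj_solution \<tau> ?K n g)) = fourier_proj n g"
  proof (cases \<tau>)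
    case LS
    obtain x where x: "x \<in> trig_polys n" "proj_solution LS ?K n g = x" "?K x = orth_proj (?K ` trig_polys n) g"
      by (rule proj_solution_LS)
    have "?K ` trig_polys n = trig_polys n"
    proof
      show "trig_polys n \<subseteq> ?K ` trig_polys n"
      proof
        fix y assume y: "y \<in> trig_polys n"
        define w where "w = trig_sum {- int n..int n} (\<lambda>k. of_real (weight k) * coef y k)"
        have "w \<in> trig_polys n" by (simp add: w_def trig_polys_iff coef_trig_sum)
        moreover have "?K w = y"
          by (rule l2_eq_coefI) (use y weight_pos in \<open>auto simp: w_def cK coef_trig_sum trig_polys_iff less_imp_neq[symmetric]\<close>)
        ultimately show "y \<in> ?K ` trig_polys n" by blast
      qed
    qed (use KT in auto)
    then show ?thesis using x LS KT by (simp add: fourier_proj_id fourier_proj_in)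
  next
    case DLS
    then show ?thesis using proj_solution_DLS by metis
  next
    case BG
    have "v = 0" if "v \<in> trig_polys n" "fourier_proj n (?K v) = 0" for v
      using that K_inj[of v] by (simp add: fourier_proj_id KT)
    then show ?thesis using proj_solution_BG[of n g] BG by metis
  qed
  then have "coef (proj_solution \<tau> ?K n g) k = of_real (weight k) * coef g k" if "k \<in> {- int n..int n}" for k
    using coef_fourier_proj[of n "?K (proj_solution \<tau> ?K n g)" k] coef_fourier_proj[of n g k] that weight_pos[of k]
    by (simp add: cK field_simps)
  then have "(\<Sum>k\<in>{- int n..int n}. (weight k)\<^sup>2 * (cmod (coef g k))\<^sup>2)
      = (\<Sum>k\<in>{- int n..int n}. (cmod (coef (proj_solution \<tau> ?K n g) k))\<^sup>2)"
    by (intro sum.cong refl) (simp add: norm_mult power_mult_distrib)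
  also have "\<dots> \<le> (norm (proj_solution \<tau> ?K n g))\<^sup>2"
  proof -
    let ?s = "\<Sum>k\<in>{- int n..int n}. (cmod (coef (proj_solution \<tau> ?K n g) k))\<^sup>2"
    have "1 * ?s \<le> 2 * pi * ?s" using pi_gt3 by (intro mult_right_mono sum_nonneg) auto
    also have "\<dots> \<le> (norm (proj_solution \<tau> ?K n g))\<^sup>2" by (rule bessel) simp
    finally show ?thesis by simp
  qed
  finally show ?thesis by (simp add: real_le_lsqrt)
qed

text \<open>The coefficients k^(-1/2 - \<alpha>), k > 0, are square-summable, while their weighted
  squares k^(1 - 2 \<alpha>) add up to order n^(2 - 2 \<alpha>), twice the exponent wanted for the
  norm.\<close>

lemma slowly_decaying_coefficients:
  assumes \<alpha>: "0 < \<alpha>" "\<alpha> < 1 / 2"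
  obtains g where "\<And>n. n \<ge> 1 \<Longrightarrow>
    (real n / 2) powr (2 - 2 * \<alpha>) \<le> (\<Sum>k\<in>{- int n..int n}. (weight k)\<^sup>2 * (cmod (coef g k))\<^sup>2)"
proof -
  define a where "a k = (if k > 0 then complex_of_real (of_int k powr (- 1 / 2 - \<alpha>)) else 0)" for k :: int
  have a_sum: "(\<Sum>k\<in>{- int n..int n}. b k * (cmod (a k))\<^sup>2) = (\<Sum>i\<in>{1..n}. b (int i) * real i powr (- 1 - 2 * \<alpha>))"
    for b :: "int \<Rightarrow> real" and n
  proof -
    have "(\<Sum>k\<in>{- int n..int n}. b k * (cmod (a k))\<^sup>2) = (\<Sum>k\<in>int ` {1..n}. b k * (cmod (a k))\<^sup>2)"
    proof (rule sum.mono_neutral_right)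
      show "\<forall>k\<in>{- int n..int n} - int ` {1..n}. b k * (cmod (a k))\<^sup>2 = 0"
      proof
        fix k assume k: "k \<in> {- int n..int n} - int ` {1..n}"
        have "\<not> k > 0"
        proof
          assume "k > 0"
          then have "k = int (nat k)" "nat k \<in> {1..n}" using k by auto
          then show False using k by blast
        qed
        then show "b k * (cmod (a k))\<^sup>2 = 0" by (simp add: a_def)
      qed
    qed auto
    also have "\<dots> = (\<Sum>i\<in>{1..n}. b (int i) * (cmod (a (int i)))\<^sup>2)" by (simp add: sum.reindex)
    also have "\<dots> = (\<Sum>i\<in>{1..n}. b (int i) * real i powr (- 1 - 2 * \<alpha>))"
    proof (intro sum.cong refl)
      fix i assume "i \<in> {1..n}"
      then have "(cmod (a (int i)))\<^sup>2 = real i powr (- 1 / 2 - \<alpha>) * real i powr (- 1 / 2 - \<alpha>)"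
        by (simp add: a_def power2_eq_square)
      also have "\<dots> = real i powr (- 1 - 2 * \<alpha>)" by (simp flip: powr_add)
      finally show "b (int i) * (cmod (a (int i)))\<^sup>2 = b (int i) * real i powr (- 1 - 2 * \<alpha>)" by simp
    qed
    finally show ?thesis .
  qed
  have sm: "summable (\<lambda>i. real i powr (- 1 - 2 * \<alpha>))"
    using \<alpha> by (simp add: summable_real_powr_iff)
  have "(\<Sum>k\<in>{- int n..int n}. (cmod (a k))\<^sup>2) \<le> (\<Sum>i. real i powr (- 1 - 2 * \<alpha>))" for n
    using a_sum[where b = "\<lambda>_. 1" and n = n] sum_le_suminf[OF sm, of "{1..n}"] by simp
  then obtain g where g: "coef g = a" by (rule riesz_fischer)
  show ?thesis
  proof (rule that[of g])
    fix n :: nat assume n: "n \<ge> 1"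
    have "(real n / 2) powr (2 - 2 * \<alpha>) = (real n / 2) powr (1 - 2 * \<alpha>) * (real n / 2)"
    proof -
      have "(real n / 2) powr (2 - 2 * \<alpha>) = (real n / 2) powr ((1 - 2 * \<alpha>) + 1)" by simp
      also have "\<dots> = (real n / 2) powr (1 - 2 * \<alpha>) * (real n / 2) powr 1" by (rule powr_add)
      finally show ?thesis using n by simp
    qed
    \<comment> \<open>The upper half of the index range has at least n / 2 members, and each term
      there is at least (n / 2)^(1 - 2 \<alpha>) because the exponent is positive.\<close>
    also have "\<dots> \<le> (real n / 2) powr (1 - 2 * \<alpha>) * real (card {n - n div 2..n})"
    proof (rule mult_left_mono)
      have "n \<le> 2 * (n div 2) + 1" by arith
      then have "real n \<le> 2 * real (n div 2) + 1" by linarith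
      moreover have "card {n - n div 2..n} = n div 2 + 1" by simp
      ultimately show "real n / 2 \<le> real (card {n - n div 2..n})" by simp
    qed simp
    also have "\<dots> = (\<Sum>i\<in>{n - n div 2..n}. (real n / 2) powr (1 - 2 * \<alpha>))" by simp
    also have "\<dots> \<le> (\<Sum>i\<in>{n - n div 2..n}. (weight (int i))\<^sup>2 * real i powr (- 1 - 2 * \<alpha>))"
    proof (rule sum_mono)
      fix i assume i: "i \<in> {n - n div 2..n}"
      then have "n - n div 2 \<le> i" by simp
      then have "n \<le> 2 * i" by presburger
      then have i2: "real n / 2 \<le> real i" "i \<ge> 1" using n by auto
      have "(real n / 2) powr (1 - 2 * \<alpha>) \<le> real i powr (1 - 2 * \<alpha>)"
        using i2 \<alpha> by (intro powr_mono2) auto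
      also have "\<dots> = real i powr 2 * real i powr (- 1 - 2 * \<alpha>)"
        by (simp only: powr_add[symmetric]) simp
      also have "real i powr 2 = (weight (int i))\<^sup>2" using i2 by (simp add: weight_def)
      finally show "(real n / 2) powr (1 - 2 * \<alpha>) \<le> (weight (int i))\<^sup>2 * real i powr (- 1 - 2 * \<alpha>)" .
    qed
    also have "\<dots> \<le> (\<Sum>i\<in>{1..n}. (weight (int i))\<^sup>2 * real i powr (- 1 - 2 * \<alpha>))"
      using n by (intro sum_mono2) auto
    also have "\<dots> = (\<Sum>k\<in>{- int n..int n}. (weight k)\<^sup>2 * (cmod (coef g k))\<^sup>2)"
      unfolding g a_sum ..
    finally show "(real n / 2) powr (2 - 2 * \<alpha>) \<le> (\<Sum>k\<in>{- int n..int n}. (weight k)\<^sup>2 * (cmod (coef g k))\<^sup>2)" .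
  qed
qed

text \<open>The exponent 2 - 2 \<alpha> exceeds 1, so the weighted sums grow at least linearly; n
  \<ge> 2 keeps the base n / 2 at least 1 when the powers are compared.\<close>

lemma slowly_decaying_not_sobolev:
  assumes \<alpha>: "\<alpha> < 1 / 2"
    and g: "\<And>n. n \<ge> 1 \<Longrightarrow>
    (real n / 2) powr (2 - 2 * \<alpha>) \<le> (\<Sum>k\<in>{- int n..int n}. (weight k)\<^sup>2 * (cmod (coef g k))\<^sup>2)"
  shows "g \<notin> sobolev 1"
proof
  assume "g \<in> sobolev 1"
  then obtain B where B: "\<And>n. (\<Sum>k\<in>{- int n..int n}. (1 + (real_of_int k)\<^sup>2) powr 1 * (cmod (coef g k))\<^sup>2) \<le> B"
    unfolding sobolev_iff by blast
  have le: "real n / 2 \<le> B" if n: "n \<ge> 2" for n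
  proof -
    have "real n / 2 = (real n / 2) powr 1" using n by simp
    also have "\<dots> \<le> (real n / 2) powr (2 - 2 * \<alpha>)" using n \<alpha> by (intro powr_mono) auto
    also have "\<dots> \<le> (\<Sum>k\<in>{- int n..int n}. (weight k)\<^sup>2 * (cmod (coef g k))\<^sup>2)" using g n by simp
    also have "\<dots> \<le> (\<Sum>k\<in>{- int n..int n}. (1 + (real_of_int k)\<^sup>2) powr 1 * (cmod (coef g k))\<^sup>2)"
    proof (intro sum_mono mult_right_mono)
      fix k :: int
      show "(weight k)\<^sup>2 \<le> (1 + (real_of_int k)\<^sup>2) powr 1"
        by (auto simp: weight_def max_def add_nonneg_nonneg)
    qed simp
    finally show ?thesis using B[of n] by linarith
  qed
  obtain n :: nat where "real n > 2 * B" using reals_Archimedean2 by blast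
  moreover have "real n \<le> real (max n 2)" by simp
  ultimately show False using le[of "max n 2"] by linarith
qed

theorem theorem1p1:
  shows
    "(\<forall>(\<Omega> :: complex set) (\<gamma> :: real \<Rightarrow> complex) (g :: l2) (\<tau> :: proj_method).
        open \<Omega> \<and> connected \<Omega> \<and> bounded \<Omega> \<and> simply_connected \<Omega> \<and>
        parametrized_boundary \<Omega> \<gamma> \<and>
        (\<exists>z\<^sub>0\<in>\<Omega>. \<forall>x\<in>frontier \<Omega>. cmod (x - z\<^sub>0) \<noteq> 1) \<and>
        g \<notin> sobolev 1 \<longrightarrow>
          filterlim (\<lambda>n. norm (proj_solution \<tau> (symm_op \<gamma>) n g)) at_top sequentially \<and>
          (\<lambda>n. norm (proj_solution \<tau> (symm_op \<gamma>) n g)) \<in> O(\<lambda>n. real n))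
     \<and>
     (\<forall>\<alpha>\<in>{0<..<1 / 2 :: real}.
        \<exists>g :: l2. g \<notin> sobolev 1 \<and>
          (\<exists>c>0. \<forall>n\<ge>1. \<forall>\<tau>.
             c * real n powr (1 - \<alpha>) \<le> norm (proj_solution \<tau> (symm_op circle_param) n g)))"
proof (intro conjI allI impI ballI; (elim conjE bexE)?)
  fix \<Omega> :: "complex set" and \<gamma> g \<tau> z0
  assume "open \<Omega>" "bounded \<Omega>" "parametrized_boundary \<Omega> \<gamma>" "z0 \<in> \<Omega>" "\<forall>x\<in>frontier \<Omega>. cmod (x - z0) \<noteq> 1"
    and g: "g \<notin> sobolev 1"
  then obtain B where "smoothing_op (symm_op \<gamma>) B" using symm_op_smoothing_op by metis
  then interpret smoothing_op "symm_op \<gamma>" B .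
  show "filterlim (\<lambda>n. norm (proj_solution \<tau> (symm_op \<gamma>) n g)) at_top sequentially"
    and "(\<lambda>n. norm (proj_solution \<tau> (symm_op \<gamma>) n g)) \<in> O(\<lambda>n. real n)"
    by (rule divergence[OF g])+
next
  fix \<alpha> :: real assume "\<alpha> \<in> {0<..<1 / 2}"
  then have \<alpha>: "0 < \<alpha>" "\<alpha> < 1 / 2" by auto
  obtain g where g: "\<And>n. n \<ge> 1 \<Longrightarrow>
    (real n / 2) powr (2 - 2 * \<alpha>) \<le> (\<Sum>k\<in>{- int n..int n}. (weight k)\<^sup>2 * (cmod (coef g k))\<^sup>2)"
    using slowly_decaying_coefficients[OF \<alpha>] by blast
  have "(1 / 2) powr (1 - \<alpha>) * real n powr (1 - \<alpha>) \<le> norm (proj_solution \<tau> (symm_op circle_param) n g)"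
    if "n \<ge> 1" for n \<tau>
  proof -
    have "(1 / 2) powr (1 - \<alpha>) * real n powr (1 - \<alpha>) = sqrt ((real n / 2) powr (2 - 2 * \<alpha>))"
    proof -
      have "sqrt ((real n / 2) powr (2 - 2 * \<alpha>)) = (real n / 2) powr ((2 - 2 * \<alpha>) / 2)"
        by (simp add: powr_half_sqrt[symmetric] powr_powr)
      also have "\<dots> = (1 / 2 * real n) powr (1 - \<alpha>)" by (simp add: diff_divide_distrib)
      also have "\<dots> = (1 / 2) powr (1 - \<alpha>) * real n powr (1 - \<alpha>)" by (simp only: powr_mult)
      finally show ?thesis by simp
    qed
    also have "\<dots> \<le> sqrt (\<Sum>k\<in>{- int n..int n}. (weight k)\<^sup>2 * (cmod (coef g k))\<^sup>2)"
      using g[OF that] by simp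
    also have "\<dots> \<le> norm (proj_solution \<tau> (symm_op circle_param) n g)" by (rule proj_solution_circle)
    finally show ?thesis .
  qed
  moreover have "g \<notin> sobolev 1" by (rule slowly_decaying_not_sobolev[OF \<alpha>(2) g])
  ultimately show "\<exists>g. g \<notin> sobolev 1 \<and> (\<exists>c>0. \<forall>n\<ge>1. \<forall>\<tau>.
      c * real n powr (1 - \<alpha>) \<le> norm (proj_solution \<tau> (symm_op circle_param) n g))"
    by (intro exI[of _ g] conjI exI[of _ "(1 / 2) powr (1 - \<alpha>)"]) auto
qed

end
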